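(* Let $\mathcal{M}$ and $\mathcal{N}$ be $AW^*$-factors of Type I. Then every spectral order isomorphism $\varphi:\mathcal{M}_+\to\mathcal{N}_+$ is canonical, i.e. there exist a strictly increasing bijection $f:[0,\infty)\to[0,\infty)$ and a projection isomorphism $\tau:P(\mathcal{M})\to P(\mathcal{N})$ such that $\varphi(x)=\Theta_\tau(f(x))$ for all $x\in\mathcal{M}_+$.
   Context: An $AW^*$-algebra is a C*-algebra $\mathcal{M}$ such that for every nonempty $S\subseteq\mathcal{M}$ there is a projection $p$ with $\{x\in\mathcal{M}: sx=0\ \forall s\in S\}=p\mathcal{M}$; it is unital and its projections $P(\mathcal{M})$ form a complete lattice under the Löwner order $\le$. An $AW^*$-factor is an $AW^*$-algebra with one-dimensional center. $\mathcal{M}_{sa}$, $\mathcal{M}_+$ denote the self-adjoint and positive parts. Every $x\in\mathcal{M}_{sa}$ has a unique spectral family $(E^x_\lambda)_{\lambda\in\mathbb{R}}$ of projections: increasing in $\lambda$, right-continuous ($E^x_\lambda=\bigwedge_{\mu>\lambda}E^x_\mu$), equal to $0$ for $\lambda<-\alpha$ and $\mathbf{1}$ for $\lambda>\alpha$ for some $\alpha>0$, with $xE^x_\lambda\le\lambda E^x_\lambda$ and $\lambda(\mathbf{1}-E^x_\lambda)\le x(\mathbf{1}-E^x_\lambda)$. The spectral order on $\mathcal{M}_{sa}$ is $x\preceq y$ iff $E^y_\lambda\le E^x_\lambda$ for all $\lambda$. A spectral order isomorphism between subsets of self-adjoint parts is a bijection $\varphi$ with $x\preceq y\iff\varphi(x)\preceq\varphi(y)$.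 A projection isomorphism $\tau:P(\mathcal{M})\to P(\mathcal{N})$ is a bijection with $p\le q\iff\tau(p)\le\tau(q)$; it induces $\Theta_\tau:\mathcal{M}_{sa}\to\mathcal{N}_{sa}$ by $E^{\Theta_\tau(x)}_\lambda=\tau(E^x_\lambda)$ for all $\lambda$. $f(x)$ denotes continuous functional calculus. *)

theory Defs
  imports "HOL-Analysis.Analysis" "HOL-Computational_Algebra.Polynomial"
begin

class cstar_algebra = real_normed_algebra_1 + banach +
  fixes scaleC :: "complex \<Rightarrow> 'a \<Rightarrow> 'a"
    and adj :: "'a \<Rightarrow> 'a"
  assumes scaleC_of_real: "scaleC (complex_of_real r) x = scaleR r x"
    and scaleC_add_left: "scaleC (a + b) x = scaleC a x + scaleC b x"
    and scaleC_add_right: "scaleC a (x + y) = scaleC a x + scaleC a y"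
    and scaleC_scaleC: "scaleC a (scaleC b x) = scaleC (a * b) x"
    and scaleC_one: "scaleC 1 x = x"
    and scaleC_mult_left: "scaleC a x * y = scaleC a (x * y)"
    and scaleC_mult_right: "x * scaleC a y = scaleC a (x * y)"
    and norm_scaleC: "norm (scaleC a x) = cmod a * norm x"
    and adj_adj: "adj (adj x) = x"
    and adj_add: "adj (x + y) = adj x + adj y"
    and adj_mult: "adj (x * y) = adj y * adj x"
    and adj_scaleC: "adj (scaleC a x) = scaleC (cnj a) (adj x)"
    and cstar_identity: "norm (adj x * x) = (norm x)^2"

definition cs_invertible :: "'a::cstar_algebra \<Rightarrow> bool" where
  "cs_invertible x \<longleftrightarrow> (\<exists>y. x * y = 1 \<and> y * x = 1)"

definition cs_spectrum :: "'a::cstar_algebra \<Rightarrow> complex set" where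
  "cs_spectrum x = {c. \<not> cs_invertible (x - scaleC c 1)}"

definition cs_sa :: "'a::cstar_algebra \<Rightarrow> bool" where
  "cs_sa x \<longleftrightarrow> adj x = x"

definition cs_pos :: "'a::cstar_algebra \<Rightarrow> bool" where
  "cs_pos x \<longleftrightarrow> cs_sa x \<and> cs_spectrum x \<subseteq> {c. Im c = 0 \<and> Re c \<ge> 0}"

definition cs_le :: "'a::cstar_algebra \<Rightarrow> 'a \<Rightarrow> bool" where
  "cs_le x y \<longleftrightarrow> cs_sa x \<and> cs_sa y \<and> cs_pos (y - x)"

definition cs_proj :: "'a::cstar_algebra \<Rightarrow> bool" where
  "cs_proj p \<longleftrightarrow> adj p = p \<and> p * p = p"

definition cs_center :: "'a::cstar_algebra set" where
  "cs_center = {z. \<forall>x. z * x = x * z}"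

definition aw_star :: "'a::cstar_algebra itself \<Rightarrow> bool" where
  "aw_star _ \<longleftrightarrow> (\<forall>S::'a set. S \<noteq> {} \<longrightarrow>
     (\<exists>p. cs_proj p \<and> {x. \<forall>s\<in>S. s * x = 0} = {p * y | y. True}))"

definition aw_factor :: "'a::cstar_algebra itself \<Rightarrow> bool" where
  "aw_factor T \<longleftrightarrow> aw_star T \<and> (cs_center :: 'a set) = {scaleC c 1 | c. True}"

definition cs_abelian_proj :: "'a::cstar_algebra \<Rightarrow> bool" where
  "cs_abelian_proj e \<longleftrightarrow> cs_proj e \<and>
     (\<forall>x y. (e * x * e) * (e * y * e) = (e * y * e) * (e * x * e))"

text \<open>Type I (Kaplansky): there is an abelian projection with central cover 1,
i.e. the only central projection dominating it is 1.\<close>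
definition aw_typeI :: "'a::cstar_algebra itself \<Rightarrow> bool" where
  "aw_typeI _ \<longleftrightarrow> (\<exists>e::'a. cs_abelian_proj e \<and>
     (\<forall>z. cs_proj z \<and> z \<in> cs_center \<and> cs_le e z \<longrightarrow> z = 1))"

definition proj_glb :: "'a::cstar_algebra set \<Rightarrow> 'a \<Rightarrow> bool" where
  "proj_glb A p \<longleftrightarrow> cs_proj p \<and> (\<forall>q\<in>A. cs_le p q) \<and>
     (\<forall>r. cs_proj r \<and> (\<forall>q\<in>A. cs_le r q) \<longrightarrow> cs_le r p)"

definition is_spectral_family :: "'a::cstar_algebra \<Rightarrow> (real \<Rightarrow> 'a) \<Rightarrow> bool" where
  "is_spectral_family x E \<longleftrightarrow>
     (\<forall>l. cs_proj (E l)) \<and>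
     (\<forall>l \<mu>. l \<le> \<mu> \<longrightarrow> cs_le (E l) (E \<mu>)) \<and>
     (\<forall>l. proj_glb {E \<mu> | \<mu>. \<mu> > l} (E l)) \<and>
     (\<exists>\<alpha>>0. (\<forall>l< -\<alpha>. E l = 0) \<and> (\<forall>l>\<alpha>. E l = 1)) \<and>
     (\<forall>l. cs_le (x * E l) (scaleR l (E l))) \<and>
     (\<forall>l. cs_le (scaleR l (1 - E l)) (x * (1 - E l)))"

definition spectral_family :: "'a::cstar_algebra \<Rightarrow> real \<Rightarrow> 'a" where
  "spectral_family x = (THE E. is_spectral_family x E)"

definition spectral_le :: "'a::cstar_algebra \<Rightarrow> 'a \<Rightarrow> bool" where
  "spectral_le x y \<longleftrightarrow> (\<forall>l. cs_le (spectral_family y l) (spectral_family x l))"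

definition spectral_order_iso :: "('a::cstar_algebra \<Rightarrow> 'b::cstar_algebra) \<Rightarrow> 'a set \<Rightarrow> 'b set \<Rightarrow> bool" where
  "spectral_order_iso \<phi> A B \<longleftrightarrow> bij_betw \<phi> A B \<and>
     (\<forall>x\<in>A. \<forall>y\<in>A. spectral_le x y \<longleftrightarrow> spectral_le (\<phi> x) (\<phi> y))"

definition proj_iso :: "('a::cstar_algebra \<Rightarrow> 'b::cstar_algebra) \<Rightarrow> bool" where
  "proj_iso \<tau> \<longleftrightarrow> bij_betw \<tau> {p. cs_proj p} {q. cs_proj q} \<and>
     (\<forall>p q. cs_proj p \<and> cs_proj q \<longrightarrow> (cs_le p q \<longleftrightarrow> cs_le (\<tau> p) (\<tau> q)))"

definition Theta :: "('a::cstar_algebra \<Rightarrow> 'b::cstar_algebra) \<Rightarrow> 'a \<Rightarrow> 'b" where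
  "Theta \<tau> x = (THE y. cs_sa y \<and> (\<forall>l. spectral_family y l = \<tau> (spectral_family x l)))"

definition poly_eval :: "real poly \<Rightarrow> 'a::cstar_algebra \<Rightarrow> 'a" where
  "poly_eval p x = (\<Sum>i\<le>degree p. scaleR (coeff p i) (x ^ i))"

definition real_spectrum :: "'a::cstar_algebra \<Rightarrow> real set" where
  "real_spectrum x = {t. complex_of_real t \<in> cs_spectrum x}"

text \<open>f(x) for self-adjoint x and f continuous on the spectrum: the limit of p_n(x)
for any sequence of real polynomials p_n converging uniformly to f on the spectrum.\<close>
definition cfc :: "(real \<Rightarrow> real) \<Rightarrow> 'a::cstar_algebra \<Rightarrow> 'a" where
  "cfc f x = (THE y. \<forall>P :: nat \<Rightarrow> real poly.
      (\<forall>\<epsilon>>0. \<exists>N. \<forall>n\<ge>N. \<forall>t\<in>real_spectrum x. \<bar>poly (P n) t - f t\<bar> < \<epsilon>) \<longrightarrow>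
      (\<lambda>n. poly_eval (P n) x) \<longlonglongrightarrow> y)"

end

theory Submission
  imports Defs "HOL-Computational_Algebra.Fundamental_Theorem_Algebra"
begin

text \<open>
  In a type I factor every nonzero projection dominates an atom, so the projection lattice is
  atomistic. Positive elements whose lower sets for the spectral order are chains are exactly the
  multiples \<open>a e\<close> with \<open>a \<ge> 0\<close> and \<open>e\<close> an atom, hence an isomorphism maps \<open>a e\<close> to
  \<open>f\<^sub>e(a) \<tau>(e)\<close> with a bijection \<open>\<tau>\<close> of the atoms. Any two atoms have a third one below their join,
  and comparing the three scales shows that \<open>f\<^sub>e = f\<close> does not depend on \<open>e\<close>. Since
  \<open>r \<le> E\<^sup>x\<^sub>l\<close> holds iff every atom \<open>e\<close> with \<open>a e \<preceq> x\<close> for some \<open>a > l\<close> is orthogonal to \<open>r\<close>,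
  an element is determined by the points \<open>a e\<close> below it. The map \<open>\<tau>\<close> extends to a lattice
  isomorphism \<open>T\<close>, and the projection isomorphism of the canonical form is
  \<open>p \<mapsto> 1 - T (1 - p)\<close>, because the points see the complements of the spectral projections.
\<close>

section \<open>Elementary C*-algebra\<close>

text \<open>Positivity is defined through the spectrum, so even transitivity of \<open>cs_le\<close>
  and \<open>cs_pos (adj y * y)\<close> have to be derived. Both rest on the fact that the norm of a
  self-adjoint element is attained on its spectrum. Functional calculus and annihilator projections
  then give spectral families that are unique and determine the element. The lower set of
  \<open>a e\<close> consists of the multiples \<open>c e\<close> with c between 0 and a, because an
  atom has only 0 and itself below it. Conversely, if the lower set of x is a chain, all points
  below x share one atom. The factor hypothesis is what links the scales: in a direct sum each
  summand could be rescaled by a function of its own. In a factor a partial isometry v connects two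
  orthogonal atoms e and f, and the range projection of e + v is a third atom below their join. T is
  built from suprema of atoms and respects the order, but an order isomorphism need not preserve
  orthocomplements. Hence \<open>T p\<close> and \<open>1 - T (1 - p)\<close> are kept
  apart.\<close>

lemma scaleC_zero_left [simp]: "scaleC 0 (x::'a::cstar_algebra) = 0"
  using scaleC_of_real[of 0 x] by simp

lemma scaleC_zero_right [simp]: "scaleC c (0::'a::cstar_algebra) = 0"
  using norm_scaleC[of c "0::'a"] by simp

lemma scaleC_minus_left: "scaleC (- c) (x::'a::cstar_algebra) = - scaleC c x"
  using scaleC_add_left[of c "- c" x] by (simp add: eq_neg_iff_add_eq_0 add.commute)

lemma scaleC_minus_right: "scaleC c (- x::'a::cstar_algebra) = - scaleC c x"
  using scaleC_add_right[of c x "- x"] by (simp add: eq_neg_iff_add_eq_0 add.commute)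

lemma scaleC_diff_left: "scaleC (a - b) (x::'a::cstar_algebra) = scaleC a x - scaleC b x"
  using scaleC_add_left[of a "- b" x] by (simp add: scaleC_minus_left)

lemma scaleC_diff_right: "scaleC c (x - y::'a::cstar_algebra) = scaleC c x - scaleC c y"
  using scaleC_add_right[of c x "- y"] by (simp add: scaleC_minus_right)

lemma adj_zero [simp]: "adj (0::'a::cstar_algebra) = 0"
  using adj_add[of "0::'a" 0] by simp

lemma adj_minus: "adj (- x::'a::cstar_algebra) = - adj x"
  using adj_add[of x "- x"] by (simp add: eq_neg_iff_add_eq_0 add.commute)

lemma adj_diff: "adj (x - y::'a::cstar_algebra) = adj x - adj y"
  using adj_add[of x "- y"] by (simp add: adj_minus)

lemma adj_one [simp]: "adj (1::'a::cstar_algebra) = 1"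
  using adj_mult[of "adj 1::'a" 1] by (simp add: adj_adj)

lemma adj_scaleR: "adj (r *\<^sub>R x::'a::cstar_algebra) = r *\<^sub>R adj x"
  using adj_scaleC[of "complex_of_real r" x] by (simp add: scaleC_of_real)

lemma norm_adj [simp]: "norm (adj x::'a::cstar_algebra) = norm x"
proof -
  have *: "norm y \<le> norm (adj y)" for y :: 'a
  proof (cases "y = 0")
    case False
    have "(norm y)^2 \<le> norm (adj y) * norm y"
      using cstar_identity[of y] norm_mult_ineq[of "adj y" y] by simp
    then show ?thesis using False by (simp add: power2_eq_square)
  qed simp
  show ?thesis using *[of x] *[of "adj x"] by (simp add: adj_adj)
qed

lemma tendsto_adj: "(f \<longlongrightarrow> l) F \<Longrightarrow> ((\<lambda>n. adj (f n::'a::cstar_algebra)) \<longlongrightarrow> adj l) F"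
  by (simp add: tendsto_iff dist_norm flip: adj_diff)

lemma adj_mult_self_eq_0: "adj x * x = 0 \<longleftrightarrow> x = (0::'a::cstar_algebra)"
  using cstar_identity[of x] by auto

lemma sa_square_norm:
  assumes "cs_sa (x::'a::cstar_algebra)" shows "norm (x * x) = norm x ^ 2"
  using assms cstar_identity[of x] by (simp add: cs_sa_def)

lemma cs_sa_scaleR: "cs_sa x \<Longrightarrow> cs_sa (r *\<^sub>R x)"
  and cs_sa_add: "cs_sa x \<Longrightarrow> cs_sa y \<Longrightarrow> cs_sa (x + y)"
  and cs_sa_diff: "cs_sa x \<Longrightarrow> cs_sa y \<Longrightarrow> cs_sa (x - y)"
  and cs_sa_one: "cs_sa 1"
  and cs_sa_zero: "cs_sa 0"
  and cs_sa_adj_mult: "cs_sa (adj z * z)"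
  and cs_sa_mult: "cs_sa x \<Longrightarrow> cs_sa y \<Longrightarrow> x * y = y * x \<Longrightarrow> cs_sa (x * y)"
  for x y z :: "'a::cstar_algebra"
  by (simp_all add: cs_sa_def adj_scaleR adj_add adj_diff adj_minus adj_mult adj_adj)

lemma cs_sa_power: "cs_sa x \<Longrightarrow> cs_sa (x ^ n)" for x :: "'a::cstar_algebra"
proof (induction n)
  case (Suc n)
  then show ?case using cs_sa_mult[of x "x^n"] by (simp add: power_commutes)
qed (simp add: cs_sa_one)

lemma cs_sa_sum: "(\<And>i. i \<in> I \<Longrightarrow> cs_sa (g i)) \<Longrightarrow> cs_sa (sum g I)"
  for g :: "'i \<Rightarrow> 'a::cstar_algebra"
  by (induction I rule: infinite_finite_induct) (auto simp: cs_sa_zero cs_sa_add)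

section \<open>Invertibility and the spectrum\<close>

lemma neumann_invertible:
  fixes x :: "'a::cstar_algebra"
  assumes "norm x < 1" shows "cs_invertible (1 - x)"
proof -
  have s: "summable (\<lambda>n. x ^ n)"
  proof (rule summable_comparison_test)
    show "\<exists>N. \<forall>n\<ge>N. norm (x ^ n) \<le> norm x ^ n" by (auto intro: norm_power_ineq)
    show "summable (\<lambda>n. norm x ^ n)" using assms by (simp add: summable_geometric)
  qed
  define y where "y = (\<Sum>n. x ^ n)"
  have h: "y = 1 + (\<Sum>n. x ^ Suc n)"
    using suminf_split_head[OF s] by (simp add: y_def)
  have l: "(\<Sum>n. x ^ Suc n) = x * y"
    using suminf_mult[OF s, of x] by (simp add: y_def)
  have r: "(\<Sum>n. x ^ Suc n) = y * x"
    using suminf_mult2[OF s, of x] by (simp only: y_def power_Suc2)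
  show ?thesis unfolding cs_invertible_def
  proof (intro exI[of _ y] conjI)
    show "(1 - x) * y = 1" using h l by (simp add: algebra_simps)
    show "y * (1 - x) = 1" using h r by (simp add: algebra_simps)
  qed
qed

lemma cs_invertible_mult:
  "cs_invertible x \<Longrightarrow> cs_invertible y \<Longrightarrow> cs_invertible (x * y)" for x y :: "'a::cstar_algebra"
proof -
  assume "cs_invertible x" "cs_invertible y"
  then obtain a b where *: "x * a = 1" "a * x = 1" "y * b = 1" "b * y = 1"
    unfolding cs_invertible_def by blast
  have "(x * y) * (b * a) = x * (y * b) * a" "(b * a) * (x * y) = b * (a * x) * y"
    by (simp_all add: mult.assoc)
  then show ?thesis unfolding cs_invertible_def using * by (intro exI[of _ "b * a"]) simp
qed

lemma cs_invertible_scaleC: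
  "c \<noteq> 0 \<Longrightarrow> cs_invertible x \<Longrightarrow> cs_invertible (scaleC c x)" for x :: "'a::cstar_algebra"
proof -
  assume c: "c \<noteq> 0" and "cs_invertible x"
  then obtain a where *: "x * a = 1" "a * x = 1" unfolding cs_invertible_def by blast
  show ?thesis unfolding cs_invertible_def
    by (rule exI[of _ "scaleC (inverse c) a"])
       (simp add: scaleC_mult_left scaleC_mult_right scaleC_scaleC * c scaleC_one)
qed

lemma not_cs_invertible_zero: "\<not> cs_invertible (0::'a::cstar_algebra)"
  by (simp add: cs_invertible_def)

lemma spectrum_bounded:
  fixes x :: "'a::cstar_algebra"
  assumes "c \<in> cs_spectrum x" shows "cmod c \<le> norm x"
proof (rule ccontr)
  assume "\<not> cmod c \<le> norm x"
  then have lt: "norm x < cmod c" by simp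
  then have c: "c \<noteq> 0" by (metis norm_ge_zero norm_zero not_less)
  have "norm x / cmod c < 1" using lt c by simp
  then have "norm (scaleC (inverse c) x) < 1" by (simp add: norm_scaleC norm_inverse divide_inverse mult.commute)
  then have "cs_invertible (scaleC (- c) (1 - scaleC (inverse c) x))"
    using c by (intro cs_invertible_scaleC neumann_invertible) auto
  moreover have "scaleC (- c) (1 - scaleC (inverse c) x) = x - scaleC c 1"
    using c by (simp add: scaleC_diff_right scaleC_scaleC scaleC_minus_left scaleC_one)
  ultimately show False using assms by (simp add: cs_spectrum_def)
qed

lemma spectrum_shift:
  "c \<in> cs_spectrum x \<Longrightarrow> c + d \<in> cs_spectrum (x + scaleC d 1)" for x :: "'a::cstar_algebra"
  by (simp add: cs_spectrum_def scaleC_add_left algebra_simps)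

text \<open>Arens' trick: compare the spectral bound with the norm of \<open>x + it\<close> as \<open>t\<close> tends to infinity.\<close>
lemma sa_spectrum_real:
  fixes x :: "'a::cstar_algebra"
  assumes x: "cs_sa x" and c: "c \<in> cs_spectrum x" shows "Im c = 0"
proof -
  have bd: "2 * Im c * t \<le> (norm x)^2" for t
  proof -
    let ?y = "x + scaleC (\<i> * complex_of_real t) 1"
    have "adj ?y * ?y = (x - scaleC (\<i> * complex_of_real t) 1) * ?y"
      using x by (simp add: cs_sa_def adj_add adj_scaleC scaleC_minus_left)
    also have "\<dots> = x * x - scaleC ((\<i> * complex_of_real t) * (\<i> * complex_of_real t)) 1"
      by (simp add: algebra_simps scaleC_mult_left scaleC_mult_right scaleC_scaleC scaleC_diff_right)
    also have "(\<i> * complex_of_real t) * (\<i> * complex_of_real t) = complex_of_real (- (t^2))"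
      by (simp add: power2_eq_square algebra_simps)
    also have "x * x - scaleC (complex_of_real (- (t^2))) 1 = x * x + (t^2) *\<^sub>R 1"
      by (simp only: scaleC_of_real) simp
    finally have "(norm ?y)^2 = norm (x * x + (t^2) *\<^sub>R 1)" by (metis cstar_identity)
    also have "\<dots> \<le> norm (x * x) + norm ((t^2) *\<^sub>R (1::'a))" by (rule norm_triangle_ineq)
    finally have 1: "(norm ?y)^2 \<le> (norm x)^2 + t^2" using sa_square_norm[OF x] by simp
    have "cmod (c + \<i> * complex_of_real t) \<le> norm ?y"
      using spectrum_bounded[OF spectrum_shift[OF c]] .
    then have "(cmod (c + \<i> * complex_of_real t))^2 \<le> (norm ?y)^2" by (simp add: power_mono)
    with 1 have "(Re c)^2 + (Im c + t)^2 \<le> (norm x)^2 + t^2" by (simp add: cmod_power2)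
    then have "(Re c)^2 + (Im c)^2 + 2 * Im c * t \<le> (norm x)^2"
      by (simp add: power2_sum algebra_simps)
    then show ?thesis by (smt (verit) zero_le_power2)
  qed
  show ?thesis
  proof (rule ccontr)
    assume "Im c \<noteq> 0"
    then show False using bd[of "((norm x)^2 + 1) / (2 * Im c)"] by simp
  qed
qed

lemma sa_spectrum_iff_real_spectrum:
  fixes x :: "'a::cstar_algebra"
  assumes "cs_sa x" shows "c \<in> cs_spectrum x \<longleftrightarrow> Im c = 0 \<and> Re c \<in> real_spectrum x"
  using sa_spectrum_real[OF assms, of c]
  by (auto simp: real_spectrum_def complex_eq_iff intro: back_subst[of "\<lambda>c. c \<in> cs_spectrum x"])

lemma real_spectrum_alt: "t \<in> real_spectrum x \<longleftrightarrow> \<not> cs_invertible (x - t *\<^sub>R (1::'a::cstar_algebra))"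
  by (simp add: real_spectrum_def cs_spectrum_def scaleC_of_real)

lemma real_spectrum_bounded: "t \<in> real_spectrum x \<Longrightarrow> \<bar>t\<bar> \<le> norm x"
  using spectrum_bounded[of "complex_of_real t" x] by (simp add: real_spectrum_def)

lemma cs_pos_iff: "cs_pos x \<longleftrightarrow> cs_sa x \<and> (\<forall>t\<in>real_spectrum x. 0 \<le> t)"
proof (cases "cs_sa x")
  case True
  show ?thesis
    unfolding cs_pos_def using True sa_spectrum_iff_real_spectrum[OF True]
    by (auto simp: subset_iff) (metis Im_complex_of_real Re_complex_of_real)
qed (simp add: cs_pos_def)

section \<open>The norm of a self-adjoint element is its spectral radius\<close>

text \<open>The inverse is an argument here, in contrast to \<open>cs_invertible\<close>, because
  the resolvent estimates below follow the norms of specific inverses.\<close>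

definition mutually_inverse :: "'a::cstar_algebra \<Rightarrow> 'a \<Rightarrow> bool" where
  "mutually_inverse x y \<longleftrightarrow> x * y = 1 \<and> y * x = 1"

text \<open>Partial fractions: \<open>1 / (1 - u^2)\<close> is the mean of
  \<open>1 / (1 - u)\<close> and \<open>1 / (1 + u)\<close>.\<close>

lemma mutually_inverse_average:
  fixes u A B :: "'a::cstar_algebra"
  assumes "mutually_inverse (1 - u) A" "mutually_inverse (1 + u) B"
  shows "mutually_inverse (1 - u * u) ((1/2) *\<^sub>R (A + B))"
proof -
  have a: "(1 - u) * A = 1" "A * (1 - u) = 1" "(1 + u) * B = 1" "B * (1 + u) = 1"
    using assms by (auto simp: mutually_inverse_def)
  have e: "1 - u * u = (1 + u) * (1 - u)" "1 - u * u = (1 - u) * (1 + u)"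
    by (simp_all add: algebra_simps)
  have "(1 - u * u) * (A + B) = (1 + u) * ((1 - u) * A) + (1 - u) * ((1 + u) * B)"
    unfolding distrib_left by (subst (1) e(1), subst (1) e(2)) (simp only: mult.assoc)
  then have 1: "(1 - u * u) * (A + B) = 2" by (simp add: a)
  have "(A + B) * (1 - u * u) = (A * (1 - u)) * (1 + u) + (B * (1 + u)) * (1 - u)"
    unfolding distrib_right by (subst (1) e(2), subst (1) e(1)) (simp only: mult.assoc)
  then have 2: "(A + B) * (1 - u * u) = 2" by (simp add: a)
  have "(1/2) *\<^sub>R (2 *\<^sub>R (1::'a)) = 1" by simp
  then have "(1/2) *\<^sub>R (2::'a) = 1" by (simp only: scaleR_2 one_add_one)
  with 1 2 show ?thesis by (simp add: mutually_inverse_def)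
qed

text \<open>The resolvent identity \<open>y' - y = y' * (x - x') * y\<close> bounds the difference
  once the norm of y' is under control, and the smallness hypothesis gives
  \<open>norm y' \<le> 2 * norm y\<close>.\<close>

lemma inverse_norm_diff:
  fixes x x' y y' :: "'a::cstar_algebra"
  assumes i: "mutually_inverse x y" "mutually_inverse x' y'"
    and d: "norm (x' - x) * norm y \<le> 1/2"
  shows "norm (y' - y) \<le> 2 * norm y ^ 2 * norm (x' - x)"
proof -
  have "y' - y = y' * (x - x') * y"
    using i by (simp add: mutually_inverse_def algebra_simps)
  moreover have "norm (y' * (x - x') * y) \<le> norm (y' * (x - x')) * norm y" by (rule norm_mult_ineq)
  moreover have "norm (y' * (x - x')) * norm y \<le> norm y' * norm (x - x') * norm y"
    by (intro mult_right_mono norm_mult_ineq) simp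
  ultimately have 1: "norm (y' - y) \<le> norm y' * norm (x' - x) * norm y"
    by (simp add: norm_minus_commute)
  also have "\<dots> \<le> norm y' * (1/2)" using mult_left_mono[OF d, of "norm y'"] by (simp add: mult.assoc)
  finally have "norm y' \<le> 2 * norm y" using norm_triangle_ineq2[of y' y] by simp
  then have "norm y' * norm (x' - x) * norm y \<le> 2 * norm y * norm (x' - x) * norm y"
    by (intro mult_right_mono) auto
  with 1 show ?thesis by (simp add: power2_eq_square algebra_simps)
qed

lemma resolvent_continuous:
  fixes a :: "'a::cstar_algebra"
  assumes R: "\<And>z. z \<in> S \<Longrightarrow> mutually_inverse (1 - scaleC z a) (R z)"
  shows "continuous_on S R"
  unfolding continuous_on_iff
proof (intro ballI allI impI)
  fix z and e :: real assume z: "z \<in> S" and e: "0 < e"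
  define K where "K = norm (R z) + 1"
  define L where "L = norm a + 1"
  have KL: "K > 0" "L > 0" by (auto simp: K_def L_def add_nonneg_pos)
  \<comment> \<open>The first bound secures the smallness hypothesis of
    \<open>inverse_norm_diff\<close>, the second makes its conclusion at most \<open>e / 2\<close>;
    the summands 1 in K and L exclude division by zero.\<close>
  define d where "d = min (1 / (2 * K * L)) (e / (4 * K^2 * L))"
  have "0 < d" using KL e by (simp add: d_def)
  moreover have "dist (R w) (R z) < e" if w: "w \<in> S" "dist w z < d" for w
  proof -
    have "(1 - scaleC w a) - (1 - scaleC z a) = scaleC (z - w) a" by (simp add: scaleC_diff_left)
    then have n: "norm ((1 - scaleC w a) - (1 - scaleC z a)) \<le> d * L"
      using w(2) \<open>0 < d\<close> by (simp add: norm_scaleC L_def dist_norm norm_minus_commute) (intro mult_mono, auto)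
    have "d * L * K \<le> 1 / (2 * K * L) * L * K"
      using KL by (intro mult_right_mono) (auto simp: d_def)
    then have dLK: "d * L * K \<le> 1/2" using KL by simp
    have "norm ((1 - scaleC w a) - (1 - scaleC z a)) * norm (R z) \<le> d * L * K"
      using n KL by (intro mult_mono) (auto simp: K_def d_def e less_imp_le)
    then have "norm (R w - R z) \<le> 2 * norm (R z) ^ 2 * norm ((1 - scaleC w a) - (1 - scaleC z a))"
      using dLK by (intro inverse_norm_diff R z w) auto
    also have "\<dots> \<le> 2 * K^2 * (d * L)"
      using n KL by (intro mult_mono power_mono) (auto simp: K_def)
    also have "\<dots> \<le> 2 * K^2 * (e / (4 * K^2 * L) * L)"
      using KL by (intro mult_left_mono mult_right_mono) (auto simp: d_def)
    also have "\<dots> = e / 2" using KL by simp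
    finally show ?thesis using e by (simp add: dist_norm)
  qed
  ultimately show "\<exists>d>0. \<forall>w\<in>S. dist w z < d \<longrightarrow> dist (R w) (R z) < e" by blast
qed

text \<open>Rickart's argument: averaging the resolvent over the \<open>2 ^ k\<close>-th roots of unity yields
  \<open>(1 - a ^ (2 ^ k))\<close> inverted, and uniform continuity of the resolvent on the disc forces
  these inverses to be close to 1.\<close>
lemma exists_singular_resolvent:
  fixes a :: "'a::cstar_algebra"
  assumes n: "\<And>k. norm (a ^ (2 ^ k)) = 1"
  shows "\<exists>z. cmod z \<le> 1 \<and> \<not> cs_invertible (1 - scaleC z a)"
proof (rule ccontr)
  assume "\<not> ?thesis"
  then have "\<forall>z. cmod z \<le> 1 \<longrightarrow> (\<exists>y. mutually_inverse (1 - scaleC z a) y)"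
    by (auto simp: cs_invertible_def mutually_inverse_def)
  then obtain R where R: "\<And>z. cmod z \<le> 1 \<Longrightarrow> mutually_inverse (1 - scaleC z a) (R z)" by metis
  have "continuous_on (cball 0 1) R" by (rule resolvent_continuous[where a = a]) (simp add: R)
  then have "uniformly_continuous_on (cball 0 1) R" by (rule compact_uniformly_continuous) simp
  then obtain d where d: "d > 0" "\<And>z w. cmod z \<le> 1 \<Longrightarrow> cmod w \<le> 1 \<Longrightarrow> dist z w < d \<Longrightarrow> dist (R z) (R w) < 1/12"
    unfolding uniformly_continuous_on_def
    by (metis dist_0_norm mem_cball zero_less_divide_1_iff zero_less_numeral)
  \<comment> \<open>Shrinking z to \<open>r z\<close> moves it by less than d on the whole disc; 1/2
    keeps r positive.\<close>
  define r where "r = max (1/2) (1 - d/2)"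
  have r: "0 < r" "r < 1" "1 - r < d" using d(1) by (auto simp: r_def)
  \<comment> \<open>\<open>A z\<close> is to be the mean of R over the \<open>2^k\<close> rotations
    of z by roots of unity. A mean of differences obeys the same bound, so 1/12 stays valid while
    \<open>r ^ (2^k)\<close> tends to 0.\<close>
  have "\<exists>A. (\<forall>z. cmod z \<le> 1 \<longrightarrow> mutually_inverse (1 - scaleC (z ^ (2^k)) (a ^ (2^k))) (A z)) \<and>
            (\<forall>z. cmod z \<le> 1 \<longrightarrow> norm (A z - A (of_real r * z)) \<le> 1/12)" for k
  proof (induction k)
    case 0
    have "norm (R z - R (of_real r * z)) \<le> 1/12" if z: "cmod z \<le> 1" for z
    proof -
      have "z - of_real r * z = of_real (1 - r) * z" by (simp add: algebra_simps)
      then have "dist z (of_real r * z) = (1 - r) * cmod z" using r by (simp add: dist_norm norm_mult flip: of_real_diff)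
      also have "\<dots> \<le> (1 - r) * 1" using r z by (intro mult_left_mono) auto
      finally have "dist z (of_real r * z) < d" using r by simp
      moreover have "cmod (of_real r * z) \<le> 1" using r z by (simp add: norm_mult mult_le_one)
      ultimately show ?thesis using d(2)[of z "of_real r * z"] z by (simp add: dist_norm)
    qed
    then show ?case using R by (intro exI[of _ R]) auto
  next
    case (Suc k)
    then obtain A where A: "\<And>z. cmod z \<le> 1 \<Longrightarrow> mutually_inverse (1 - scaleC (z ^ (2^k)) (a ^ (2^k))) (A z)"
      "\<And>z. cmod z \<le> 1 \<Longrightarrow> norm (A z - A (of_real r * z)) \<le> 1/12" by blast
    \<comment> \<open>A \<open>2^k\<close>-th root of -1: replacing z by \<open>w z\<close> turns 1
      - u into 1 + u, the second factor of \<open>1 - u * u\<close>.\<close>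
    define w where "w = cis (pi / 2^k)"
    have w: "cmod w = 1" "w ^ (2^k) = -1" by (simp_all add: w_def Complex.DeMoivre)
    define B where "B z = (1/2) *\<^sub>R (A z + A (w * z))" for z
    have "mutually_inverse (1 - scaleC (z ^ (2^Suc k)) (a ^ (2^Suc k))) (B z)" if z: "cmod z \<le> 1" for z
    proof -
      let ?u = "scaleC (z ^ (2^k)) (a ^ (2^k))"
      have "mutually_inverse (1 + ?u) (A (w * z))"
        using A(1)[of "w * z"] z w by (simp add: norm_mult power_mult_distrib scaleC_minus_left)
      then have "mutually_inverse (1 - ?u * ?u) (B z)"
        unfolding B_def by (intro mutually_inverse_average A(1) z)
      moreover have "?u * ?u = scaleC (z ^ (2^Suc k)) (a ^ (2^Suc k))"
        by (simp add: scaleC_mult_left scaleC_mult_right scaleC_scaleC mult_2 flip: power_add)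
      ultimately show ?thesis by simp
    qed
    moreover have "norm (B z - B (of_real r * z)) \<le> 1/12" if z: "cmod z \<le> 1" for z
    proof -
      have "B z - B (of_real r * z) = (1/2) *\<^sub>R ((A z - A (of_real r * z)) + (A (w * z) - A (of_real r * (w * z))))"
        by (simp add: B_def algebra_simps)
      then have "norm (B z - B (of_real r * z)) \<le> (1/2) * (norm (A z - A (of_real r * z)) + norm (A (w * z) - A (of_real r * (w * z))))"
        by (simp add: norm_triangle_ineq)
      also have "\<dots> \<le> (1/2) * (1/12 + 1/12)"
        using z w by (intro mult_left_mono add_mono A(2)) (auto simp: norm_mult)
      finally show ?thesis by simp
    qed
    ultimately show ?case by blast
  qed
  note AA = this
  \<comment> \<open>With \<open>r ^ (2^m) < 1/4\<close> the inverse C at radius r is within 1/3 of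
    1, hence D at radius 1 is within 1/3 + 1/12 < 1/2. Then \<open>b = (D - 1) - (D - 1) * b\<close>
    forces \<open>norm b < 1\<close>, against \<open>norm b = 1\<close>.\<close>
  have "\<exists>m. r ^ m < 1/4" using r by (intro real_arch_pow_inv) auto
  then obtain m where m: "r ^ m < 1/4" by blast
  have "r ^ (2^m) \<le> r ^ m" using r by (intro power_decreasing) (auto simp: less_imp_le[OF less_exp])
  with m have s: "r ^ (2^m) < 1/4" by simp
  define b where "b = a ^ (2^m)"
  have b: "norm b = 1" using n by (simp add: b_def)
  obtain A where A: "\<And>z. cmod z \<le> 1 \<Longrightarrow> mutually_inverse (1 - scaleC (z ^ (2^m)) b) (A z)"
      "\<And>z. cmod z \<le> 1 \<Longrightarrow> norm (A z - A (of_real r * z)) \<le> 1/12" using AA[of m] unfolding b_def by blast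
  define C where "C = A (of_real r)"
  have C: "mutually_inverse (1 - (r ^ (2^m)) *\<^sub>R b) C"
    using A(1)[of "of_real r"] r by (simp add: C_def flip: scaleC_of_real)
  have C1: "C = 1 + (r ^ (2^m)) *\<^sub>R (b * C)"
    using C by (simp add: mutually_inverse_def algebra_simps)
  have "norm (C - 1) = r ^ (2^m) * norm (b * C)" using C1 r by (metis add_diff_cancel_left' norm_scaleR abs_of_pos zero_less_power)
  also have "\<dots> \<le> 1/4 * (norm b * norm C)" using s r by (intro mult_mono norm_mult_ineq) auto
  finally have c1: "norm (C - 1) \<le> 1/4 * norm C" using b by simp
  have "norm C \<le> norm (C - 1) + 1" using norm_triangle_ineq[of "C - 1" 1] by simp
  with c1 have c2: "norm (C - 1) \<le> 1/3" by simp
  define D where "D = A 1"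
  have D: "mutually_inverse (1 - b) D" using A(1)[of 1] by (simp add: D_def scaleC_one)
  have "norm (D - C) \<le> 1/12" using A(2)[of 1] by (simp add: D_def C_def)
  then have D1: "norm (D - 1) < 1/2" using c2 norm_triangle_ineq[of "D - C" "C - 1"] by simp
  have "b = (D - 1) - (D - 1) * b" using D by (simp add: mutually_inverse_def algebra_simps)
  then have "norm b = norm ((D - 1) - (D - 1) * b)" by (rule arg_cong)
  then have "norm b \<le> norm (D - 1) + norm (D - 1) * norm b"
    using norm_triangle_ineq4[of "D - 1" "(D - 1) * b"] norm_mult_ineq[of "D - 1" b] by linarith
  then show False using D1 b by simp
qed

lemma sa_norm_power_two:
  fixes x :: "'a::cstar_algebra"
  assumes x: "cs_sa x" and "norm x = 1" shows "norm (x ^ (2 ^ k)) = 1"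
proof (induction k)
  case (Suc k)
  have "x ^ 2 ^ Suc k = x ^ 2^k * x ^ 2^k" by (simp add: mult_2 flip: power_add)
  then show ?case using sa_square_norm[OF cs_sa_power[OF x, of "2^k"]] Suc by simp
qed (simp add: assms)

text \<open>If x has norm 1, the C*-identity keeps all its \<open>2^k\<close>-th powers at norm 1,
  so some 1 - z x with \<open>cmod z \<le> 1\<close> is singular. After rescaling,
  \<open>norm x / z\<close> is a spectral point of modulus at least \<open>norm x\<close>, and it is
  real.\<close>

lemma sa_norm_attained:
  fixes x :: "'a::cstar_algebra"
  assumes x: "cs_sa x" shows "\<exists>t\<in>real_spectrum x. \<bar>t\<bar> = norm x"
proof (cases "x = 0")
  case True
  then have "0 \<in> real_spectrum x" by (simp add: real_spectrum_alt not_cs_invertible_zero)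
  then show ?thesis using True by force
next
  case False
  define a where "a = (1 / norm x) *\<^sub>R x"
  have "cs_sa a" "norm a = 1" using False x by (auto simp: a_def cs_sa_scaleR)
  then obtain z where z: "cmod z \<le> 1" "\<not> cs_invertible (1 - scaleC z a)"
    using exists_singular_resolvent[of a] sa_norm_power_two by blast
  have z0: "z \<noteq> 0" using z(2) by (auto simp: cs_invertible_def)
  define c where "c = of_real (norm x) / z"
  have c0: "c \<noteq> 0" using False z0 by (simp add: c_def)
  have "scaleC c (scaleC z a) = scaleC (of_real (norm x)) a" using z0 by (simp add: scaleC_scaleC c_def)
  then have "scaleC c (scaleC z a) = x" using False by (simp add: scaleC_of_real a_def)
  then have e: "scaleC (inverse (- c)) (x - scaleC c 1) = 1 - scaleC z a"
    using c0 by (simp add: scaleC_diff_right scaleC_scaleC scaleC_minus_left scaleC_one) 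
      (metis scaleC_scaleC left_inverse scaleC_one)
  have "c \<in> cs_spectrum x"
    using z(2) cs_invertible_scaleC[of "inverse (- c)" "x - scaleC c 1"] c0 unfolding e
    by (auto simp: cs_spectrum_def)
  then have c: "Im c = 0" "Re c \<in> real_spectrum x" using sa_spectrum_iff_real_spectrum[OF x] by auto
  have "norm x * cmod z \<le> norm x" using z(1) by (simp add: mult_left_le)
  then have "norm x \<le> cmod c" using z0 by (simp add: c_def norm_divide field_simps)
  moreover have "cmod c = \<bar>Re c\<bar>" using c(1) by (simp add: cmod_eq_Re)
  ultimately show ?thesis using c(2) real_spectrum_bounded[OF c(2)] by (intro bexI[of _ "Re c"]) auto
qed

lemma sa_norm_le:
  fixes x :: "'a::cstar_algebra"
  assumes "cs_sa x" "\<And>t. t \<in> real_spectrum x \<Longrightarrow> \<bar>t\<bar> \<le> C" shows "norm x \<le> C"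
  using sa_norm_attained[OF assms(1)] assms(2) by metis

section \<open>Continuous functional calculus\<close>

text \<open>Complex coefficients, unlike in \<open>poly_eval\<close>, let a polynomial split into
  linear factors.\<close>

definition complex_poly_eval :: "complex poly \<Rightarrow> 'a::cstar_algebra \<Rightarrow> 'a" where
  "complex_poly_eval q x = (\<Sum>i\<le>degree q. scaleC (coeff q i) (x ^ i))"

lemma complex_poly_eval_altdef:
  fixes x :: "'a::cstar_algebra"
  assumes "degree q \<le> n" shows "complex_poly_eval q x = (\<Sum>i\<le>n. scaleC (coeff q i) (x ^ i))"
  unfolding complex_poly_eval_def
  using assms by (intro sum.mono_neutral_left) (auto simp: coeff_eq_0)

lemma scaleC_sum_right: "scaleC c (sum g I) = (\<Sum>i\<in>I. scaleC c (g i))" for g :: "'i \<Rightarrow> 'a::cstar_algebra"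
  by (induction I rule: infinite_finite_induct) (auto simp: scaleC_add_right)

lemma complex_poly_eval_pCons:
  "complex_poly_eval (pCons c q) x = scaleC c 1 + x * complex_poly_eval q (x::'a::cstar_algebra)"
proof -
  have "complex_poly_eval (pCons c q) x = (\<Sum>i\<le>Suc (degree q). scaleC (coeff (pCons c q) i) (x ^ i))"
    by (rule complex_poly_eval_altdef) (rule degree_pCons_le)
  also have "\<dots> = scaleC c 1 + (\<Sum>i\<le>degree q. scaleC (coeff q i) (x ^ Suc i))"
    by (subst sum.atMost_Suc_shift) simp
  also have "(\<Sum>i\<le>degree q. scaleC (coeff q i) (x ^ Suc i)) = x * complex_poly_eval q x"
    by (simp add: complex_poly_eval_def sum_distrib_left scaleC_mult_right)
  finally show ?thesis .
qed

lemma complex_poly_eval_0 [simp]: "complex_poly_eval 0 x = (0::'a::cstar_algebra)"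
  by (simp add: complex_poly_eval_def)

lemma complex_poly_eval_add:
  "complex_poly_eval (p + q) x = complex_poly_eval p x + complex_poly_eval q (x::'a::cstar_algebra)"
proof -
  define n where "n = max (degree p) (degree q)"
  have "degree p \<le> n" "degree q \<le> n" "degree (p + q) \<le> n"
    by (auto simp: n_def degree_add_le_max)
  then show ?thesis by (simp add: complex_poly_eval_altdef[of _ n] scaleC_add_left sum.distrib)
qed

lemma complex_poly_eval_smult:
  "complex_poly_eval (smult c q) x = scaleC c (complex_poly_eval q (x::'a::cstar_algebra))"
  by (simp add: complex_poly_eval_altdef[of "smult c q" "degree q"] degree_smult_le
      complex_poly_eval_def scaleC_sum_right scaleC_scaleC)

lemma complex_poly_eval_mult:
  "complex_poly_eval (p * q) x = complex_poly_eval p x * complex_poly_eval q (x::'a::cstar_algebra)"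
proof (induction p)
  case (pCons a p)
  then show ?case
    by (simp add: complex_poly_eval_add complex_poly_eval_smult complex_poly_eval_pCons
        distrib_right scaleC_mult_left mult.assoc)
qed simp

text \<open>Each root z contributes an invertible factor x - z, and the constant that remains is
  nonzero.\<close>

lemma complex_poly_eval_invertible:
  fixes x :: "'a::cstar_algebra"
  assumes "q \<noteq> 0" "\<And>z. poly q z = 0 \<Longrightarrow> cs_invertible (x - scaleC z 1)"
  shows "cs_invertible (complex_poly_eval q x)"
  using assms
proof (induction "degree q" arbitrary: q)
  case 0
  then obtain c where c: "q = [:c:]" "c \<noteq> 0" by (metis degree_eq_zeroE pCons_0_0)
  have "cs_invertible (1::'a)" by (auto simp: cs_invertible_def)
  then show ?case using c by (simp add: complex_poly_eval_pCons cs_invertible_scaleC)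
next
  case (Suc n)
  have "\<not> constant (poly q)" using Suc.hyps(2) by (simp add: constant_degree)
  then obtain z where z: "poly q z = 0" using fundamental_theorem_of_algebra by blast
  then obtain r where r: "q = [:- z, 1:] * r" by (auto simp: poly_eq_0_iff_dvd)
  with Suc.prems have r0: "r \<noteq> 0" by auto
  have "degree q = degree [:- z, 1:] + degree r" unfolding r using r0 by (intro degree_mult_eq) auto
  with Suc.hyps(2) have "n = degree r" by simp
  then have "cs_invertible (complex_poly_eval r x)"
    by (rule Suc.hyps(1)[OF _ r0]) (use Suc.prems(2) r in auto)
  moreover have "complex_poly_eval q x = (x - scaleC z 1) * complex_poly_eval r x"
    unfolding r by (simp only: complex_poly_eval_mult) (simp add: complex_poly_eval_pCons scaleC_minus_left scaleC_one)
  ultimately show ?case using Suc.prems(2)[OF z] by (simp add: cs_invertible_mult)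
qed

lemma poly_eval_eq_complex: "poly_eval p x = complex_poly_eval (map_poly of_real p) (x::'a::cstar_algebra)"
  by (simp add: poly_eval_def complex_poly_eval_def degree_map_poly coeff_map_poly scaleC_of_real)

lemma map_poly_of_real_add: "map_poly complex_of_real (p + q) = map_poly of_real p + map_poly of_real q"
  by (rule poly_eqI) (simp add: coeff_map_poly)

lemma map_poly_of_real_mult: "map_poly complex_of_real (p * q) = map_poly of_real p * map_poly of_real q"
  by (rule poly_eqI) (simp add: coeff_map_poly coeff_mult)

lemma poly_map_poly_of_real: "poly (map_poly complex_of_real p) (of_real t) = of_real (poly p t)"
  by (induction p) (auto simp: map_poly_pCons)

lemma poly_eval_add: "poly_eval (p + q) x = poly_eval p x + poly_eval q (x::'a::cstar_algebra)"
  by (simp add: poly_eval_eq_complex map_poly_of_real_add complex_poly_eval_add)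

lemma poly_eval_mult: "poly_eval (p * q) x = poly_eval p x * poly_eval q (x::'a::cstar_algebra)"
  by (simp add: poly_eval_eq_complex map_poly_of_real_mult complex_poly_eval_mult)

lemma poly_eval_const: "poly_eval [:c:] x = c *\<^sub>R (1::'a::cstar_algebra)"
  by (simp add: poly_eval_def)

lemma poly_eval_pCons: "poly_eval (pCons c p) x = c *\<^sub>R 1 + x * poly_eval p (x::'a::cstar_algebra)"
  by (simp add: poly_eval_eq_complex map_poly_pCons complex_poly_eval_pCons scaleC_of_real)

lemma poly_eval_diff: "poly_eval (p - q) x = poly_eval p x - poly_eval q (x::'a::cstar_algebra)"
  using poly_eval_add[of "p - q" q x] by simp

lemma poly_eval_sa: "cs_sa x \<Longrightarrow> cs_sa (poly_eval p x)"
  unfolding poly_eval_def by (intro cs_sa_sum cs_sa_scaleR cs_sa_power)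

lemma poly_eval_commute:
  fixes x y :: "'a::cstar_algebra"
  assumes "y * x = x * y" shows "y * poly_eval p x = poly_eval p x * y"
proof (induction p)
  case (pCons a p)
  have "y * (x * poly_eval p x) = x * poly_eval p x * y" by (metis pCons.IH assms mult.assoc)
  then show ?case by (simp add: poly_eval_pCons algebra_simps)
qed (simp add: poly_eval_def)

text \<open>One inclusion of the spectral mapping theorem: if p - s had no root in the spectrum,
  then p(x) - s would be a product of invertible factors.\<close>

lemma poly_eval_spectrum:
  fixes x :: "'a::cstar_algebra"
  assumes x: "cs_sa x" and s: "s \<in> real_spectrum (poly_eval p x)"
  shows "\<exists>t\<in>real_spectrum x. poly p t = s"
proof (cases "p = [:s:]")
  case True
  \<comment> \<open>p - s vanishes identically here, so any spectral point serves; the spectrum is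
    nonempty because it attains the norm.\<close>
  then show ?thesis using sa_norm_attained[OF x] by auto
next
  case False
  define q where "q = map_poly complex_of_real (p - [:s:])"
  have "q \<noteq> 0" using False by (simp add: q_def map_poly_eq_0_iff)
  moreover have "complex_poly_eval q x = poly_eval p x - s *\<^sub>R 1"
    by (simp add: q_def poly_eval_diff poly_eval_const flip: poly_eval_eq_complex)
  ultimately obtain z where z: "poly q z = 0" "z \<in> cs_spectrum x"
    using complex_poly_eval_invertible[of q x] s by (auto simp: real_spectrum_alt cs_spectrum_def)
  then obtain t where t: "z = of_real t" "t \<in> real_spectrum x"
    using sa_spectrum_iff_real_spectrum[OF x, of z]
    by (metis complex_eq_iff Im_complex_of_real Re_complex_of_real)
  from z(1) have "poly (p - [:s:]) t = 0" unfolding q_def t(1) poly_map_poly_of_real by simp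
  then show ?thesis using t(2) by auto
qed

text \<open>Spectral mapping and the equality of norm and spectral radius make
  \<open>poly_eval\<close> a contraction for the supremum norm on the spectrum, which is what
  carries the calculus from polynomials to continuous functions.\<close>

lemma poly_eval_norm_le:
  fixes x :: "'a::cstar_algebra"
  assumes "cs_sa x" "\<And>t. t \<in> real_spectrum x \<Longrightarrow> \<bar>poly p t\<bar> \<le> C"
  shows "norm (poly_eval p x) \<le> C"
  by (rule sa_norm_le) (use assms poly_eval_sa poly_eval_spectrum in \<open>auto dest!: poly_eval_spectrum[rotated]\<close>)

section \<open>From polynomials to continuous functions\<close>

definition spectrum_approx :: "(nat \<Rightarrow> real poly) \<Rightarrow> (real \<Rightarrow> real) \<Rightarrow> 'a::cstar_algebra \<Rightarrow> bool" where
  "spectrum_approx P f x \<longleftrightarrow> uniform_limit (real_spectrum x) (\<lambda>n. poly (P n)) f sequentially"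

lemma cfc_altdef:
  "cfc f x = (THE y. \<forall>P. spectrum_approx P f x \<longrightarrow> (\<lambda>n. poly_eval (P n) x) \<longlonglongrightarrow> y)"
  unfolding cfc_def spectrum_approx_def uniform_limit_iff eventually_sequentially dist_real_def by simp

text \<open>Weierstrass approximation takes place on the interval from \<open>- norm x\<close> to
  \<open>norm x\<close>, a compact set containing the spectrum; hence continuity is asked for on the
  whole line.\<close>

lemma exists_spectrum_approx:
  fixes x :: "'a::cstar_algebra"
  assumes f: "continuous_on UNIV f" shows "\<exists>P. spectrum_approx P f x"
proof -
  let ?S = "{- norm x..norm x}"
  have S: "real_spectrum x \<subseteq> ?S" using real_spectrum_bounded by force
  have "\<exists>p. \<forall>t\<in>?S. \<bar>poly p t - f t\<bar> < inverse (real (Suc n))" for n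
  proof -
    obtain g where g: "real_polynomial_function g" "\<And>t. t \<in> ?S \<Longrightarrow> \<bar>f t - g t\<bar> < inverse (real (Suc n))"
    proof (rule Stone_Weierstrass_real_polynomial_function[of ?S f "inverse (real (Suc n))"])
      show "continuous_on ?S f" using continuous_on_subset[OF f] by blast
    qed auto
    obtain a m where "g = (\<lambda>t. \<Sum>i\<le>m. a i * t ^ i)" using g(1) unfolding real_polynomial_function_iff_sum by blast
    then have "poly (\<Sum>i\<le>m. monom (a i) i) t = g t" for t by (simp add: poly_sum poly_monom)
    then show ?thesis using g(2) by (intro exI[of _ "\<Sum>i\<le>m. monom (a i) i"]) (simp add: abs_minus_commute)
  qed
  then obtain P where P: "\<And>n t. t \<in> ?S \<Longrightarrow> \<bar>poly (P n) t - f t\<bar> < inverse (real (Suc n))" by metis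
  have "spectrum_approx P f x" unfolding spectrum_approx_def uniform_limit_iff dist_real_def eventually_sequentially
  proof (intro allI impI)
    fix e :: real assume "e > 0"
    then obtain N where N: "inverse (real (Suc N)) < e" using reals_Archimedean by blast
    have "\<bar>poly (P n) t - f t\<bar> < e" if "n \<ge> N" "t \<in> real_spectrum x" for n t
    proof -
      have "inverse (real (Suc n)) \<le> inverse (real (Suc N))" using that(1) by (intro le_imp_inverse_le) auto
      moreover have "t \<in> ?S" using S that(2) by blast
      ultimately show ?thesis using P[of t n] N by linarith
    qed
    then show "\<exists>N. \<forall>n\<ge>N. \<forall>t\<in>real_spectrum x. \<bar>poly (P n) t - f t\<bar> < e" by blast
  qed
  then show ?thesis by blast
qed

lemma spectrum_approx_norm_diff:
  fixes x :: "'a::cstar_algebra"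
  assumes x: "cs_sa x" and P: "spectrum_approx P f x" and Q: "spectrum_approx Q f x" and e: "e > 0"
  shows "\<exists>N. \<forall>m\<ge>N. \<forall>n\<ge>N. norm (poly_eval (P m) x - poly_eval (Q n) x) \<le> e"
proof -
  have "e/2 > 0" using e by simp
  then obtain N1 N2 where N1: "\<And>n t. n \<ge> N1 \<Longrightarrow> t \<in> real_spectrum x \<Longrightarrow> \<bar>poly (P n) t - f t\<bar> < e/2"
    and N2: "\<And>n t. n \<ge> N2 \<Longrightarrow> t \<in> real_spectrum x \<Longrightarrow> \<bar>poly (Q n) t - f t\<bar> < e/2"
    using P Q unfolding spectrum_approx_def uniform_limit_iff eventually_sequentially dist_real_def by meson
  have "norm (poly_eval (P m) x - poly_eval (Q n) x) \<le> e" if "m \<ge> max N1 N2" "n \<ge> max N1 N2" for m n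
    unfolding poly_eval_diff[symmetric]
  proof (rule poly_eval_norm_le[OF x])
    fix t assume "t \<in> real_spectrum x"
    then have "\<bar>poly (P m) t - f t\<bar> < e/2" "\<bar>poly (Q n) t - f t\<bar> < e/2" using N1 N2 that by auto
    then show "\<bar>poly (P m - Q n) t\<bar> \<le> e" unfolding poly_diff by linarith
  qed
  then show ?thesis by blast
qed

text \<open>Justifies the definite description in \<open>cfc\<close>: one approximating sequence is
  Cauchy, and every other one gets arbitrarily close to it, so the limit is common to all.\<close>

lemma cfc_tendsto:
  fixes x :: "'a::cstar_algebra"
  assumes x: "cs_sa x" and f: "continuous_on UNIV f" and P: "spectrum_approx P f x"
  shows "(\<lambda>n. poly_eval (P n) x) \<longlonglongrightarrow> cfc f x"
proof -
  have "Cauchy (\<lambda>n. poly_eval (P n) x)"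
  proof (rule metric_CauchyI)
    fix e :: real assume "e > 0"
    then show "\<exists>M. \<forall>m\<ge>M. \<forall>n\<ge>M. dist (poly_eval (P m) x) (poly_eval (P n) x) < e"
      using spectrum_approx_norm_diff[OF x P P, of "e/2"] by (force simp: dist_norm)
  qed
  then obtain y where y: "(\<lambda>n. poly_eval (P n) x) \<longlonglongrightarrow> y" using Cauchy_convergent convergent_def by blast
  have all: "(\<lambda>n. poly_eval (Q n) x) \<longlonglongrightarrow> y" if Q: "spectrum_approx Q f x" for Q
  proof -
    have "(\<lambda>n. poly_eval (Q n) x - poly_eval (P n) x) \<longlonglongrightarrow> 0"
    proof (rule LIMSEQ_I)
      fix e :: real assume "e > 0"
      then show "\<exists>no. \<forall>n\<ge>no. norm (poly_eval (Q n) x - poly_eval (P n) x - 0) < e"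
        using spectrum_approx_norm_diff[OF x Q P, of "e/2"] by force
    qed
    from tendsto_add[OF this y] show ?thesis by simp
  qed
  have "cfc f x = y" unfolding cfc_altdef
    by (rule the_equality) (use all P LIMSEQ_unique[OF y] in auto)
  with y show ?thesis by simp
qed

lemma cfc_eqI:
  assumes "cs_sa x" "continuous_on UNIV f" "spectrum_approx P f x" "(\<lambda>n. poly_eval (P n) x) \<longlonglongrightarrow> y"
  shows "cfc f x = y"
  using LIMSEQ_unique[OF cfc_tendsto[OF assms(1-3)] assms(4)] .

lemma cfc_cong:
  assumes "\<And>t. t \<in> real_spectrum x \<Longrightarrow> f t = g t" shows "cfc f x = cfc g x"
  using assms by (simp add: cfc_def cong: ball_cong)

lemma cfc_id: "cs_sa x \<Longrightarrow> cfc (\<lambda>t. t) x = (x::'a::cstar_algebra)"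
  by (rule cfc_eqI[where P = "\<lambda>_. [:0, 1:]"])
     (auto simp: spectrum_approx_def uniform_limit_iff poly_eval_pCons poly_eval_def)

lemma cfc_const: "cs_sa x \<Longrightarrow> cfc (\<lambda>t. c) x = c *\<^sub>R (1::'a::cstar_algebra)"
  by (rule cfc_eqI[where P = "\<lambda>_. [:c:]"])
     (auto simp: spectrum_approx_def uniform_limit_iff poly_eval_const)

lemma cfc_add:
  fixes x :: "'a::cstar_algebra"
  assumes x: "cs_sa x" and f: "continuous_on UNIV f" and g: "continuous_on UNIV g"
  shows "cfc (\<lambda>t. f t + g t) x = cfc f x + cfc g x"
proof -
  obtain P Q where P: "spectrum_approx P f x" and Q: "spectrum_approx Q g x"
    using exists_spectrum_approx f g by meson
  show ?thesis
  proof (rule cfc_eqI[OF x, where P = "\<lambda>n. P n + Q n"])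
    show "continuous_on UNIV (\<lambda>t. f t + g t)" using f g by (intro continuous_intros)
    show "spectrum_approx (\<lambda>n. P n + Q n) (\<lambda>t. f t + g t) x"
      using uniform_limit_add[OF P[unfolded spectrum_approx_def] Q[unfolded spectrum_approx_def]]
      by (simp add: spectrum_approx_def uniform_limit_iff)
    show "(\<lambda>n. poly_eval (P n + Q n) x) \<longlonglongrightarrow> cfc f x + cfc g x"
      unfolding poly_eval_add using cfc_tendsto[OF x f P] cfc_tendsto[OF x g Q] by (rule tendsto_add)
  qed
qed

lemma continuous_bounded_on_spectrum:
  assumes "continuous_on UNIV f" shows "bounded (f ` real_spectrum x)"
proof -
  have "compact (f ` {- norm x..norm x})"
    by (intro compact_continuous_image continuous_on_subset[OF assms]) auto
  moreover have "f ` real_spectrum x \<subseteq> f ` {- norm x..norm x}" using real_spectrum_bounded by force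
  ultimately show ?thesis using compact_imp_bounded bounded_subset by blast
qed

lemma cfc_mult:
  fixes x :: "'a::cstar_algebra"
  assumes x: "cs_sa x" and f: "continuous_on UNIV f" and g: "continuous_on UNIV g"
  shows "cfc (\<lambda>t. f t * g t) x = cfc f x * cfc g x"
proof -
  obtain P Q where P: "spectrum_approx P f x" and Q: "spectrum_approx Q g x"
    using exists_spectrum_approx f g by meson
  show ?thesis
  proof (rule cfc_eqI[OF x, where P = "\<lambda>n. P n * Q n"])
    show "continuous_on UNIV (\<lambda>t. f t * g t)" using f g by (intro continuous_intros)
    show "spectrum_approx (\<lambda>n. P n * Q n) (\<lambda>t. f t * g t) x"
      using uniform_lim_mult[OF P[unfolded spectrum_approx_def] Q[unfolded spectrum_approx_def]
          continuous_bounded_on_spectrum[OF f] continuous_bounded_on_spectrum[OF g]]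
      by (simp add: spectrum_approx_def uniform_limit_iff)
    show "(\<lambda>n. poly_eval (P n * Q n) x) \<longlonglongrightarrow> cfc f x * cfc g x"
      unfolding poly_eval_mult using cfc_tendsto[OF x f P] cfc_tendsto[OF x g Q] by (rule tendsto_mult)
  qed
qed

lemma cfc_scaleR:
  fixes x :: "'a::cstar_algebra"
  assumes x: "cs_sa x" and f: "continuous_on UNIV f"
  shows "cfc (\<lambda>t. c * f t) x = c *\<^sub>R cfc f x"
  using cfc_mult[OF x _ f, of "\<lambda>_. c"] by (simp add: cfc_const[OF x] continuous_on_const)

lemma cfc_diff:
  fixes x :: "'a::cstar_algebra"
  assumes x: "cs_sa x" and f: "continuous_on UNIV f" and g: "continuous_on UNIV g"
  shows "cfc (\<lambda>t. f t - g t) x = cfc f x - cfc g x"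
  using cfc_add[OF x f, of "\<lambda>t. - 1 * g t"] cfc_scaleR[OF x g, of "-1"] g
  by (simp add: continuous_on_minus)

lemma cfc_norm_le:
  fixes x :: "'a::cstar_algebra"
  assumes x: "cs_sa x" and f: "continuous_on UNIV f"
    and C: "\<And>t. t \<in> real_spectrum x \<Longrightarrow> \<bar>f t\<bar> \<le> C"
  shows "norm (cfc f x) \<le> C"
proof (rule field_le_epsilon)
  fix e :: real assume e: "e > 0"
  obtain P where P: "spectrum_approx P f x" using exists_spectrum_approx f by meson
  then obtain N where N: "\<And>n t. n \<ge> N \<Longrightarrow> t \<in> real_spectrum x \<Longrightarrow> \<bar>poly (P n) t - f t\<bar> < e"
    using e unfolding spectrum_approx_def uniform_limit_iff eventually_sequentially dist_real_def by meson
  have "norm (poly_eval (P n) x) \<le> C + e" if "n \<ge> N" for n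
  proof (rule poly_eval_norm_le[OF x])
    fix t assume "t \<in> real_spectrum x"
    then show "\<bar>poly (P n) t\<bar> \<le> C + e" using N[OF that, of t] C[of t] by linarith
  qed
  then show "norm (cfc f x) \<le> C + e"
    using Lim_bounded[OF tendsto_norm[OF cfc_tendsto[OF x f P]]] by blast
qed

lemma cfc_sa:
  fixes x :: "'a::cstar_algebra"
  assumes x: "cs_sa x" and f: "continuous_on UNIV f" shows "cs_sa (cfc f x)"
proof -
  obtain P where P: "spectrum_approx P f x" using exists_spectrum_approx f by meson
  note lim = cfc_tendsto[OF x f P]
  have "(\<lambda>n. adj (poly_eval (P n) x)) \<longlonglongrightarrow> adj (cfc f x)" using lim by (rule tendsto_adj)
  moreover have "adj (poly_eval (P n) x) = poly_eval (P n) x" for n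
    using poly_eval_sa[OF x] by (simp add: cs_sa_def)
  ultimately have "(\<lambda>n. poly_eval (P n) x) \<longlonglongrightarrow> adj (cfc f x)" by simp
  from LIMSEQ_unique[OF this lim] show ?thesis by (simp add: cs_sa_def)
qed

lemma cfc_commute:
  fixes x y :: "'a::cstar_algebra"
  assumes x: "cs_sa x" and f: "continuous_on UNIV f" and y: "y * x = x * y"
  shows "y * cfc f x = cfc f x * y"
proof -
  obtain P where P: "spectrum_approx P f x" using exists_spectrum_approx f by meson
  note lim = cfc_tendsto[OF x f P]
  have l: "(\<lambda>n. y * poly_eval (P n) x) \<longlonglongrightarrow> y * cfc f x"
    and r: "(\<lambda>n. poly_eval (P n) x * y) \<longlonglongrightarrow> cfc f x * y"
    using lim by (auto intro: tendsto_mult tendsto_const)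
  show ?thesis by (rule LIMSEQ_unique[OF l]) (simp only: poly_eval_commute[OF y] r)
qed

text \<open>Stands in for Borel calculus: up to an error e, g is a continuous multiple of f, namely
  g = k f + r on the spectrum with |r| at most e. Hence g(x) y = r(x) y has norm at most
  \<open>e * norm y\<close> for every e > 0.\<close>

lemma cfc_annihilator_mono:
  fixes x y :: "'a::cstar_algebra"
  assumes x: "cs_sa x" and f: "continuous_on UNIV f" and g: "continuous_on UNIV g"
    and z: "\<And>t. f t = 0 \<Longrightarrow> g t = 0" and y: "cfc f x * y = 0"
  shows "cfc g x * y = 0"
proof -
  have "norm (cfc g x * y) \<le> e * norm y" if e: "e > 0" for e
  proof -
    \<comment> \<open>On this compact set |g| is at least e, so f has no zero there and |f| is
      bounded below by some d > 0.\<close>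
    define S where "S = {- norm x..norm x} \<inter> {t. e \<le> \<bar>g t\<bar>}"
    have cf: "continuous_on T f" and cg: "continuous_on T g" for T
      using f g continuous_on_subset by blast+
    have "\<exists>d>0. \<forall>t\<in>S. d \<le> \<bar>f t\<bar>"
    proof (cases "S = {}")
      case False
      have "closed {t. e \<le> \<bar>g t\<bar>}" using g by (intro closed_Collect_le continuous_intros)
      then have "compact S" unfolding S_def by (intro compact_Int_closed) auto
      then obtain t0 where t0: "t0 \<in> S" "\<And>t. t \<in> S \<Longrightarrow> \<bar>f t0\<bar> \<le> \<bar>f t\<bar>"
        using continuous_attains_inf[OF _ False, of "\<lambda>t. \<bar>f t\<bar>"] cf by (auto intro!: continuous_intros)
      then have "f t0 \<noteq> 0" using e z[of t0] by (auto simp: S_def)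
      then show ?thesis using t0 by (intro exI[of _ "\<bar>f t0\<bar>"]) auto
    qed (auto intro: exI[of _ 1])
    then obtain d where d: "d > 0" "\<And>t. t \<in> S \<Longrightarrow> d \<le> \<bar>f t\<bar>" by blast
    \<comment> \<open>r truncates g at height e. The quotient (g - r) / f gets the denominator
      \<open>max ((f t)^2) (d^2)\<close> to be continuous everywhere; on S this is
      \<open>(f t)^2\<close>, and elsewhere in the spectrum g = r.\<close>
    define r where "r t = max (- e) (min e (g t))" for t
    define k where "k t = (g t - r t) * f t / max ((f t)^2) (d^2)" for t
    have cr: "continuous_on UNIV r" unfolding r_def using cg by (intro continuous_intros)
    have nz: "max ((f t)^2) (d^2) \<noteq> 0" for t using d(1) by (smt (verit) zero_less_power)
    have ck: "continuous_on UNIV k" unfolding k_def using cf cg cr nz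
      by (intro continuous_intros) auto
    have "k t * f t + r t = g t" if "t \<in> real_spectrum x" for t
    proof (cases "e \<le> \<bar>g t\<bar>")
      case True
      have "t \<in> S" using that True real_spectrum_bounded[OF that] by (auto simp: S_def)
      then have "d^2 \<le> (f t)^2" "f t \<noteq> 0" using d(1) d(2)[of t] by (auto simp: abs_le_square_iff[symmetric])
      then show ?thesis by (simp add: k_def max_def power2_eq_square)
    qed (auto simp: k_def r_def)
    then have "cfc g x = cfc (\<lambda>t. k t * f t + r t) x" by (intro cfc_cong) simp
    also have "\<dots> = cfc k x * cfc f x + cfc r x"
      using cr ck f by (simp add: cfc_add[OF x] cfc_mult[OF x] continuous_on_mult)
    finally have "cfc g x * y = cfc r x * y" using y by (simp add: distrib_right mult.assoc)
    moreover have "norm (cfc r x) \<le> e" using e by (intro cfc_norm_le x cr) (auto simp: r_def)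
    from this have "norm (cfc r x) * norm y \<le> e * norm y" by (rule mult_right_mono) simp
    ultimately show ?thesis using norm_mult_ineq[of "cfc r x" y] by simp
  qed
  note bound = this
  show ?thesis
  proof (rule ccontr)
    assume n: "cfc g x * y \<noteq> 0"
    then have "norm y > 0" by auto
    with n bound[of "norm (cfc g x * y) / (2 * norm y)"] show False by simp
  qed
qed

section \<open>Positive elements and the projection order\<close>

text \<open>The commutation clause is recorded because products of commuting positive elements rely
  on it.\<close>

lemma cfc_pos:
  fixes x :: "'a::cstar_algebra"
  assumes x: "cs_sa x" and f: "continuous_on UNIV f" "\<And>t. t \<in> real_spectrum x \<Longrightarrow> 0 \<le> f t"
  shows "\<exists>s. cs_sa s \<and> s * s = cfc f x \<and> (\<forall>y. y * x = x * y \<longrightarrow> y * s = s * y)"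
proof (intro exI conjI allI impI)
  let ?g = "\<lambda>t. sqrt (max (f t) 0)"
  have g: "continuous_on UNIV ?g" using f(1) by (intro continuous_intros)
  show "cs_sa (cfc ?g x)" by (rule cfc_sa[OF x g])
  show "cfc ?g x * cfc ?g x = cfc f x"
    unfolding cfc_mult[OF x g g, symmetric] by (rule cfc_cong) (use f(2) in auto)
  show "y * cfc ?g x = cfc ?g x * y" if "y * x = x * y" for y using cfc_commute[OF x g that] .
qed

lemma cs_pos_square: "cs_sa s \<Longrightarrow> cs_pos (s * s)" for s :: "'a::cstar_algebra"
proof -
  assume s: "cs_sa s"
  have "s * s = poly_eval [:0, 0, 1:] s" by (simp add: poly_eval_pCons poly_eval_def)
  then have "0 \<le> t" if "t \<in> real_spectrum (s * s)" for t
    using poly_eval_spectrum[OF s, of t "[:0, 0, 1:]"] that by auto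
  then show ?thesis using s by (simp add: cs_pos_iff cs_sa_mult)
qed

lemma cs_pos_sqrt:
  fixes x :: "'a::cstar_algebra"
  assumes "cs_pos x"
  shows "\<exists>s. cs_sa s \<and> s * s = x \<and> (\<forall>y. y * x = x * y \<longrightarrow> y * s = s * y)"
  using cfc_pos[of x "\<lambda>t. t"] assms by (simp add: cs_pos_iff cfc_id continuous_on_id)

lemma cfc_cs_pos:
  fixes x :: "'a::cstar_algebra"
  assumes "cs_sa x" "continuous_on UNIV f" "\<And>t. t \<in> real_spectrum x \<Longrightarrow> 0 \<le> f t"
  shows "cs_pos (cfc f x)"
  using cfc_pos[OF assms] cs_pos_square by metis

lemma real_spectrum_diff:
  "t \<in> real_spectrum (r *\<^sub>R 1 - x) \<longleftrightarrow> r - t \<in> real_spectrum (x::'a::cstar_algebra)"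
proof -
  have "cs_invertible (- y)" if "cs_invertible y" for y :: 'a
    using cs_invertible_scaleC[of "-1" y] that by (simp add: scaleC_minus_left scaleC_one)
  then have "cs_invertible (- y) \<longleftrightarrow> cs_invertible y" for y :: 'a by (metis minus_minus)
  moreover have "r *\<^sub>R 1 - x - t *\<^sub>R 1 = - (x - (r - t) *\<^sub>R 1)" by (simp add: algebra_simps)
  ultimately show ?thesis unfolding real_spectrum_alt by metis
qed

lemma real_spectrum_minus: "t \<in> real_spectrum (- x) \<longleftrightarrow> - t \<in> real_spectrum (x::'a::cstar_algebra)"
  using real_spectrum_diff[of t 0 x] by simp

text \<open>Together with \<open>cs_pos_normI\<close> this is a criterion for positivity in terms of
  norms; sums of positive elements then follow from the triangle inequality.\<close>

lemma cs_pos_norm_bound: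
  fixes x :: "'a::cstar_algebra"
  assumes "cs_pos x" "norm x \<le> r" shows "norm (r *\<^sub>R 1 - x) \<le> r"
proof (rule sa_norm_le)
  show "cs_sa (r *\<^sub>R 1 - x)" using assms by (simp add: cs_pos_def cs_sa_diff cs_sa_scaleR cs_sa_one)
  fix t assume "t \<in> real_spectrum (r *\<^sub>R 1 - x)"
  then have "r - t \<in> real_spectrum x" by (simp add: real_spectrum_diff)
  then show "\<bar>t\<bar> \<le> r" using assms real_spectrum_bounded[of "r - t" x] by (force simp: cs_pos_iff)
qed

lemma cs_pos_normI:
  fixes x :: "'a::cstar_algebra"
  assumes "cs_sa x" "norm (r *\<^sub>R 1 - x) \<le> r" shows "cs_pos x"
proof -
  have "0 \<le> t" if "t \<in> real_spectrum x" for t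
  proof -
    have "r - t \<in> real_spectrum (r *\<^sub>R 1 - x)" using that by (simp add: real_spectrum_diff)
    then show ?thesis using real_spectrum_bounded[of "r - t"] assms(2) by force
  qed
  then show ?thesis using assms by (simp add: cs_pos_iff)
qed

lemma cs_pos_add: "cs_pos x \<Longrightarrow> cs_pos y \<Longrightarrow> cs_pos (x + y)" for x y :: "'a::cstar_algebra"
proof -
  assume x: "cs_pos x" and y: "cs_pos y"
  have "(norm x + norm y) *\<^sub>R 1 - (x + y) = (norm x *\<^sub>R 1 - x) + (norm y *\<^sub>R 1 - y)"
    by (simp add: algebra_simps)
  note eq = this
  have "norm ((norm x + norm y) *\<^sub>R 1 - (x + y)) \<le> norm x + norm y"
    unfolding eq using norm_triangle_ineq[of "norm x *\<^sub>R 1 - x" "norm y *\<^sub>R 1 - y"]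
      cs_pos_norm_bound[OF x order_refl] cs_pos_norm_bound[OF y order_refl] by linarith
  then show ?thesis using x y by (intro cs_pos_normI) (auto simp: cs_pos_def cs_sa_add)
qed

lemma cs_pos_0 [simp]: "cs_pos (0::'a::cstar_algebra)"
  using cs_pos_square[of "0::'a"] by (simp add: cs_sa_zero)

lemma cs_pos_scaleR: "cs_pos x \<Longrightarrow> 0 \<le> r \<Longrightarrow> cs_pos (r *\<^sub>R x)" for x :: "'a::cstar_algebra"
proof -
  assume "cs_pos x" and r: "0 \<le> r"
  then obtain s where s: "cs_sa s" "s * s = x" using cs_pos_sqrt by blast
  have "(sqrt r *\<^sub>R s) * (sqrt r *\<^sub>R s) = (sqrt r * sqrt r) *\<^sub>R (s * s)" by simp
  then have "(sqrt r *\<^sub>R s) * (sqrt r *\<^sub>R s) = r *\<^sub>R x" unfolding s(2) using r by simp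
  then show ?thesis using cs_pos_square[OF cs_sa_scaleR[OF s(1)], of "sqrt r"] by argo
qed

lemma cs_pos_sa: "cs_pos x \<Longrightarrow> cs_sa x" by (simp add: cs_pos_def)

lemma cs_pos_antisym: "cs_pos x \<Longrightarrow> cs_pos (- x) \<Longrightarrow> x = 0" for x :: "'a::cstar_algebra"
proof -
  assume "cs_pos x" "cs_pos (- x)"
  moreover from this obtain t where "t \<in> real_spectrum x" "\<bar>t\<bar> = norm x"
    using sa_norm_attained[of x] cs_pos_sa by auto
  ultimately have "t = 0" using real_spectrum_minus[of "- t" x] by (force simp: cs_pos_iff)
  with \<open>\<bar>t\<bar> = norm x\<close> show ?thesis by simp
qed

text \<open>The square roots commute with whatever their squares commute with, so
  \<open>x * y\<close> is the square of the self-adjoint \<open>s * r\<close>.\<close>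

lemma cs_pos_mult:
  fixes x y :: "'a::cstar_algebra"
  assumes "cs_pos x" "cs_pos y" "x * y = y * x" shows "cs_pos (x * y)"
proof -
  obtain s where s: "cs_sa s" "s * s = x" "\<And>z. z * x = x * z \<Longrightarrow> z * s = s * z"
    using cs_pos_sqrt[OF assms(1)] by blast
  obtain r where r: "cs_sa r" "r * r = y" "\<And>z. z * y = y * z \<Longrightarrow> z * r = r * z"
    using cs_pos_sqrt[OF assms(2)] by blast
  have "y * s = s * y" using s(3) assms(3) by simp
  then have rs: "s * r = r * s" using r(3) by simp
  have "(s * r) * (s * r) = s * (r * s) * r" by (simp add: mult.assoc)
  also have "\<dots> = s * (s * r) * r" by (simp only: rs)
  also have "\<dots> = (s * s) * (r * r)" by (simp only: mult.assoc)
  finally have "(s * r) * (s * r) = x * y" by (simp only: s(2) r(2))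
  then show ?thesis using cs_pos_square[OF cs_sa_mult[OF s(1) r(1) rs]] by simp
qed

text \<open>Jacobson's formula: if c inverts \<open>a * b - t\<close>, then
  \<open>(b * c * a - 1) / t\<close> inverts \<open>b * a - t\<close>. So both products have the
  same nonzero real spectrum.\<close>

lemma cs_invertible_mult_swap:
  fixes a b :: "'a::cstar_algebra"
  assumes "t \<noteq> 0" "cs_invertible (a * b - t *\<^sub>R 1)" shows "cs_invertible (b * a - t *\<^sub>R 1)"
proof -
  obtain c where c: "(a * b - t *\<^sub>R 1) * c = 1" "c * (a * b - t *\<^sub>R 1) = 1"
    using assms(2) by (auto simp: cs_invertible_def)
  have l: "a * (b * c) = 1 + t *\<^sub>R c" and r: "c * (a * b) = 1 + t *\<^sub>R c"
    using c by (simp_all add: algebra_simps)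
  have "(b * a - t *\<^sub>R 1) * (b * c * a - 1) = b * (a * (b * c)) * a - t *\<^sub>R (b * c * a) - b * a + t *\<^sub>R 1"
    by (simp add: algebra_simps)
  also have "\<dots> = t *\<^sub>R 1" unfolding l by (simp add: algebra_simps)
  finally have 1: "(b * a - t *\<^sub>R 1) * (b * c * a - 1) = t *\<^sub>R 1" .
  have "(b * c * a - 1) * (b * a - t *\<^sub>R 1) = b * (c * (a * b)) * a - t *\<^sub>R (b * c * a) - b * a + t *\<^sub>R 1"
    by (simp add: algebra_simps)
  also have "\<dots> = t *\<^sub>R 1" unfolding r by (simp add: algebra_simps)
  finally have 2: "(b * c * a - 1) * (b * a - t *\<^sub>R 1) = t *\<^sub>R 1" .
  show ?thesis unfolding cs_invertible_def
    by (rule exI[of _ "(1/t) *\<^sub>R (b * c * a - 1)"]) (simp add: 1 2 assms(1))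
qed

text \<open>Swapping the factors keeps the nonzero spectrum, so \<open>y * adj y\<close> is negative
  as well. But \<open>adj y * y + y * adj y\<close> is half the sum of the squares of h and k, which
  are twice the real and imaginary parts of y up to sign, hence it is positive.\<close>

lemma eq_0_if_neg_adj_mult_pos:
  fixes y :: "'a::cstar_algebra"
  assumes "cs_pos (- (adj y * y))" shows "y = 0"
proof -
  have "0 \<le> t" if t: "t \<in> real_spectrum (- (y * adj y))" for t
  proof (cases "t = 0")
    case False
    have "- t \<in> real_spectrum (y * adj y)" using t by (simp add: real_spectrum_minus)
    then have "- t \<in> real_spectrum (adj y * y)"
      using cs_invertible_mult_swap[of "- t" "adj y" y] False unfolding real_spectrum_alt by auto
    then show ?thesis using assms by (simp add: cs_pos_iff real_spectrum_minus)
  qed simp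
  then have 1: "cs_pos (- (y * adj y))"
    by (auto simp: cs_pos_iff cs_sa_def adj_minus adj_mult adj_adj)
  define h where "h = y + adj y"
  define k where "k = scaleC \<i> (y - adj y)"
  have "cs_sa h" "cs_sa k"
    by (simp_all add: h_def k_def cs_sa_def adj_add adj_adj adj_scaleC adj_diff scaleC_minus_left scaleC_diff_right add.commute)
  then have 2: "cs_pos (h * h + k * k)" by (intro cs_pos_add cs_pos_square)
  have "k * k = - ((y - adj y) * (y - adj y))"
    by (simp add: k_def scaleC_mult_left scaleC_mult_right scaleC_scaleC scaleC_minus_left scaleC_one)
  then have "h * h + k * k = 2 *\<^sub>R (adj y * y + y * adj y)"
    by (simp add: h_def algebra_simps scaleR_2)
  then have "(1/2) *\<^sub>R (h * h + k * k) = adj y * y + y * adj y" by simp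
  moreover have "cs_pos ((1/2) *\<^sub>R (h * h + k * k))" using 2 by (rule cs_pos_scaleR) simp
  ultimately have "cs_pos (adj y * y + y * adj y)" by simp
  from cs_pos_add[OF this 1] have "cs_pos (adj y * y)" by simp
  then have "adj y * y = 0" using assms by (rule cs_pos_antisym)
  then show ?thesis by (simp add: adj_mult_self_eq_0)
qed

text \<open>Let b be the negative part of \<open>x = adj y * y\<close>. Then
  \<open>adj (y * b) * (y * b) = b * x * b\<close> is minus the cube of b, so the previous lemma
  gives \<open>y * b = 0\<close>, and b vanishes.\<close>

lemma adj_mult_pos: "cs_pos (adj y * y)" for y :: "'a::cstar_algebra"
proof -
  define x where "x = adj y * y"
  have x: "cs_sa x" by (simp add: x_def cs_sa_adj_mult)
  define n where "n t = max (- t) (0::real)" for t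
  have cn: "continuous_on UNIV n" unfolding n_def by (intro continuous_intros)
  have c3: "continuous_on UNIV (\<lambda>t. n t * (t * n t))" using cn by (intro continuous_intros)
  define b where "b = cfc n x"
  have b: "cs_sa b" unfolding b_def by (rule cfc_sa[OF x cn])
  have bxb: "b * (x * b) = cfc (\<lambda>t. n t * (t * n t)) x"
    using cn unfolding b_def
    by (subst cfc_mult[OF x], auto intro!: continuous_intros)
       (subst cfc_mult[OF x], auto intro!: continuous_intros simp: cfc_id[OF x])
  have "cs_pos (- (b * (x * b)))"
  proof -
    have "- (b * (x * b)) = cfc (\<lambda>t. (- 1) * (n t * (t * n t))) x" using cfc_scaleR[OF x c3, of "-1"] bxb by simp
    moreover have "cs_pos (cfc (\<lambda>t. (- 1) * (n t * (t * n t))) x)"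
    proof (rule cfc_cs_pos[OF x])
      show "continuous_on UNIV (\<lambda>t. (- 1) * (n t * (t * n t)))" using cn by (intro continuous_intros)
      fix t show "0 \<le> (- 1) * (n t * (t * n t))"
        by (cases "t \<le> 0") (auto simp: n_def max_def mult_nonneg_nonpos mult_nonneg_nonneg)
    qed
    ultimately show ?thesis by simp
  qed
  moreover have "adj (y * b) * (y * b) = b * (x * b)" using b by (simp add: adj_mult x_def cs_sa_def mult.assoc)
  ultimately have "y * b = 0" by (metis eq_0_if_neg_adj_mult_pos)
  then have "cfc (\<lambda>t. n t * (t * n t)) x * 1 = 0" using bxb by (simp add: x_def mult.assoc)
  then have "cfc n x * 1 = 0"
    by (rule cfc_annihilator_mono[OF x c3 cn, rotated]) (auto simp: n_def max_def split: if_splits)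
  then have "x = cfc (\<lambda>t. t + n t) x" using cn by (simp add: cfc_add[OF x] continuous_on_id cfc_id[OF x])
  moreover have "cs_pos (cfc (\<lambda>t. t + n t) x)"
    using cn by (intro cfc_cs_pos x) (auto intro!: continuous_intros simp: n_def)
  ultimately show ?thesis by (simp add: x_def)
qed

lemma cs_pos_conj: "cs_pos x \<Longrightarrow> cs_pos (adj c * x * c)" for x c :: "'a::cstar_algebra"
proof -
  assume "cs_pos x"
  then obtain s where s: "cs_sa s" "s * s = x" using cs_pos_sqrt by blast
  then have "adj c * x * c = adj (s * c) * (s * c)" by (simp add: adj_mult cs_sa_def mult.assoc flip: s(2))
  then show ?thesis using adj_mult_pos by metis
qed

section \<open>Projections and their order\<close>

lemma cs_proj_sa: "cs_proj p \<Longrightarrow> cs_sa p" by (simp add: cs_proj_def cs_sa_def)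

lemma cs_proj_idem: "cs_proj p \<Longrightarrow> p * p = p" by (simp add: cs_proj_def)

lemma cs_proj_idem_assoc: "cs_proj p \<Longrightarrow> p * (p * x) = p * x" by (simp add: cs_proj_def flip: mult.assoc)

lemma cs_proj_pos: "cs_proj p \<Longrightarrow> cs_pos p"
  using cs_pos_square[of p] by (simp add: cs_proj_def cs_sa_def)

lemma cs_proj_compl: "cs_proj p \<Longrightarrow> cs_proj (1 - p)"
  by (simp add: cs_proj_def adj_diff algebra_simps)

lemma cs_proj_0 [simp]: "cs_proj 0" and cs_proj_1 [simp]: "cs_proj 1"
  by (simp_all add: cs_proj_def)

lemma cs_proj_le_iff:
  fixes p q :: "'a::cstar_algebra"
  assumes p: "cs_proj p" and q: "cs_proj q" shows "cs_le p q \<longleftrightarrow> q * p = p"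
proof
  assume "cs_le p q"
  then have pos: "cs_pos (q - p)" by (simp add: cs_le_def)
  \<comment> \<open>Compressing q - p by 1 - q leaves \<open>- (adj z * z)\<close> with
    \<open>z = p * (1 - q)\<close>, so positivity forces z = 0.\<close>
  have "cs_pos (adj (1 - q) * (q - p) * (1 - q))" by (rule cs_pos_conj[OF pos])
  moreover have "adj (1 - q) * (q - p) * (1 - q) = - (adj (p * (1 - q)) * (p * (1 - q)))"
    using p q cs_proj_idem[OF p] cs_proj_idem[OF q] cs_proj_idem_assoc[OF p] cs_proj_idem_assoc[OF q]
    by (simp add: cs_proj_def adj_mult adj_diff algebra_simps)
  ultimately have "p * (1 - q) = 0" using eq_0_if_neg_adj_mult_pos by metis
  then have "p = p * q" by (simp add: algebra_simps)
  then show "q * p = p" using p q by (metis adj_mult cs_proj_def)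
next
  assume qp: "q * p = p"
  then have pq: "p * q = p" using p q by (metis adj_mult cs_proj_def)
  have "cs_proj (q - p)" using p q qp pq by (simp add: cs_proj_def adj_diff algebra_simps)
  then show "cs_le p q" using p q by (simp add: cs_le_def cs_proj_sa cs_proj_pos)
qed

lemma cs_proj_le_iff':
  fixes p q :: "'a::cstar_algebra"
  assumes p: "cs_proj p" and q: "cs_proj q" shows "cs_le p q \<longleftrightarrow> p * q = p"
  using cs_proj_le_iff[OF assms] p q by (metis adj_mult cs_proj_def)

lemma cs_proj_diff:
  fixes p q :: "'a::cstar_algebra"
  assumes "cs_proj p" "cs_proj q" "cs_le p q" shows "cs_proj (q - p)"
  using assms cs_proj_le_iff[OF assms(1,2)] cs_proj_le_iff'[OF assms(1,2)]
  by (simp add: cs_proj_def adj_diff algebra_simps)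

lemma cs_le_refl: "cs_sa x \<Longrightarrow> cs_le x x"
  by (simp add: cs_le_def)

lemma cs_le_trans: "cs_le x y \<Longrightarrow> cs_le y z \<Longrightarrow> cs_le x z"
  using cs_pos_add[of "y - x" "z - y"] by (simp add: cs_le_def)

lemma cs_le_antisym: "cs_le x y \<Longrightarrow> cs_le y x \<Longrightarrow> x = y"
  using cs_pos_antisym[of "y - x"] by (simp add: cs_le_def)

lemma cs_proj_le_compl_iff:
  "cs_le (1 - p) (1 - q) \<longleftrightarrow> cs_le q p" if "cs_proj p" "cs_proj q"
  using that by (simp add: cs_le_def cs_proj_sa cs_proj_compl)

lemma cs_proj_le_compl_swap:
  "cs_le p (1 - q) \<longleftrightarrow> cs_le q (1 - p)" if "cs_proj p" "cs_proj q"
  using cs_proj_le_compl_iff[of "1 - p" q] that by (simp add: cs_proj_compl)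

lemma cs_proj_ge_0: "cs_proj p \<Longrightarrow> cs_le 0 p" and cs_proj_le_1: "cs_proj p \<Longrightarrow> cs_le p 1"
  by (simp_all add: cs_le_def cs_sa_zero cs_sa_one cs_proj_sa cs_proj_pos cs_proj_compl)

lemma cs_proj_commute_if_le:
  assumes "cs_proj p" "cs_proj q" "cs_le p q" shows "p * q = q * p"
  using cs_proj_le_iff[OF assms(1,2)] cs_proj_le_iff'[OF assms(1,2)] assms(3) by simp

section \<open>Spectral families in AW*-algebras\<close>

text \<open>Membership in the right ideal generated by p becomes the equation
  \<open>p * x = x\<close>, which suits calculations; the empty S is covered by p = 1.\<close>

lemma aw_annihilator:
  assumes "aw_star TYPE('a::cstar_algebra)"
  shows "\<exists>p::'a. cs_proj p \<and> (\<forall>x. (\<forall>s\<in>S. s * x = 0) \<longleftrightarrow> p * x = x)"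
proof (cases "S = {}")
  case False
  with assms have "\<exists>p. cs_proj p \<and> {x. \<forall>s\<in>S. s * x = 0} = {p * y | y. True}"
    unfolding aw_star_def by (elim allE[of _ S] impE)
  then obtain p where p: "cs_proj p" "{x. \<forall>s\<in>S. s * x = 0} = {p * y | y. True}" by (elim exE conjE)
  have "(\<forall>s\<in>S. s * x = 0) \<longleftrightarrow> p * x = x" for x
  proof -
    have "(\<forall>s\<in>S. s * x = 0) \<longleftrightarrow> (\<exists>y. x = p * y)" using p(2) by blast
    also have "\<dots> \<longleftrightarrow> p * x = x" using cs_proj_idem_assoc[OF p(1)] by metis
    finally show ?thesis .
  qed
  with p(1) show ?thesis by blast
qed (auto intro: exI[of _ 1])

text \<open>\<open>r \<le> q\<close> means \<open>(1 - q) * r = 0\<close>, so the annihilator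
  projection of all complements is the infimum.\<close>

lemma proj_glb_exists:
  assumes aw: "aw_star TYPE('a::cstar_algebra)" and A: "\<And>q. q \<in> A \<Longrightarrow> cs_proj (q::'a)"
  shows "\<exists>p. proj_glb A p"
proof -
  obtain p where p: "cs_proj p" "\<And>x. (\<forall>s\<in>(\<lambda>q. 1 - q) ` A. s * x = 0) \<longleftrightarrow> p * x = x"
    using aw_annihilator[OF aw, of "(\<lambda>q. 1 - q) ` A"] by blast
  have "(\<forall>q\<in>A. cs_le r q) \<longleftrightarrow> cs_le r p" if r: "cs_proj r" for r
  proof -
    have "(\<forall>q\<in>A. cs_le r q) \<longleftrightarrow> (\<forall>s\<in>(\<lambda>q. 1 - q) ` A. s * r = 0)"
      using cs_proj_le_iff[OF r] A by (auto simp: left_diff_distrib)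
    also have "\<dots> \<longleftrightarrow> cs_le r p" unfolding p(2) using cs_proj_le_iff[OF r p(1)] by simp
    finally show ?thesis .
  qed
  with p(1) show ?thesis unfolding proj_glb_def by (metis cs_le_refl cs_proj_sa)
qed

lemma proj_lub_exists:
  assumes aw: "aw_star TYPE('a::cstar_algebra)" and A: "\<And>q. q \<in> A \<Longrightarrow> cs_proj (q::'a)"
  shows "\<exists>p. cs_proj p \<and> (\<forall>r. cs_proj r \<longrightarrow> (cs_le p r \<longleftrightarrow> (\<forall>q\<in>A. cs_le q r)))"
proof -
  obtain p where p: "proj_glb ((\<lambda>q. 1 - q) ` A) p"
    using proj_glb_exists[OF aw, of "(\<lambda>q. 1 - q) ` A"] A cs_proj_compl by blast
  then have pp: "cs_proj p" by (simp add: proj_glb_def)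
  show ?thesis
  proof (intro exI[of _ "1 - p"] conjI allI impI iffI)
    show "cs_proj (1 - p)" using pp by (rule cs_proj_compl)
  next
    fix r :: 'a assume r: "cs_proj r" and le: "cs_le (1 - p) r"
    show "\<forall>q\<in>A. cs_le q r"
    proof
      fix q assume q: "q \<in> A"
      then have "cs_le p (1 - q)" using p by (auto simp: proj_glb_def)
      then have "cs_le q (1 - p)" using cs_proj_le_compl_swap[OF pp A[OF q]] by simp
      then show "cs_le q r" using le cs_le_trans by blast
    qed
  next
    fix r :: 'a assume r: "cs_proj r" and le: "\<forall>q\<in>A. cs_le q r"
    then have "\<forall>s\<in>(\<lambda>q. 1 - q) ` A. cs_le (1 - r) s" using A by (auto simp: cs_proj_le_compl_iff)
    then have "cs_le (1 - r) p" using p r by (auto simp: proj_glb_def cs_proj_compl)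
    then show "cs_le (1 - p) r" using cs_proj_le_compl_iff[of p "1 - r"] r pp by (simp add: cs_proj_compl)
  qed
qed

text \<open>An element commuting with s preserves the right annihilator of s. This applies to z and,
  s being self-adjoint, to \<open>adj z\<close>, so p reduces z.\<close>

lemma annihilator_commute:
  fixes p s z :: "'a::cstar_algebra"
  assumes p: "cs_proj p" and s: "cs_sa s" and ann: "\<And>y. s * y = 0 \<longleftrightarrow> p * y = y" and z: "z * s = s * z"
  shows "z * p = p * z"
proof -
  have *: "p * (w * p) = w * p" if w: "w * s = s * w" for w
  proof -
    have "s * p = 0" using ann cs_proj_idem[OF p] by simp
    then have "s * (w * p) = 0" by (metis mult.assoc mult_zero_right w)
    then show ?thesis using ann by simp
  qed
  have "adj (z * s) = adj (s * z)" using z by simp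
  then have "adj z * s = s * adj z" using s by (simp add: adj_mult cs_sa_def)
  then have "adj (p * (adj z * p)) = adj (adj z * p)" using * by simp
  then have "p * z * p = p * z" using p by (simp add: adj_mult adj_adj cs_proj_def)
  with *[OF z] show ?thesis by (simp add: mult.assoc)
qed

section \<open>Spectral projections from functional calculus\<close>

abbreviation pos_shift :: "real \<Rightarrow> real \<Rightarrow> real" where
  "pos_shift l \<equiv> (\<lambda>t. max (t - l) 0)"

text \<open>The annihilator projection of the positive part of x - l, the concrete candidate for the
  spectral family of x.\<close>

definition spec_proj :: "'a::cstar_algebra \<Rightarrow> real \<Rightarrow> 'a" where
  "spec_proj x l = (SOME p. cs_proj p \<and> (\<forall>y. cfc (pos_shift l) x * y = 0 \<longleftrightarrow> p * y = y))"

lemma continuous_pos_shift: "continuous_on UNIV (pos_shift l)"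
  by (intro continuous_intros)

context
  fixes x :: "'a::cstar_algebra"
  assumes aw: "aw_star TYPE('a)" and x: "cs_sa x"
begin

lemma spec_proj: "cs_proj (spec_proj x l)"
  and spec_proj_iff: "cfc (pos_shift l) x * y = 0 \<longleftrightarrow> spec_proj x l * y = y"
proof -
  have "\<exists>p. cs_proj p \<and> (\<forall>y. cfc (pos_shift l) x * y = 0 \<longleftrightarrow> p * y = y)"
    using aw_annihilator[OF aw, of "{cfc (pos_shift l) x}"] by simp
  from someI_ex[OF this, folded spec_proj_def]
  show "cs_proj (spec_proj x l)" "cfc (pos_shift l) x * y = 0 \<longleftrightarrow> spec_proj x l * y = y" by auto
qed

lemma spec_proj_annihilates: "cfc (pos_shift l) x * spec_proj x l = 0"
  by (simp add: spec_proj_iff cs_proj_idem[OF spec_proj])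

lemma spec_proj_commute: "z * x = x * z \<Longrightarrow> z * spec_proj x l = spec_proj x l * z"
  by (rule annihilator_commute[OF spec_proj cfc_sa[OF x continuous_pos_shift] spec_proj_iff
        cfc_commute[OF x continuous_pos_shift]])

lemma spec_proj_commute_cfc:
  "continuous_on UNIV f \<Longrightarrow> spec_proj x l * cfc f x = cfc f x * spec_proj x l"
  by (rule cfc_commute[OF x]) (simp_all add: spec_proj_commute)

lemma spec_proj_mono: "l \<le> m \<Longrightarrow> cs_le (spec_proj x l) (spec_proj x m)"
proof -
  assume lm: "l \<le> m"
  have "cfc (pos_shift m) x * spec_proj x l = 0"
    by (rule cfc_annihilator_mono[OF x continuous_pos_shift[of l] continuous_pos_shift _ spec_proj_annihilates])
       (use lm in auto)
  then show ?thesis using cs_proj_le_iff[OF spec_proj spec_proj] spec_proj_iff by simp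
qed

lemma spec_proj_glb: "proj_glb {spec_proj x m | m. m > l} (spec_proj x l)"
  unfolding proj_glb_def
proof (intro conjI allI impI ballI)
  show "cs_proj (spec_proj x l)" by (rule spec_proj)
  show "cs_le (spec_proj x l) q" if "q \<in> {spec_proj x m | m. m > l}" for q
    using that spec_proj_mono by auto
  fix r assume r: "cs_proj r \<and> (\<forall>q\<in>{spec_proj x m | m. m > l}. cs_le r q)"
  \<comment> \<open>The positive part of x - m annihilates r, and the positive parts of x - l and x
    - m differ by at most m - l in norm; letting m tend to l gives right-continuity.\<close>
  have bound: "norm (cfc (pos_shift l) x * r) \<le> (m - l) * norm r" if m: "m > l" for m
  proof -
    have "cs_le r (spec_proj x m)" using r m by blast
    then have "cfc (pos_shift m) x * r = 0" using r cs_proj_le_iff[OF _ spec_proj] spec_proj_iff by blast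
    then have "cfc (pos_shift l) x * r = cfc (\<lambda>t. pos_shift l t - pos_shift m t) x * r"
      by (simp add: cfc_diff[OF x continuous_pos_shift continuous_pos_shift] left_diff_distrib)
    moreover have "norm (cfc (\<lambda>t. pos_shift l t - pos_shift m t) x) \<le> m - l"
      by (rule cfc_norm_le[OF x]) (use m in \<open>auto intro!: continuous_intros\<close>)
    then have "norm (cfc (\<lambda>t. pos_shift l t - pos_shift m t) x) * norm r \<le> (m - l) * norm r"
      by (rule mult_right_mono) simp
    ultimately show ?thesis using norm_mult_ineq order_trans by metis
  qed
  have "cfc (pos_shift l) x * r = 0"
  proof (rule ccontr)
    assume n: "cfc (pos_shift l) x * r \<noteq> 0"
    then have "norm r > 0" by auto
    with n bound[of "l + norm (cfc (pos_shift l) x * r) / (2 * norm r)"] show False by simp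
  qed
  then show "cs_le r (spec_proj x l)" using r cs_proj_le_iff[OF _ spec_proj] spec_proj_iff by blast
qed

lemma spec_proj_eq_0: "(\<And>t. t \<in> real_spectrum x \<Longrightarrow> l < t) \<Longrightarrow> spec_proj x l = 0"
proof -
  assume l: "\<And>t. t \<in> real_spectrum x \<Longrightarrow> l < t"
  have "cfc (pos_shift l) x = cfc (\<lambda>t. t - l) x" by (rule cfc_cong) (use l in force)
  also have "\<dots> = x - l *\<^sub>R 1" by (simp add: cfc_diff[OF x] continuous_on_id continuous_on_const cfc_id[OF x] cfc_const[OF x])
  finally have "(x - l *\<^sub>R 1) * spec_proj x l = 0" using spec_proj_annihilates by metis
  moreover have "cs_invertible (x - l *\<^sub>R 1)" using l[of l] by (auto simp: real_spectrum_alt)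
  ultimately show ?thesis unfolding cs_invertible_def by (metis mult.assoc mult_1 mult_zero_right)
qed

lemma spec_proj_eq_1: "(\<And>t. t \<in> real_spectrum x \<Longrightarrow> t \<le> l) \<Longrightarrow> spec_proj x l = 1"
proof -
  assume l: "\<And>t. t \<in> real_spectrum x \<Longrightarrow> t \<le> l"
  have "cfc (pos_shift l) x = cfc (\<lambda>t. 0) x" by (rule cfc_cong) (use l in force)
  then have "cfc (pos_shift l) x * 1 = 0" by (simp add: cfc_const[OF x])
  then show ?thesis unfolding spec_proj_iff by simp
qed

text \<open>Treating f(x) instead of x lets the same estimate serve the reparametrized family below.
  Split f l - f into its positive part hp and negative part hm: hm vanishes wherever
  \<open>pos_shift l\<close> does, and \<open>pos_shift l\<close> times hp is 0, so hp(x) lives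
  under the projection and hm(x) under its complement.\<close>

lemma cfc_spec_proj_le:
  assumes f: "continuous_on UNIV f" "mono f"
  shows "cs_le (cfc f x * spec_proj x l) (f l *\<^sub>R spec_proj x l)"
    and "cs_le (f l *\<^sub>R (1 - spec_proj x l)) (cfc f x * (1 - spec_proj x l))"
proof -
  let ?E = "spec_proj x l"
  define h where "h t = f l - f t" for t
  define hp where "hp t = max (h t) 0" for t
  define hm where "hm t = max (- h t) 0" for t
  have ch: "continuous_on UNIV h" unfolding h_def using f(1) by (intro continuous_intros)
  have chp: "continuous_on UNIV hp" unfolding hp_def using ch by (intro continuous_intros)
  have chm: "continuous_on UNIV hm" unfolding hm_def using ch by (intro continuous_intros)
  have hx: "cfc h x = f l *\<^sub>R 1 - cfc f x"
    unfolding h_def by (simp add: cfc_diff[OF x] f(1) continuous_on_const cfc_const[OF x])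
  have "cfc h x = cfc (\<lambda>t. hp t - hm t) x" by (rule cfc_cong) (auto simp: hp_def hm_def)
  then have hd: "cfc h x = cfc hp x - cfc hm x" by (simp add: cfc_diff[OF x chp chm])
  have hmE: "cfc hm x * ?E = 0"
  proof (rule cfc_annihilator_mono[OF x continuous_pos_shift chm _ spec_proj_annihilates])
    fix t assume "pos_shift l t = 0"
    then have "f t \<le> f l" using f(2) by (intro monoD[of f]) auto
    then show "hm t = 0" by (simp add: hm_def h_def)
  qed
  have "cfc (pos_shift l) x * cfc hp x = cfc (\<lambda>t. pos_shift l t * hp t) x"
    by (simp add: cfc_mult[OF x continuous_pos_shift chp])
  also have "\<dots> = cfc (\<lambda>t. 0) x"
  proof (rule cfc_cong)
    fix t show "pos_shift l t * hp t = 0"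
      using monoD[OF f(2), of l t] by (cases "l \<le> t") (auto simp: hp_def h_def)
  qed
  also have "\<dots> = 0" by (simp add: cfc_const[OF x])
  finally have "?E * cfc hp x = cfc hp x" using spec_proj_iff by simp
  then have hpE: "cfc hp x * ?E = cfc hp x" using spec_proj_commute_cfc[OF chp] by simp
  have c: "?E * cfc g x = cfc g x * ?E" if "continuous_on UNIV g" for g
    using spec_proj_commute_cfc[OF that] .
  have sa: "cs_sa ?E" "cs_sa (1 - ?E)" using cs_proj_sa spec_proj cs_proj_compl by blast+
  have sf: "cs_sa (cfc f x)" using cfc_sa[OF x f(1)] .
  have "f l *\<^sub>R ?E - cfc f x * ?E = cfc h x * ?E" unfolding hx by (simp add: left_diff_distrib)
  also have "\<dots> = cfc hp x * ?E" unfolding hd by (simp add: left_diff_distrib hmE)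
  finally have 1: "f l *\<^sub>R ?E - cfc f x * ?E = cfc hp x * ?E" .
  have "cs_pos (cfc hp x * ?E)"
    using c[OF chp] by (intro cs_pos_mult cfc_cs_pos[OF x chp] cs_proj_pos[OF spec_proj]) (auto simp: hp_def)
  then show "cs_le (cfc f x * ?E) (f l *\<^sub>R ?E)"
    unfolding cs_le_def 1 using sa sf c[OF f(1)] by (simp add: cs_sa_scaleR cs_sa_mult)
  have "cfc f x * (1 - ?E) - f l *\<^sub>R (1 - ?E) = - (cfc h x * (1 - ?E))"
    unfolding hx by (simp add: algebra_simps)
  also have "\<dots> = cfc hm x * (1 - ?E)"
    unfolding hd using hpE by (simp add: algebra_simps)
  finally have 2: "cfc f x * (1 - ?E) - f l *\<^sub>R (1 - ?E) = cfc hm x * (1 - ?E)" .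
  have commute: "cfc f x * (1 - ?E) = (1 - ?E) * cfc f x"
    using c[OF f(1)] by (simp add: algebra_simps)
  have "cs_pos (cfc hm x * (1 - ?E))"
    using c[OF chm] by (intro cs_pos_mult cfc_cs_pos[OF x chm] cs_proj_pos cs_proj_compl spec_proj)
      (auto simp: hm_def algebra_simps)
  then show "cs_le (f l *\<^sub>R (1 - ?E)) (cfc f x * (1 - ?E))"
    unfolding cs_le_def 2 using sa cs_sa_mult[OF sf sa(2) commute] by (simp add: cs_sa_scaleR)
qed

text \<open>The conditions for f(x) at level l are those of \<open>cfc_spec_proj_le\<close> at level
  \<open>g l\<close>; the identity in place of f gives the family of x itself.\<close>

lemma is_spectral_family_cfc:
  assumes f: "continuous_on UNIV f" "strict_mono f" and g: "\<And>l. f (g l) = l"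
  shows "is_spectral_family (cfc f x) (\<lambda>l. spec_proj x (g l))"
proof -
  have gf: "g (f t) = t" for t using g strict_mono_eq[OF f(2)] by blast
  have gless: "g l < m \<longleftrightarrow> l < f m" "m < g l \<longleftrightarrow> f m < l" "g l \<le> g l' \<longleftrightarrow> l \<le> l'" for l l' m
    using strict_mono_less[OF f(2), of "g l" m] strict_mono_less[OF f(2), of m "g l"]
      strict_mono_less_eq[OF f(2), of "g l" "g l'"] by (simp_all add: g)
  have set: "{spec_proj x (g m) | m. m > l} = {spec_proj x m | m. m > g l}" for l
  proof (intro equalityI subsetI)
    fix p assume "p \<in> {spec_proj x (g m) | m. m > l}"
    then obtain m where m: "p = spec_proj x (g m)" "m > l" by blast
    then have "g m > g l" by (simp add: gless g)
    with m show "p \<in> {spec_proj x m | m. m > g l}" by blast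
  next
    fix p assume "p \<in> {spec_proj x m | m. m > g l}"
    then obtain m where m: "p = spec_proj x (g (f m))" "f m > l" by (auto simp: gf gless)
    then show "p \<in> {spec_proj x (g m) | m. m > l}" by blast
  qed
  have f': "mono f" using f(2) by (rule strict_mono_mono)
  define \<alpha> where "\<alpha> = \<bar>f (- norm x)\<bar> + \<bar>f (norm x)\<bar> + 1"
  have "spec_proj x (g l) = 0" if "l < - \<alpha>" for l
  proof (rule spec_proj_eq_0)
    have "l < f (- norm x)" using that unfolding \<alpha>_def by linarith
    then have "g l < - norm x" by (simp add: gless)
    then show "g l < t" if "t \<in> real_spectrum x" for t using real_spectrum_bounded[OF that] by linarith
  qed
  moreover have "spec_proj x (g l) = 1" if "l > \<alpha>" for l
  proof (rule spec_proj_eq_1)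
    have "l > f (norm x)" using that unfolding \<alpha>_def by linarith
    then have "norm x < g l" by (simp add: gless)
    then show "t \<le> g l" if "t \<in> real_spectrum x" for t using real_spectrum_bounded[OF that] by linarith
  qed
  moreover have "\<alpha> > 0" unfolding \<alpha>_def by linarith
  ultimately have "\<exists>\<alpha>>0. (\<forall>l< -\<alpha>. spec_proj x (g l) = 0) \<and> (\<forall>l>\<alpha>. spec_proj x (g l) = 1)" by blast
  then show ?thesis unfolding is_spectral_family_def set
    using cfc_spec_proj_le[OF f(1) f', of "g _"]
    by (simp add: g gless(3) spec_proj spec_proj_glb spec_proj_mono)
qed

lemma is_spectral_family_spec_proj: "is_spectral_family x (spec_proj x)"
  using is_spectral_family_cfc[of "\<lambda>t. t" "\<lambda>t. t"] by (simp add: cfc_id[OF x] continuous_on_id strict_mono_def)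

end

section \<open>Uniqueness of the spectral family\<close>

lemma commute_mult: "z * a = a * z \<Longrightarrow> z * b = b * z \<Longrightarrow> z * (a * b) = (a * b) * z" for z a b :: "'a::cstar_algebra"
  by (metis mult.assoc)

lemma commute_diff: "z * a = a * z \<Longrightarrow> z * b = b * z \<Longrightarrow> z * (a - b) = (a - b) * z" for z a b :: "'a::cstar_algebra"
  by (simp add: algebra_simps)

lemma commute_scaleR: "z * a = a * z \<Longrightarrow> z * (r *\<^sub>R a) = (r *\<^sub>R a) * z" for z a :: "'a::cstar_algebra"
  by simp

lemma commute_one: "z * 1 = 1 * z" for z :: "'a::cstar_algebra"
  by simp

lemmas commute_intros = commute_mult commute_diff commute_scaleR commute_one

lemma cs_pos_mult_proj: "cs_pos a \<Longrightarrow> cs_proj q \<Longrightarrow> q * a = a * q \<Longrightarrow> cs_pos (a * q)"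
  by (simp add: cs_pos_mult cs_proj_pos)

lemma neg_scale_proj_pos:
  fixes p :: "'a::cstar_algebra"
  assumes "cs_pos (r *\<^sub>R p)" "r < 0" "cs_pos p" shows "p = 0"
proof -
  have "cs_pos ((- r) *\<^sub>R p)" using assms by (intro cs_pos_scaleR) auto
  then have "r *\<^sub>R p = 0" using assms cs_pos_antisym[of "r *\<^sub>R p"] by simp
  then show ?thesis using assms by simp
qed

lemma is_spectral_familyD:
  fixes x :: "'a::cstar_algebra"
  assumes "is_spectral_family x F" and x: "cs_sa x"
  shows "cs_proj (F l)" "l \<le> m \<Longrightarrow> cs_le (F l) (F m)" "F l * x = x * F l"
    "cs_pos ((l *\<^sub>R 1 - x) * F l)" "cs_pos ((x - l *\<^sub>R 1) * (1 - F l))"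
    "cs_proj r \<Longrightarrow> (\<And>m. m > l \<Longrightarrow> cs_le r (F m)) \<Longrightarrow> cs_le r (F l)"
proof -
  note F = assms(1)[unfolded is_spectral_family_def]
  show p: "cs_proj (F l)" using F by blast
  show "l \<le> m \<Longrightarrow> cs_le (F l) (F m)" using F by blast
  have "cs_le (x * F l) (l *\<^sub>R F l)" "cs_le (l *\<^sub>R (1 - F l)) (x * (1 - F l))" using F by blast+
  then have "cs_sa (x * F l)" "cs_pos (l *\<^sub>R F l - x * F l)" "cs_pos (x * (1 - F l) - l *\<^sub>R (1 - F l))"
    by (auto simp: cs_le_def)
  then show "F l * x = x * F l" "cs_pos ((l *\<^sub>R 1 - x) * F l)" "cs_pos ((x - l *\<^sub>R 1) * (1 - F l))"
    using p x by (auto simp: cs_sa_def cs_proj_def adj_mult left_diff_distrib)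
  have "proj_glb {F \<mu> | \<mu>. \<mu> > l} (F l)" using F by blast
  then show "cs_proj r \<Longrightarrow> (\<And>m. m > l \<Longrightarrow> cs_le r (F m)) \<Longrightarrow> cs_le r (F l)"
    unfolding proj_glb_def by blast
qed

text \<open>On F l the element x - l is negative, so its positive part annihilates F l and F l lies
  below \<open>spec_proj x l\<close>. On the difference q one has x q = l q. For m > l the part of q
  outside F m would need x to be at least m, so q lies below F m. Right-continuity puts q below F l,
  to which it is orthogonal.\<close>

lemma spectral_family_unique:
  fixes x :: "'a::cstar_algebra"
  assumes aw: "aw_star TYPE('a)" and x: "cs_sa x" and F: "is_spectral_family x F"
  shows "F = spec_proj x"
proof
  fix l
  note FD = is_spectral_familyD[OF F x]
  note ED = is_spectral_familyD[OF is_spectral_family_spec_proj[OF aw x] x]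
  let ?E = "spec_proj x l" and ?d = "x - l *\<^sub>R 1" and ?c = "cfc (pos_shift l) x"
  have EF: "F m * ?E = ?E * F m" for m using spec_proj_commute[OF aw x FD(3)] .
  have c: "cs_pos ?c" by (rule cfc_cs_pos[OF x continuous_pos_shift]) auto
  have cF: "F l * ?c = ?c * F l" by (rule cfc_commute[OF x continuous_pos_shift FD(3)])
  have dc: "?d * ?c = ?c * ?c"
  proof -
    have "?d = cfc (\<lambda>t. t - l) x" by (simp add: cfc_diff[OF x] continuous_on_id continuous_on_const cfc_id[OF x] cfc_const[OF x])
    then have "?d * ?c = cfc (\<lambda>t. (t - l) * pos_shift l t) x"
      by (simp add: cfc_mult[OF x] continuous_pos_shift continuous_on_diff continuous_on_id continuous_on_const)
    also have "\<dots> = cfc (\<lambda>t. pos_shift l t * pos_shift l t) x" by (rule cfc_cong) (auto simp: max_def)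
    finally show ?thesis by (simp add: cfc_mult[OF x continuous_pos_shift continuous_pos_shift])
  qed
  have cx: "?c * x = x * ?c" using cfc_commute[OF x continuous_pos_shift, of x l] by simp
  have cFsa: "cs_sa (?c * F l)" using c FD(1) cF by (intro cs_sa_mult) (auto simp: cs_pos_sa cs_proj_sa)
  have "cs_pos (((l *\<^sub>R 1 - x) * F l) * ?c)"
  proof (rule cs_pos_mult[OF FD(4) c])
    have "?c * ((l *\<^sub>R 1 - x) * F l) = (l *\<^sub>R 1 - x) * F l * ?c" by (intro commute_intros cx cF[symmetric])
    then show "(l *\<^sub>R 1 - x) * F l * ?c = ?c * ((l *\<^sub>R 1 - x) * F l)" by simp
  qed
  also have "((l *\<^sub>R 1 - x) * F l) * ?c = (l *\<^sub>R 1 - x) * ?c * F l" by (simp add: mult.assoc cF)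
  also have "\<dots> = - (?c * ?c * F l)" unfolding dc[symmetric] by (simp add: algebra_simps)
  also have "?c * ?c * F l = (?c * F l) * (?c * F l)"
  proof -
    have "(?c * F l) * (?c * F l) = ?c * (F l * ?c) * F l" by (simp only: mult.assoc)
    also have "\<dots> = ?c * ?c * (F l * F l)" by (simp only: cF mult.assoc)
    finally show ?thesis using cs_proj_idem[OF FD(1)] by simp
  qed
  also have "\<dots> = adj (?c * F l) * (?c * F l)" using cFsa by (simp add: cs_sa_def)
  finally have "?c * F l = 0" by (rule eq_0_if_neg_adj_mult_pos)
  then have le: "?E * F l = F l" using spec_proj_iff[OF aw x] by blast
  define q where "q = ?E - F l"
  have q: "cs_proj q" unfolding q_def
    using le by (intro cs_proj_diff FD(1) ED(1)) (simp add: cs_proj_le_iff[OF FD(1) ED(1)])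
  have FF: "F m * F n = F n * F m" for m n
    using cs_proj_commute_if_le[OF FD(1) FD(1) FD(2), of m n] cs_proj_commute_if_le[OF FD(1) FD(1) FD(2), of n m]
    by (cases "m \<le> n") auto
  have qF: "q * F m = F m * q" for m unfolding q_def using EF[of m] FF[of l m] by (simp add: algebra_simps)
  have qx: "q * x = x * q" unfolding q_def using ED(3)[of l] FD(3)[of l] by (simp add: algebra_simps)
  have Fq: "F l * q = 0" unfolding q_def using le EF[of l] cs_proj_idem[OF FD(1)] by (simp add: algebra_simps)
  have Eq: "?E * q = q" unfolding q_def using le cs_proj_idem[OF ED(1)] by (simp add: algebra_simps)
  have "cs_pos (?d * (1 - F l) * q)"
    by (rule cs_pos_mult_proj[OF FD(5) q]) (intro commute_intros qx qF)
  moreover have "?d * (1 - F l) * q = ?d * q" using Fq by (simp add: mult.assoc left_diff_distrib[of 1 "F l" q])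
  moreover have "cs_pos ((l *\<^sub>R 1 - x) * ?E * q)"
    by (rule cs_pos_mult_proj[OF ED(4) q]) (intro commute_intros qx, metis Eq EF q_def commute_diff qF ED(1) adj_mult cs_proj_def q)
  moreover have "(l *\<^sub>R 1 - x) * ?E * q = - (?d * q)" using Eq by (simp add: mult.assoc left_diff_distrib)
  ultimately have dq: "?d * q = 0" using cs_pos_antisym by simp
  have "cs_le q (F m)" if m: "m > l" for m
  proof -
    have 1: "cs_pos ((x - m *\<^sub>R 1) * (1 - F m) * q)"
      by (rule cs_pos_mult_proj[OF FD(5) q]) (intro commute_intros qx qF)
    have pr: "cs_pos ((1 - F m) * q)"
      by (rule cs_pos_mult_proj[OF cs_proj_pos[OF cs_proj_compl[OF FD(1)]] q]) (intro commute_intros qF)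
    have "(x - m *\<^sub>R 1) * (1 - F m) * q = (x - m *\<^sub>R 1) * q * (1 - F m)"
      using qF[of m] by (simp add: algebra_simps)
    also have "(x - m *\<^sub>R 1) * q = (l - m) *\<^sub>R q" using dq by (simp add: algebra_simps)
    also have "(l - m) *\<^sub>R q * (1 - F m) = (l - m) *\<^sub>R ((1 - F m) * q)" using qF[of m] by (simp add: algebra_simps)
    finally have "(1 - F m) * q = 0" using 1 pr m by (intro neg_scale_proj_pos[of "l - m"]) auto
    then show ?thesis using cs_proj_le_iff[OF q FD(1)] by (simp add: left_diff_distrib)
  qed
  then have "cs_le q (F l)" using FD(6)[OF q] by blast
  then have "q = 0" using cs_proj_le_iff[OF q FD(1)] Fq by simp
  then show "F l = ?E" by (simp add: q_def)
qed

section \<open>Transformation rules and injectivity of spectral families\<close>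

lemma spectral_family_eq:
  fixes x :: "'a::cstar_algebra"
  assumes aw: "aw_star TYPE('a)" and x: "cs_sa x" and F: "is_spectral_family x F"
  shows "spectral_family x = F"
  unfolding spectral_family_def
  using F spectral_family_unique[OF aw x] by (intro the_equality) metis+

lemma is_spectral_family_spectral_family:
  fixes x :: "'a::cstar_algebra"
  assumes aw: "aw_star TYPE('a)" and x: "cs_sa x"
  shows "is_spectral_family x (spectral_family x)"
  using is_spectral_family_spec_proj[OF aw x] spectral_family_eq[OF aw x] by metis

lemma spectral_family_eq_spec_proj:
  fixes x :: "'a::cstar_algebra"
  assumes aw: "aw_star TYPE('a)" and x: "cs_sa x"
  shows "spectral_family x = spec_proj x"
  by (rule spectral_family_eq[OF aw x is_spectral_family_spec_proj[OF aw x]])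

lemma spectral_family_cfc:
  fixes x :: "'a::cstar_algebra"
  assumes aw: "aw_star TYPE('a)" and x: "cs_sa x"
    and f: "continuous_on UNIV f" "strict_mono f" and g: "\<And>l. f (g l) = l"
  shows "spectral_family (cfc f x) l = spectral_family x (g l)"
  using spectral_family_eq[OF aw cfc_sa[OF x f(1)] is_spectral_family_cfc[OF aw x f g]]
    spectral_family_eq_spec_proj[OF aw x] by simp

lemma spectral_family_neg:
  fixes x :: "'a::cstar_algebra"
  assumes aw: "aw_star TYPE('a)" and x: "cs_pos x" and l: "l < 0"
  shows "spectral_family x l = 0"
proof -
  have "spec_proj x l = 0" by (rule spec_proj_eq_0[OF aw cs_pos_sa[OF x]]) (use x l in \<open>force simp: cs_pos_iff\<close>)
  then show ?thesis using spectral_family_eq_spec_proj[OF aw cs_pos_sa[OF x]] by simp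
qed

text \<open>If \<open>x - y\<close> exceeded \<open>\<epsilon>\<close> on a nonzero projection \<open>q\<close>, then cutting \<open>q\<close> down to a spectral
  window \<open>E \<mu> - E l\<close> of width below \<open>\<epsilon>\<close>, on which \<open>x\<close> and \<open>y\<close> both lie between \<open>l\<close> and \<open>\<mu>\<close>,
  would give a contradiction.\<close>
lemma spectral_family_inj_aux:
  fixes x y :: "'a::cstar_algebra"
  assumes aw: "aw_star TYPE('a)" and x: "cs_sa x" and y: "cs_sa y"
    and E: "is_spectral_family x E" "is_spectral_family y E" and e: "e > 0"
  shows "cs_pos (e *\<^sub>R 1 - (x - y))"
proof -
  note xD = is_spectral_familyD[OF E(1) x] and yD = is_spectral_familyD[OF E(2) y]
  define d where "d = x - y"
  have d: "cs_sa d" unfolding d_def by (rule cs_sa_diff[OF x y])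
  note dD = is_spectral_familyD[OF is_spectral_family_spec_proj[OF aw d] d]
  define q where "q = 1 - spec_proj d e"
  have q: "cs_proj q" unfolding q_def by (rule cs_proj_compl[OF dD(1)])
  have Ed: "E m * d = d * E m" for m unfolding d_def by (intro commute_intros xD(3) yD(3))
  have qE: "E m * q = q * E m" for m
    unfolding q_def by (intro commute_intros spec_proj_commute[OF aw d Ed])
  have qd: "q * d = d * q" unfolding q_def using dD(3)[of e] by (simp add: algebra_simps)
  have "q = 0"
  proof (rule ccontr)
    assume q0: "q \<noteq> 0"
    define A where "A = {l. q * E l \<noteq> 0}"
    obtain \<alpha> where \<alpha>: "\<And>l. l < - \<alpha> \<Longrightarrow> E l = 0" "\<And>l. l > \<alpha> \<Longrightarrow> E l = 1"
      using E(1) unfolding is_spectral_family_def by blast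
    have "\<alpha> + 1 \<in> A" using \<alpha>(2)[of "\<alpha> + 1"] q0 by (simp add: A_def)
    then have ne: "A \<noteq> {}" by blast
    have "- \<alpha> \<le> l" if "l \<in> A" for l using \<alpha>(1)[of l] that by (force simp: A_def)
    then have bd: "bdd_below A" by (auto simp: bdd_below_def)
    \<comment> \<open>\<mu> lies less than e/2 above \<open>Inf A\<close> and l lies e/4 below it,
      so the window is narrower than e while q still meets \<open>E \<mu> - E l\<close>.\<close>
    obtain \<mu> where \<mu>: "\<mu> \<in> A" "\<mu> < Inf A + e/2"
      using cInf_lessD[OF ne, of "Inf A + e/2"] e by auto
    define l where "l = Inf A - e/4"
    have "l \<notin> A" using cInf_lower[OF _ bd, of l] e by (auto simp: l_def)
    then have qEl: "q * E l = 0" by (simp add: A_def)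
    have "Inf A \<le> \<mu>" using cInf_lower[OF \<mu>(1) bd] .
    then have l\<mu>: "l \<le> \<mu>" "\<mu> - l < e" using \<mu>(2) e by (auto simp: l_def)
    have le: "cs_le (E l) (E \<mu>)" by (rule xD(2)[OF l\<mu>(1)])
    have EE: "E l * E \<mu> = E l" "E \<mu> * E l = E l"
      using le cs_proj_le_iff[OF xD(1) xD(1)] cs_proj_le_iff'[OF xD(1) xD(1)] by blast+
    define Q where "Q = E \<mu> - E l"
    have Q: "cs_proj Q" unfolding Q_def by (rule cs_proj_diff[OF xD(1) xD(1) le])
    have Qq: "Q * q = q * Q" unfolding Q_def using qE by (simp add: algebra_simps)
    have qQ: "q * Q \<noteq> 0" using \<mu>(1) qEl by (simp add: Q_def A_def right_diff_distrib)
    have Qx: "Q * d = d * Q" unfolding Q_def using Ed by (simp add: algebra_simps)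
    have "cs_pos ((\<mu> *\<^sub>R 1 - x) * E \<mu> * (1 - E l))"
      by (rule cs_pos_mult_proj[OF xD(4) cs_proj_compl[OF xD(1)]])
         (use EE xD(3)[of l] xD(3)[of \<mu>] in \<open>simp add: algebra_simps, metis mult.assoc\<close>)
    moreover have "(\<mu> *\<^sub>R 1 - x) * E \<mu> * (1 - E l) = (\<mu> *\<^sub>R 1 - x) * Q"
      unfolding Q_def using EE by (simp add: mult.assoc right_diff_distrib)
    moreover have "cs_pos ((y - l *\<^sub>R 1) * (1 - E l) * E \<mu>)"
      by (rule cs_pos_mult_proj[OF yD(5) xD(1)])
         (use EE yD(3)[of l] yD(3)[of \<mu>] in \<open>simp add: algebra_simps, metis mult.assoc\<close>)
    moreover have "(y - l *\<^sub>R 1) * (1 - E l) * E \<mu> = (y - l *\<^sub>R 1) * Q"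
      unfolding Q_def using EE by (simp add: mult.assoc left_diff_distrib)
    ultimately have "cs_pos ((\<mu> *\<^sub>R 1 - x) * Q + (y - l *\<^sub>R 1) * Q)" by (intro cs_pos_add) simp_all
    then have "cs_pos (((\<mu> - l) *\<^sub>R 1 - d) * Q)" by (simp add: d_def algebra_simps)
    then have 1: "cs_pos (((\<mu> - l) *\<^sub>R 1 - d) * Q * q)"
      by (rule cs_pos_mult_proj[OF _ q]) (intro commute_intros qd Qq[symmetric])
    have "cs_pos ((d - e *\<^sub>R 1) * q)" using dD(5)[of e] by (simp add: q_def)
    then have 2: "cs_pos ((d - e *\<^sub>R 1) * q * Q)"
      by (rule cs_pos_mult_proj[OF _ Q]) (intro commute_intros Qx Qq)
    \<comment> \<open>The left side is a sum of positive terms, the right side a negative multiple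
      of the positive element \<open>q * Q\<close>.\<close>
    have "((\<mu> - l) *\<^sub>R 1 - d) * Q * q + (d - e *\<^sub>R 1) * q * Q = (\<mu> - l - e) *\<^sub>R (q * Q)"
      by (simp add: mult.assoc Qq) (simp add: algebra_simps)
    then have "cs_pos ((\<mu> - l - e) *\<^sub>R (q * Q))" using cs_pos_add[OF 1 2] by simp
    then have "q * Q = 0"
      by (rule neg_scale_proj_pos) (use l\<mu> cs_pos_mult_proj[OF cs_proj_pos[OF q] Q Qq] in auto)
    with qQ show False ..
  qed
  then have "spec_proj d e = 1" by (simp add: q_def)
  then show ?thesis using dD(4)[of e] by (simp add: d_def)
qed

lemma eq_0_if_squeezed:
  fixes d :: "'a::cstar_algebra"
  assumes d: "cs_sa d" and "\<And>e. e > 0 \<Longrightarrow> cs_pos (e *\<^sub>R 1 - d)" "\<And>e. e > 0 \<Longrightarrow> cs_pos (e *\<^sub>R 1 + d)"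
  shows "d = 0"
proof -
  have "norm d \<le> e" if e: "e > 0" for e
  proof (rule sa_norm_le[OF d])
    fix t assume t: "t \<in> real_spectrum d"
    have "e - t \<in> real_spectrum (e *\<^sub>R 1 - d)" using t by (simp add: real_spectrum_diff)
    then have 1: "t \<le> e" using assms(2)[OF e] by (force simp: cs_pos_iff)
    have "- t \<in> real_spectrum (- d)" using t by (simp add: real_spectrum_minus)
    then have "e + t \<in> real_spectrum (e *\<^sub>R 1 - (- d))" unfolding real_spectrum_diff by simp
    then have "- e \<le> t" using assms(3)[OF e] by (force simp: cs_pos_iff)
    with 1 show "\<bar>t\<bar> \<le> e" by simp
  qed
  then have "norm d \<le> 0" by (metis dense_ge)
  then show ?thesis by simp
qed

lemma spectral_family_inj:
  fixes x y :: "'a::cstar_algebra"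
  assumes aw: "aw_star TYPE('a)" and x: "cs_sa x" and y: "cs_sa y"
    and eq: "spectral_family x = spectral_family y"
  shows "x = y"
proof -
  have E: "is_spectral_family x (spectral_family x)" "is_spectral_family y (spectral_family x)"
    using is_spectral_family_spectral_family[OF aw x] is_spectral_family_spectral_family[OF aw y] eq by simp_all
  have "x - y = 0"
    using spectral_family_inj_aux[OF aw x y E] spectral_family_inj_aux[OF aw y x E(2,1)]
    by (intro eq_0_if_squeezed cs_sa_diff x y) (simp_all add: algebra_simps)
  then show ?thesis by simp
qed

text \<open>The spectral family of \<open>s q + r p\<close> for p below q, an element with value s +
  r on p, s on q - p and 0 on 1 - q.\<close>

definition two_step :: "real \<Rightarrow> real \<Rightarrow> 'a::cstar_algebra \<Rightarrow> 'a \<Rightarrow> real \<Rightarrow> 'a" where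
  "two_step s r p q l = (if l < 0 then 0 else if l < s then 1 - q else if l < s + r then 1 - p else 1)"

lemma is_spectral_family_two_step:
  fixes p q :: "'a::cstar_algebra"
  assumes p: "cs_proj p" and q: "cs_proj q" and le: "cs_le p q" and s: "0 \<le> s" and r: "0 \<le> r"
  shows "is_spectral_family (s *\<^sub>R q + r *\<^sub>R p) (two_step s r p q)"
proof -
  let ?x = "s *\<^sub>R q + r *\<^sub>R p" and ?E = "two_step s r p q"
  have pq: "q * p = p" "p * q = p" using le cs_proj_le_iff[OF p q] cs_proj_le_iff'[OF p q] by simp_all
  have pp: "p * p = p" "q * q = q" using p q by (auto simp: cs_proj_def)
  have proj: "cs_proj (?E l)" for l by (simp add: two_step_def p q cs_proj_compl)
  have mono: "cs_le (?E l) (?E m)" if "l \<le> m" for l m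
    using that le s r unfolding two_step_def
    by (auto simp: cs_proj_ge_0 cs_proj_le_1 cs_proj_compl p q cs_proj_le_compl_iff cs_le_refl cs_proj_sa)
  have glb: "proj_glb {?E m | m. m > l} (?E l)" for l
  proof -
    \<comment> \<open>The steps are closed on the left, so the family is constant just to the right
      of l and the infimum is attained.\<close>
    have "\<exists>m>l. ?E m = ?E l"
    proof -
      consider "l < 0" | "0 \<le> l" "l < s" | "0 \<le> l" "s \<le> l" "l < s + r" | "0 \<le> l" "s \<le> l" "s + r \<le> l" by linarith
      then show ?thesis
      proof cases
        case 1 then show ?thesis by (intro exI[of _ "l/2"]) (auto simp: two_step_def)
      next
        case 2 then show ?thesis by (intro exI[of _ "(l+s)/2"]) (auto simp: two_step_def)
      next
        case 3 then show ?thesis by (intro exI[of _ "(l+(s+r))/2"]) (auto simp: two_step_def)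
      next
        case 4 then show ?thesis by (intro exI[of _ "l+1"]) (auto simp: two_step_def)
      qed
    qed
    then obtain m where "m > l" "?E m = ?E l" by blast
    then have "?E l \<in> {?E m | m. m > l}" unfolding mem_Collect_eq by (intro exI[of _ m]) simp
    moreover have "cs_le (?E l) y" if "y \<in> {?E m | m. m > l}" for y
      using that mono[of l] by (auto dest: less_imp_le)
    ultimately show ?thesis unfolding proj_glb_def using proj by blast
  qed
  have bd: "\<exists>\<alpha>>0. (\<forall>l< -\<alpha>. ?E l = 0) \<and> (\<forall>l>\<alpha>. ?E l = 1)"
    using s r by (intro exI[of _ "s + r + 1"]) (auto simp: two_step_def)
  have psa: "cs_sa p" "cs_sa q" "cs_sa (1::'a)" "cs_sa (0::'a)" using p q by (auto simp: cs_proj_sa cs_sa_one cs_sa_zero)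
  note sas = psa cs_sa_add cs_sa_diff cs_sa_scaleR
  note poss = cs_pos_add cs_pos_scaleR cs_proj_pos[OF p] cs_proj_pos[OF q]
    cs_proj_pos[OF cs_proj_compl[OF q]] cs_proj_pos[OF cs_proj_diff[OF p q le]] cs_proj_pos[OF cs_proj_1]
  have up: "cs_le (?x * ?E l) (l *\<^sub>R ?E l)" for l
  proof -
    consider "l < 0" | "0 \<le> l" "l < s" | "0 \<le> l" "s \<le> l" "l < s + r" | "0 \<le> l" "s \<le> l" "s + r \<le> l" by linarith
    then show ?thesis
    proof cases
      case 1 then show ?thesis by (simp add: two_step_def cs_le_def cs_sa_zero)
    next
      case 2
      have "?x * (1 - q) = 0" using pq pp by (simp add: algebra_simps)
      then show ?thesis using 2 by (simp add: two_step_def cs_le_def sas poss)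
    next
      case 3
      have eq: "?x * (1 - p) = s *\<^sub>R (q - p)" using pq pp by (simp add: algebra_simps)
      have "l *\<^sub>R (1 - p) - s *\<^sub>R (q - p) = (l - s) *\<^sub>R (q - p) + l *\<^sub>R (1 - q)" by (simp add: algebra_simps)
      then have "cs_pos (l *\<^sub>R (1 - p) - s *\<^sub>R (q - p))" using 3 by (simp only:) (intro poss, auto)
      then show ?thesis using 3 by (simp add: two_step_def cs_le_def sas eq)
    next
      case 4
      have "l *\<^sub>R 1 - ?x = (l - s - r) *\<^sub>R p + (l - s) *\<^sub>R (q - p) + l *\<^sub>R (1 - q)" by (simp add: algebra_simps)
      then have "cs_pos (l *\<^sub>R 1 - ?x)" using 4 by (simp only:) (intro poss, auto)
      then show ?thesis using 4 by (simp add: two_step_def cs_le_def sas)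
    qed
  qed
  have lo: "cs_le (l *\<^sub>R (1 - ?E l)) (?x * (1 - ?E l))" for l
  proof -
    consider "l < 0" | "0 \<le> l" "l < s" | "0 \<le> l" "s \<le> l" "l < s + r" | "0 \<le> l" "s \<le> l" "s + r \<le> l" by linarith
    then show ?thesis
    proof cases
      case 1
      have "?x - l *\<^sub>R 1 = s *\<^sub>R q + r *\<^sub>R p + (- l) *\<^sub>R 1" by simp
      then have "cs_pos (?x - l *\<^sub>R 1)" using 1 s r by (simp only:) (intro poss, auto)
      then show ?thesis using 1 by (simp add: two_step_def cs_le_def sas)
    next
      case 2
      have eq: "?x * q = ?x" using pq pp by (simp add: algebra_simps)
      have "?x - l *\<^sub>R q = (s - l) *\<^sub>R q + r *\<^sub>R p" by (simp add: algebra_simps)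
      then have "cs_pos (?x - l *\<^sub>R q)" using 2 r by (simp only:) (intro poss, auto)
      then show ?thesis using 2 by (simp add: two_step_def cs_le_def sas eq)
    next
      case 3
      have eq: "?x * p = (s + r) *\<^sub>R p" using pq pp by (simp add: algebra_simps)
      have "(s + r) *\<^sub>R p - l *\<^sub>R p = (s + r - l) *\<^sub>R p" by (simp add: algebra_simps)
      then have "cs_pos ((s + r) *\<^sub>R p - l *\<^sub>R p)" using 3 by (simp only:) (intro poss, auto)
      then show ?thesis using 3 by (simp add: two_step_def cs_le_def sas eq)
    next
      case 4 then show ?thesis by (simp add: two_step_def cs_le_def cs_sa_zero)
    qed
  qed
  show ?thesis unfolding is_spectral_family_def using proj mono glb bd up lo by blast
qed

lemma spectral_family_two_step:
  fixes p q :: "'a::cstar_algebra"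
  assumes aw: "aw_star TYPE('a)" and p: "cs_proj p" and q: "cs_proj q" and le: "cs_le p q" and s: "0 \<le> s" and r: "0 \<le> r"
  shows "spectral_family (s *\<^sub>R q + r *\<^sub>R p) = two_step s r p q"
  using assms by (intro spectral_family_eq is_spectral_family_two_step) (auto simp: cs_sa_add cs_sa_scaleR cs_proj_sa)

section \<open>Atoms of a type I factor\<close>

text \<open>Phrased by one-dimensional corners instead of minimality, because scalars in the corner
  are what normalizes partial isometries. \<open>cs_atom_le_cases\<close> recovers minimality, and
  \<open>minimal_atom\<close> is the converse.\<close>

definition cs_atom :: "'a::cstar_algebra \<Rightarrow> bool" where
  "cs_atom e \<longleftrightarrow> cs_proj e \<and> e \<noteq> 0 \<and> (\<forall>x. \<exists>c. e * x * e = scaleC c e)"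

lemma scaleC_eq_0_iff: "scaleC c x = 0 \<longleftrightarrow> c = 0 \<or> x = (0::'a::cstar_algebra)"
  using norm_scaleC[of c x] by (metis mult_eq_0_iff norm_eq_zero scaleC_zero_left scaleC_zero_right)

lemma scaleC_cancel: "scaleC a x = scaleC b x \<longleftrightarrow> a = b \<or> x = (0::'a::cstar_algebra)"
  using scaleC_eq_0_iff[of "a - b" x] by (simp add: scaleC_diff_left)

lemma idempotent_scaleC:
  fixes e :: "'a::cstar_algebra"
  assumes e: "e * e = e" and p: "scaleC c e * scaleC c e = scaleC c e"
  shows "scaleC c e = 0 \<or> scaleC c e = e"
proof -
  have "scaleC (c * c) e = scaleC c e" using p e by (simp add: scaleC_mult_left scaleC_mult_right scaleC_scaleC)
  then have "c * c = c \<or> e = 0" by (simp add: scaleC_cancel)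
  then have "c = 0 \<or> c = 1 \<or> e = 0" by auto
  then show ?thesis by (auto simp: scaleC_one)
qed

lemma aw_factor_aw: "aw_factor T \<Longrightarrow> aw_star T"
  by (simp add: aw_factor_def)

text \<open>The right annihilator of all \<open>p * x\<close> is a two-sided ideal, so its
  projection z is central and hence 0 or 1. Since z fixes q, z = 1 and p = 0.\<close>

lemma factor_prime:
  fixes p q :: "'a::cstar_algebra"
  assumes fac: "aw_factor TYPE('a)" and pq: "\<And>x. p * x * q = 0" and q: "q \<noteq> 0"
  shows "p = 0"
proof -
  obtain z where z: "cs_proj z" "\<And>y. (\<forall>s\<in>range (\<lambda>x. p * x). s * y = 0) \<longleftrightarrow> z * y = y"
    using aw_annihilator[OF aw_factor_aw[OF fac], of "range (\<lambda>x. p * x)"] by blast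
  have pz: "p * x * z = 0" for x using z(2)[of z] cs_proj_idem[OF z(1)] by blast
  have l: "z * (m * z) = m * z" for m
  proof -
    have "p * x * (m * z) = 0" for x using pz[of "x * m"] by (simp add: mult.assoc)
    then show ?thesis using z(2)[of "m * z"] by blast
  qed
  have "z * m = m * z" for m
  proof -
    have "adj (z * (adj m * z)) = adj (adj m * z)" by (simp add: l)
    then have "z * m * z = z * m" using z(1) by (simp add: adj_mult adj_adj cs_proj_def)
    then show ?thesis using l[of m] by (simp add: mult.assoc)
  qed
  then have "z \<in> cs_center" by (simp add: cs_center_def)
  then obtain c where "z = scaleC c 1" using fac by (auto simp: aw_factor_def)
  then have "z = 0 \<or> z = 1" using idempotent_scaleC[of "1::'a" c] cs_proj_idem[OF z(1)] by simp
  moreover have "z * q = q" using z(2)[of q] pq by blast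
  ultimately have "z = 1" using q by auto
  then show ?thesis using pz[of 1] by simp
qed

text \<open>Commutativity of the corner moves p next to e - p, so \<open>p * x * (e - p) = 0\<close>
  for all x, and by primeness one of p and e - p vanishes.\<close>

lemma abelian_minimal:
  fixes e p :: "'a::cstar_algebra"
  assumes fac: "aw_factor TYPE('a)" and e: "cs_abelian_proj e" and p: "cs_proj p" "cs_le p e"
  shows "p = 0 \<or> p = e"
proof (cases "e - p = 0")
  case False
  have pe: "cs_proj e" using e by (simp add: cs_abelian_proj_def)
  have pep: "e * p = p" "p * e = p" using cs_proj_le_iff[OF p(1) pe] cs_proj_le_iff'[OF p(1) pe] p(2) by simp_all
  have "p * x * (e - p) = 0" for x
  proof -
    have "(e * p * e) * (e * (x * (e - p)) * e) = (e * (x * (e - p)) * e) * (e * p * e)"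
      using e by (simp add: cs_abelian_proj_def)
    moreover have "(e * p * e) * (e * (x * (e - p)) * e) = p * x * (e - p)"
      using pep cs_proj_idem[OF pe] cs_proj_idem[OF p(1)] cs_proj_idem_assoc[OF pe]
      by (simp add: mult.assoc left_diff_distrib) (simp add: pep cs_proj_idem[OF pe] flip: mult.assoc)
    moreover have "(e * (x * (e - p)) * e) * (e * p * e) = e * x * ((e - p) * p)"
      using pep cs_proj_idem_assoc[OF pe] by (simp add: mult.assoc)
    moreover have "(e - p) * p = 0" using pep cs_proj_idem[OF p(1)] by (simp add: left_diff_distrib)
    ultimately show ?thesis by simp
  qed
  then show ?thesis using factor_prime[OF fac _ False] by blast
qed simp

text \<open>By minimality every spectral projection cuts e down to 0 or e. The level r at which it
  switches is then the only value of x on e.\<close>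

lemma minimal_corner_sa:
  fixes e x :: "'a::cstar_algebra"
  assumes aw: "aw_star TYPE('a)" and e: "cs_proj e" "e \<noteq> 0"
    and min: "\<And>p. cs_proj p \<Longrightarrow> cs_le p e \<Longrightarrow> p = 0 \<or> p = e"
    and x: "cs_sa x" "e * x = x" "x * e = x"
  shows "\<exists>r::real. x = r *\<^sub>R e"
proof -
  note D = is_spectral_familyD[OF is_spectral_family_spec_proj[OF aw x(1)] x(1)]
  let ?E = "spec_proj x"
  have eE: "e * ?E l = ?E l * e" for l using spec_proj_commute[OF aw x(1)] x by simp
  have dich: "?E l * e = 0 \<or> ?E l * e = e" for l
  proof (rule min)
    have "?E l * e * (?E l * e) = ?E l * (e * ?E l) * e" by (simp only: mult.assoc)
    also have "\<dots> = ?E l * e"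
      by (simp add: eE mult.assoc cs_proj_idem[OF e(1)] cs_proj_idem_assoc[OF D(1)])
    finally show pr: "cs_proj (?E l * e)" using D(1) e(1) by (simp add: cs_proj_def adj_mult eE)
    show "cs_le (?E l * e) e"
      using cs_proj_le_iff'[OF pr e(1)] by (simp add: mult.assoc cs_proj_idem[OF e(1)])
  qed
  define A where "A = {l. ?E l * e \<noteq> 0}"
  have "norm x \<in> A"
    using spec_proj_eq_1[OF aw x(1), of "norm x"] real_spectrum_bounded e(2) by (force simp: A_def)
  then have ne: "A \<noteq> {}" by blast
  have "- norm x \<le> l" if "l \<in> A" for l
  proof (rule ccontr)
    assume "\<not> - norm x \<le> l"
    then have "?E l = 0" using spec_proj_eq_0[OF aw x(1), of l] real_spectrum_bounded by force
    with that show False by (simp add: A_def)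
  qed
  then have bd: "bdd_below A" by (auto simp: bdd_below_def)
  define r where "r = Inf A"
  \<comment> \<open>x and \<open>r e\<close> vanish off e, so this term extends the estimates from
    the corner to the whole algebra.\<close>
  have e1: "cs_pos (d *\<^sub>R (1 - e))" if "d > 0" for d
    using that cs_proj_pos[OF cs_proj_compl[OF e(1)]] by (intro cs_pos_scaleR) auto
  have up: "cs_pos (d *\<^sub>R 1 + (r *\<^sub>R e - x))" if d: "d > 0" for d
  proof -
    obtain m where m: "m \<in> A" "m < r + d" using cInf_lessD[OF ne, of "r + d"] d by (auto simp: r_def)
    have Em: "?E m * e = e" using m(1) dich by (auto simp: A_def)
    have "e * ((m *\<^sub>R 1 - x) * ?E m) = (m *\<^sub>R 1 - x) * ?E m * e"
      using x by (intro commute_intros eE) simp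
    then have "cs_pos ((m *\<^sub>R 1 - x) * ?E m * e)" by (rule cs_pos_mult_proj[OF D(4) e(1)])
    also have "(m *\<^sub>R 1 - x) * ?E m * e = m *\<^sub>R e - x" using x by (simp add: mult.assoc Em left_diff_distrib)
    finally have 1: "cs_pos (m *\<^sub>R e - x)" .
    have 2: "cs_pos ((r + d - m) *\<^sub>R e)" using m(2) cs_proj_pos[OF e(1)] by (intro cs_pos_scaleR) auto
    have eq: "m *\<^sub>R e - x + (r + d - m) *\<^sub>R e + d *\<^sub>R (1 - e) = d *\<^sub>R 1 + (r *\<^sub>R e - x)"
      by (simp add: algebra_simps)
    show ?thesis using cs_pos_add[OF cs_pos_add[OF 1 2] e1[OF d]] by (simp only: eq)
  qed
  have lo: "cs_pos (d *\<^sub>R 1 - (r *\<^sub>R e - x))" if d: "d > 0" for d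
  proof -
    define l where "l = r - d"
    have "l \<notin> A" using cInf_lower[OF _ bd, of l] d by (auto simp: l_def r_def)
    then have El: "?E l * e = 0" by (simp add: A_def)
    have "e * ((x - l *\<^sub>R 1) * (1 - ?E l)) = (x - l *\<^sub>R 1) * (1 - ?E l) * e"
      using x by (intro commute_intros eE) simp
    then have "cs_pos ((x - l *\<^sub>R 1) * (1 - ?E l) * e)" by (rule cs_pos_mult_proj[OF D(5) e(1)])
    also have "(x - l *\<^sub>R 1) * (1 - ?E l) * e = x - l *\<^sub>R e"
      using x El by (simp add: mult.assoc left_diff_distrib)
    finally have 1: "cs_pos (x - l *\<^sub>R e)" .
    have eq: "x - l *\<^sub>R e + d *\<^sub>R (1 - e) = d *\<^sub>R 1 - (r *\<^sub>R e - x)"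
      by (simp add: algebra_simps l_def)
    show ?thesis using cs_pos_add[OF 1 e1[OF d]] by (simp only: eq)
  qed
  have "r *\<^sub>R e - x = 0"
    by (rule eq_0_if_squeezed[OF _ lo up]) (intro cs_sa_diff cs_sa_scaleR cs_proj_sa e(1) x(1))
  then show ?thesis by auto
qed

lemma minimal_atom:
  fixes e :: "'a::cstar_algebra"
  assumes aw: "aw_star TYPE('a)" and e: "cs_proj e" "e \<noteq> 0"
    and min: "\<And>p. cs_proj p \<Longrightarrow> cs_le p e \<Longrightarrow> p = 0 \<or> p = e"
  shows "cs_atom e"
  unfolding cs_atom_def
proof (intro conjI allI)
  fix x :: 'a
  have sa: "\<exists>r::real. e * h * e = r *\<^sub>R e" if h: "cs_sa h" for h
  proof (rule minimal_corner_sa[OF aw e min])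
    show "cs_sa (e * h * e)" using h e(1) by (simp add: cs_sa_def cs_proj_def adj_mult mult.assoc)
    show "e * (e * h * e) = e * h * e" by (simp add: mult.assoc cs_proj_idem_assoc[OF e(1)])
    show "e * h * e * e = e * h * e" by (simp add: mult.assoc cs_proj_idem[OF e(1)])
  qed
  define h where "h = (1/2) *\<^sub>R (x + adj x)"
  define k where "k = scaleC (- \<i> / 2) (x - adj x)"
  have "cs_sa h" by (simp add: h_def cs_sa_def adj_scaleR adj_add adj_adj add.commute)
  moreover have "cs_sa k"
    by (simp add: k_def cs_sa_def adj_scaleC adj_diff adj_adj scaleC_diff_right scaleC_minus_left)
  ultimately obtain a b where ab: "e * h * e = a *\<^sub>R e" "e * k * e = b *\<^sub>R e" using sa by meson
  have "scaleC \<i> k = scaleC (complex_of_real (1/2)) (x - adj x)" unfolding k_def scaleC_scaleC by simp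
  then have "scaleC \<i> k = (1/2) *\<^sub>R (x - adj x)" by (simp only: scaleC_of_real)
  then have "h + scaleC \<i> k = (1/2) *\<^sub>R (x + x)" by (simp add: h_def algebra_simps)
  also have "\<dots> = x" using scaleR_half_double[of x] by simp
  finally have x: "x = h + scaleC \<i> k" ..
  have "e * x * e = a *\<^sub>R e + scaleC \<i> (b *\<^sub>R e)"
    by (subst x) (simp add: distrib_left distrib_right scaleC_mult_left scaleC_mult_right ab)
  also have "\<dots> = scaleC (of_real a + \<i> * of_real b) e"
    by (simp add: scaleC_add_left scaleC_of_real flip: scaleC_scaleC)
  finally show "\<exists>c. e * x * e = scaleC c e" by blast
qed (use e in auto)

lemma typeI_atom_exists:
  assumes fac: "aw_factor TYPE('a::cstar_algebra)" and I: "aw_typeI TYPE('a)"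
  shows "\<exists>e::'a. cs_atom e"
proof -
  obtain e :: 'a where e: "cs_abelian_proj e" "\<And>z. cs_proj z \<Longrightarrow> z \<in> cs_center \<Longrightarrow> cs_le e z \<Longrightarrow> z = 1"
    using I unfolding aw_typeI_def by blast
  have pe: "cs_proj e" using e(1) by (simp add: cs_abelian_proj_def)
  have "e \<noteq> 0"
  proof
    assume "e = 0"
    then have "(0::'a) = 1" by (intro e(2)) (auto simp: cs_center_def cs_le_refl cs_sa_zero)
    then show False by simp
  qed
  then have "cs_atom e" using minimal_atom[OF aw_factor_aw[OF fac] pe] abelian_minimal[OF fac e(1)] by blast
  then show ?thesis ..
qed

section \<open>Atoms and partial isometries\<close>

lemma cs_atom_proj: "cs_atom e \<Longrightarrow> cs_proj e" by (simp add: cs_atom_def)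
lemma cs_atom_nonzero: "cs_atom e \<Longrightarrow> e \<noteq> 0" by (simp add: cs_atom_def)

lemma cs_atom_le_cases:
  fixes e p :: "'a::cstar_algebra"
  assumes e: "cs_atom e" and p: "cs_proj p" "cs_le p e" shows "p = 0 \<or> p = e"
proof -
  note pe = cs_atom_proj[OF e]
  have "e * p * e = p" using cs_proj_le_iff[OF p(1) pe] cs_proj_le_iff'[OF p(1) pe] p(2) by simp
  moreover obtain c where "e * p * e = scaleC c e" using e by (auto simp: cs_atom_def)
  ultimately have c: "p = scaleC c e" by simp
  show ?thesis using idempotent_scaleC[of e c] cs_proj_idem[OF p(1)] cs_proj_idem[OF pe] unfolding c by simp
qed

lemma cs_atom_le_atom: "cs_atom e \<Longrightarrow> cs_atom f \<Longrightarrow> cs_le e f \<Longrightarrow> e = f"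
  using cs_atom_le_cases cs_atom_proj cs_atom_nonzero by blast

text \<open>\<open>adj w * w\<close> lies in the corner of e, so it is a scalar multiple of e;
  self-adjointness makes the scalar real and \<open>eq_0_if_neg_adj_mult_pos\<close> makes it
  positive. Dividing w by the root of r yields a partial isometry.\<close>

lemma cs_atom_normalize:
  fixes e w :: "'a::cstar_algebra"
  assumes e: "cs_atom e" and w: "w * e = w" "w \<noteq> 0"
  shows "\<exists>r>0. adj w * w = r *\<^sub>R e"
proof -
  note pe = cs_atom_proj[OF e]
  have "adj (w * e) * (w * e) = e * (adj w * w) * e" using pe by (simp add: adj_mult cs_proj_def mult.assoc)
  then have ww: "adj w * w = e * (adj w * w) * e" using w by simp
  obtain c where "e * (adj w * w) * e = scaleC c e" using e by (auto simp: cs_atom_def)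
  with ww have c: "adj w * w = scaleC c e" by simp
  have "adj (adj w * w) = adj w * w" by (simp add: adj_mult adj_adj)
  then have "scaleC (cnj c) e = scaleC c e" unfolding c using pe by (simp add: adj_scaleC cs_proj_def)
  then have "cnj c = c" using cs_atom_nonzero[OF e] by (simp add: scaleC_cancel)
  then have "c = of_real (Re c)" by (simp add: complex_eq_iff)
  then have r: "adj w * w = Re c *\<^sub>R e" using c by (metis scaleC_of_real)
  have "Re c > 0"
  proof (rule ccontr)
    assume "\<not> Re c > 0"
    then have "cs_pos ((- Re c) *\<^sub>R e)" by (intro cs_pos_scaleR cs_proj_pos pe) simp
    then have "cs_pos (- (adj w * w))" using r by simp
    then show False using eq_0_if_neg_adj_mult_pos w(2) by blast
  qed
  with r show ?thesis by blast
qed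

text \<open>v carries the corner of e onto the corner of its range projection.\<close>

lemma cs_atom_transfer:
  fixes e v :: "'a::cstar_algebra"
  assumes e: "cs_atom e" and v: "v * e = v" "adj v * v = e" shows "cs_atom (v * adj v)"
  unfolding cs_atom_def
proof (intro conjI allI)
  note pe = cs_atom_proj[OF e]
  have ev: "e * adj v = adj v" using v(1) pe by (metis adj_mult cs_proj_def)
  have "v * adj v * (v * adj v) = v * (adj v * v) * adj v" by (simp only: mult.assoc)
  then show "cs_proj (v * adj v)" using v by (simp add: cs_proj_def adj_mult adj_adj)
  have "v \<noteq> 0" using v(2) cs_atom_nonzero[OF e] by auto
  then have "adj v \<noteq> 0" by (metis adj_adj adj_zero)
  then show "v * adj v \<noteq> 0" using adj_mult_self_eq_0[of "adj v"] by (simp add: adj_adj)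
  fix x
  obtain c where c: "e * (adj v * x * v) * e = scaleC c e" using e by (auto simp: cs_atom_def)
  have "v * adj v * x * (v * adj v) = v * e * (adj v * x * v) * (e * adj v)" by (simp add: v(1) ev mult.assoc)
  also have "\<dots> = v * (e * (adj v * x * v) * e) * adj v" by (simp only: mult.assoc)
  also have "\<dots> = scaleC c (v * adj v)" unfolding c by (simp add: scaleC_mult_left scaleC_mult_right v)
  finally show "\<exists>c. v * adj v * x * (v * adj v) = scaleC c (v * adj v)" by blast
qed

text \<open>Primeness supplies some nonzero \<open>p * x * e\<close>, and normalizing it gives
  v.\<close>

lemma atom_partial_isometry:
  fixes e p :: "'a::cstar_algebra"
  assumes fac: "aw_factor TYPE('a)" and e: "cs_atom e" and p: "cs_proj p" "p \<noteq> 0"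
  shows "\<exists>v. adj v * v = e \<and> v * e = v \<and> p * v = v"
proof -
  note pe = cs_atom_proj[OF e]
  obtain x where x: "p * x * e \<noteq> 0" using factor_prime[OF fac, of p e] cs_atom_nonzero[OF e] p(2) by blast
  define w where "w = p * x * e"
  have we: "w * e = w" "w \<noteq> 0" using x by (auto simp: w_def mult.assoc cs_proj_idem[OF pe])
  have pw: "p * w = w" by (simp add: w_def mult.assoc cs_proj_idem_assoc[OF p(1)])
  obtain r where r: "r > 0" "adj w * w = r *\<^sub>R e" using cs_atom_normalize[OF e we] by blast
  show ?thesis
    by (rule exI[of _ "(1 / sqrt r) *\<^sub>R w"])
       (use r we pw in \<open>simp add: adj_scaleR field_simps\<close>)
qed

lemma atom_below:
  fixes e p :: "'a::cstar_algebra"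
  assumes fac: "aw_factor TYPE('a)" and e: "cs_atom e" and p: "cs_proj p" "p \<noteq> 0"
  shows "\<exists>f. cs_atom f \<and> cs_le f p"
proof -
  obtain v where v: "adj v * v = e" "v * e = v" "p * v = v" using atom_partial_isometry[OF assms] by blast
  have a: "cs_atom (v * adj v)" by (rule cs_atom_transfer[OF e v(2,1)])
  moreover have "cs_le (v * adj v) p"
    using cs_proj_le_iff[OF cs_atom_proj[OF a] p(1)] v(3) by (simp flip: mult.assoc)
  ultimately show ?thesis by blast
qed

text \<open>Otherwise p minus the infimum m of p and q dominates an atom f; it lies below p, hence
  below q and m, yet it is orthogonal to m.\<close>

lemma atomistic:
  fixes p q :: "'a::cstar_algebra"
  assumes fac: "aw_factor TYPE('a)" and I: "aw_typeI TYPE('a)" and p: "cs_proj p" and q: "cs_proj q"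
    and le: "\<And>e. cs_atom e \<Longrightarrow> cs_le e p \<Longrightarrow> cs_le e q"
  shows "cs_le p q"
proof -
  obtain m where m: "proj_glb {p, q} m" using proj_glb_exists[OF aw_factor_aw[OF fac], of "{p, q}"] p q by auto
  then have pm: "cs_proj m" and mp: "cs_le m p" and mq: "cs_le m q"
    and glb: "\<And>r. cs_proj r \<Longrightarrow> cs_le r p \<Longrightarrow> cs_le r q \<Longrightarrow> cs_le r m" by (auto simp: proj_glb_def)
  have d: "cs_proj (p - m)" by (rule cs_proj_diff[OF pm p mp])
  have "p - m = 0"
  proof (rule ccontr)
    assume "p - m \<noteq> 0"
    then obtain f where f: "cs_atom f" "cs_le f (p - m)"
      using atom_below[OF fac _ d] typeI_atom_exists[OF fac I] by blast
    note pf = cs_atom_proj[OF f(1)]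
    have "cs_le (p - m) p" using p pm by (simp add: cs_le_def cs_sa_diff cs_proj_sa cs_proj_pos)
    then have fp: "cs_le f p" using f(2) cs_le_trans by blast
    then have "cs_le f m" using glb[OF pf] le f(1) by blast
    then have "(p - m) * f = f" "p * f = f" "m * f = f"
      using f(2) fp cs_proj_le_iff[OF pf] d p pm by auto
    then have "f = 0" by (simp add: left_diff_distrib)
    then show False using cs_atom_nonzero[OF f(1)] by simp
  qed
  then show ?thesis using mq by simp
qed

text \<open>A Gram-Schmidt step: h is the range projection of \<open>(1 - e) * f\<close>, and e + h
  is the join of e and f. The join enters only through its upper bounds r.\<close>

lemma atom_cover:
  fixes e f :: "'a::cstar_algebra"
  assumes e: "cs_atom e" and f: "cs_atom f" and ne: "e \<noteq> f"
  shows "\<exists>h. cs_atom h \<and> e * h = 0 \<and> (e + h) * f = f \<and>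
    (\<forall>r. cs_proj r \<and> cs_le e r \<and> cs_le f r \<longrightarrow> cs_le h r)"
proof -
  note pe = cs_atom_proj[OF e] and pf = cs_atom_proj[OF f]
  define w where "w = (1 - e) * f"
  have wf: "w * f = w" by (simp add: w_def mult.assoc cs_proj_idem[OF pf])
  have "w \<noteq> 0"
  proof
    assume "w = 0"
    then have "cs_le f e" using cs_proj_le_iff[OF pf pe] by (simp add: w_def left_diff_distrib)
    then show False using cs_atom_le_atom[OF f e] ne by simp
  qed
  then obtain s where s: "s > 0" "adj w * w = s *\<^sub>R f" using cs_atom_normalize[OF f wf] by blast
  have aw: "adj w = f * (1 - e)" using pe pf by (simp add: w_def adj_mult adj_diff cs_proj_def)
  define v where "v = (1 / sqrt s) *\<^sub>R w"
  have v: "v * f = v" "adj v * v = f" using s wf by (simp_all add: v_def adj_scaleR)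
  define h where "h = v * adj v"
  have h: "h = (1 / s) *\<^sub>R (w * adj w)" using s by (simp add: h_def v_def adj_scaleR)
  have ah: "cs_atom h" unfolding h_def by (rule cs_atom_transfer[OF f v])
  have ew: "e * w = 0" by (simp add: w_def right_diff_distrib left_diff_distrib cs_proj_idem_assoc[OF pe])
  then have "e * h = 0" by (simp add: h flip: mult.assoc)
  moreover have "(e + h) * f = f"
  proof -
    have "adj w * f = adj w * w" unfolding aw unfolding w_def
      by (simp only: mult.assoc cs_proj_idem_assoc[OF cs_proj_compl[OF pe]])
    then have "h * f = w" using s wf by (simp add: h mult.assoc)
    then show ?thesis by (simp add: w_def algebra_simps)
  qed
  moreover have "cs_le h r" if r: "cs_proj r" "cs_le e r" "cs_le f r" for r
  proof -
    have re: "r * e = e" "r * f = f" using r cs_proj_le_iff[OF pe r(1)] cs_proj_le_iff[OF pf r(1)] by simp_all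
    then have "r * w = w" by (simp add: w_def left_diff_distrib right_diff_distrib flip: mult.assoc)
    then show ?thesis using cs_proj_le_iff[OF cs_atom_proj[OF ah] r(1)] by (simp add: h flip: mult.assoc)
  qed
  ultimately show ?thesis using ah by blast
qed

lemma cs_proj_add:
  fixes e h :: "'a::cstar_algebra"
  assumes "cs_proj e" "cs_proj h" "e * h = 0" shows "cs_proj (e + h)"
proof -
  have "h * e = adj (e * h)" using assms(1,2) by (simp add: adj_mult cs_proj_def)
  then have "h * e = 0" using assms(3) by simp
  then show ?thesis using assms by (simp add: cs_proj_def adj_add distrib_left distrib_right)
qed

text \<open>Two distinct atoms in a join of two atoms span it. Over f, both joins have orthogonal
  complements h and k that are atoms, and k below f + h forces k = h.\<close>

lemma atom_exchange:
  fixes e f g :: "'a::cstar_algebra"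
  assumes e: "cs_atom e" and f: "cs_atom f" and g: "cs_atom g" and ne: "e \<noteq> f" "g \<noteq> f"
    and le: "\<And>r. cs_proj r \<Longrightarrow> cs_le e r \<Longrightarrow> cs_le f r \<Longrightarrow> cs_le g r"
    and r: "cs_proj r" "cs_le f r" "cs_le g r"
  shows "cs_le e r"
proof -
  note pe = cs_atom_proj[OF e] and pf = cs_atom_proj[OF f] and pg = cs_atom_proj[OF g]
  obtain h where h: "cs_atom h" "f * h = 0" "(f + h) * e = e" using atom_cover[OF f e] ne by blast
  obtain k where k: "cs_atom k" "f * k = 0" "\<And>r. cs_proj r \<Longrightarrow> cs_le f r \<Longrightarrow> cs_le g r \<Longrightarrow> cs_le k r"
    using atom_cover[OF f g] ne by blast
  note ph = cs_atom_proj[OF h(1)] and pk = cs_atom_proj[OF k(1)]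
  have s: "cs_proj (f + h)" by (rule cs_proj_add[OF pf ph h(2)])
  have "h * f = 0" using h(2) ph pf by (metis adj_mult adj_zero cs_proj_def)
  then have "(f + h) * f = f" by (simp add: distrib_right cs_proj_idem[OF pf])
  then have fs: "cs_le f (f + h)" using cs_proj_le_iff[OF pf s] by simp
  have es: "cs_le e (f + h)" using cs_proj_le_iff[OF pe s] h(3) by simp
  have "cs_le k (f + h)" by (rule k(3)[OF s fs le[OF s es fs]])
  then have "(f + h) * k = k" using cs_proj_le_iff[OF pk s] by simp
  then have "h * k = k" using k(2) by (simp add: distrib_right)
  then have "cs_le k h" using cs_proj_le_iff[OF pk ph] by simp
  then have "k = h" by (rule cs_atom_le_atom[OF k(1) h(1)])
  then have "cs_le h r" using k(3)[OF r] by simp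
  then have "r * h = h" "r * f = f" using r cs_proj_le_iff[OF ph r(1)] cs_proj_le_iff[OF pf r(1)] by simp_all
  then have "r * (f + h) = f + h" by (simp add: distrib_left)
  then have "r * e = e" using h(3) by (metis mult.assoc)
  then show ?thesis using cs_proj_le_iff[OF pe r(1)] by simp
qed

text \<open>If e and f are not orthogonal, the atom h of \<open>atom_cover\<close> already differs
  from both. If they are, a partial isometry v from e into f gives the range projection of e + v, a
  diagonal between them.\<close>

lemma third_atom:
  fixes e f :: "'a::cstar_algebra"
  assumes fac: "aw_factor TYPE('a)" and e: "cs_atom e" and f: "cs_atom f" and ne: "e \<noteq> f"
  shows "\<exists>g. cs_atom g \<and> g \<noteq> e \<and> g \<noteq> f \<and>
    (\<forall>r. cs_proj r \<and> cs_le e r \<and> cs_le f r \<longrightarrow> cs_le g r)"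
proof -
  note pe = cs_atom_proj[OF e] and pf = cs_atom_proj[OF f]
  obtain h where h: "cs_atom h" "e * h = 0" "\<And>r. cs_proj r \<Longrightarrow> cs_le e r \<Longrightarrow> cs_le f r \<Longrightarrow> cs_le h r"
    using atom_cover[OF e f ne] by blast
  show ?thesis
  proof (cases "h = f")
    case False
    moreover have "h \<noteq> e" using h(2) cs_proj_idem[OF pe] cs_atom_nonzero[OF e] by auto
    ultimately show ?thesis using h by blast
  next
    case True
    then have ef: "e * f = 0" using h by simp
    then have fe: "f * e = 0" using pe pf by (metis adj_mult adj_zero cs_proj_def)
    obtain v where v: "adj v * v = e" "v * e = v" "f * v = v"
      using atom_partial_isometry[OF fac e pf cs_atom_nonzero[OF f]] by blast
    have ev: "e * v = 0" using v(3) ef by (metis mult.assoc mult_zero_left)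
    then have ve: "adj v * e = 0" using pe by (metis adj_mult adj_zero cs_proj_def)
    have eav: "e * adj v = adj v" using v(2) pe by (metis adj_mult cs_proj_def)
    define w where "w = (1 / sqrt 2) *\<^sub>R (e + v)"
    have aw: "adj w = (1 / sqrt 2) *\<^sub>R (e + adj v)" using pe by (simp add: w_def adj_scaleR adj_add cs_proj_def)
    have "(e + adj v) * (e + v) = 2 *\<^sub>R e"
      by (simp add: distrib_left distrib_right ev ve v(1) cs_proj_idem[OF pe] scaleR_2)
    then have ww: "adj w * w = e" unfolding aw by (simp add: w_def)
    have we: "w * e = w" by (simp add: w_def distrib_right cs_proj_idem[OF pe] v(2))
    define g where "g = w * adj w"
    have g: "cs_atom g" unfolding g_def by (rule cs_atom_transfer[OF e we ww])
    have g2: "g = (1/2) *\<^sub>R (e + v + adj v + v * adj v)"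
      unfolding g_def aw by (simp add: w_def distrib_left distrib_right v(2) eav cs_proj_idem[OF pe] algebra_simps)
    have "g * e = (1/2) *\<^sub>R (e + v)"
      by (simp add: g2 distrib_right cs_proj_idem[OF pe] v(2) ve mult.assoc)
    then have ge: "2 *\<^sub>R (g * e) = e + v" by simp
    have "g \<noteq> f"
    proof
      assume "g = f"
      then have "e + v = 0" using ge fe by simp
      then have "e * (e + v) = 0" by simp
      then show False using ev cs_proj_idem[OF pe] cs_atom_nonzero[OF e] by (simp add: distrib_left)
    qed
    moreover have "g \<noteq> e"
    proof
      assume "g = e"
      then have "e = v" using ge cs_proj_idem[OF pe] by (simp add: scaleR_2)
      then show False using ev cs_proj_idem[OF pe] cs_atom_nonzero[OF e] by simp
    qed
    moreover have "cs_le g r" if r: "cs_proj r" "cs_le e r" "cs_le f r" for r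
    proof -
      have re: "r * e = e" "r * f = f" using r cs_proj_le_iff[OF pe r(1)] cs_proj_le_iff[OF pf r(1)] by simp_all
      have "r * v = v" using re(2) v(3) by (metis mult.assoc)
      then have "r * w = w" using re by (simp add: w_def distrib_left)
      then show ?thesis using cs_proj_le_iff[OF cs_atom_proj[OF g] r(1)] by (simp add: g_def flip: mult.assoc)
    qed
    ultimately show ?thesis using g by blast
  qed
qed

section \<open>The spectral order on the positive cone\<close>

lemma spectral_le_trans: "spectral_le x y \<Longrightarrow> spectral_le y z \<Longrightarrow> spectral_le x z"
  unfolding spectral_le_def using cs_le_trans by blast

lemma spectral_le_antisym:
  fixes x y :: "'a::cstar_algebra"
  assumes aw: "aw_star TYPE('a)" and "cs_pos x" "cs_pos y" "spectral_le x y" "spectral_le y x"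
  shows "x = y"
  by (rule spectral_family_inj[OF aw]) (use assms in \<open>auto simp: cs_pos_sa spectral_le_def intro!: ext cs_le_antisym\<close>)

lemma cs_pos_scaleR_proj: "cs_proj p \<Longrightarrow> 0 \<le> a \<Longrightarrow> cs_pos (a *\<^sub>R p)"
  by (simp add: cs_pos_scaleR cs_proj_pos)

definition down_chain :: "'a::cstar_algebra \<Rightarrow> bool" where
  "down_chain x \<longleftrightarrow> (\<forall>u v. cs_pos u \<and> cs_pos v \<and> spectral_le u x \<and> spectral_le v x \<longrightarrow>
     spectral_le u v \<or> spectral_le v u)"

context
  fixes T :: "'a::cstar_algebra itself"
  assumes fac: "aw_factor TYPE('a)" and I: "aw_typeI TYPE('a)"
begin

private lemma aw: "aw_star TYPE('a)" using fac by (rule aw_factor_aw)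

lemma spectral_family_proj: "cs_pos (x::'a) \<Longrightarrow> cs_proj (spectral_family x l)"
  using is_spectral_familyD(1)[OF is_spectral_family_spectral_family[OF aw]] cs_pos_sa by blast

lemma spectral_family_mono: "cs_pos (x::'a) \<Longrightarrow> l \<le> m \<Longrightarrow> cs_le (spectral_family x l) (spectral_family x m)"
  using is_spectral_familyD(2)[OF is_spectral_family_spectral_family[OF aw]] cs_pos_sa by blast

lemma spectral_family_scaleR_proj:
  "cs_proj (p::'a) \<Longrightarrow> 0 \<le> a \<Longrightarrow> spectral_family (a *\<^sub>R p) = two_step a 0 p p"
  using spectral_family_two_step[OF aw, of p p a 0] by (simp add: cs_le_refl cs_proj_sa)

text \<open>The family of \<open>a p\<close> is 0 below 0, 1 - p up to a and 1 from there on; only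
  the middle range constrains x. Comparison with a point thus becomes orthogonality to spectral
  projections.\<close>

lemma scaleR_proj_le_iff:
  assumes x: "cs_pos (x::'a)" and p: "cs_proj p" and a: "0 \<le> a"
  shows "spectral_le (a *\<^sub>R p) x \<longleftrightarrow> (\<forall>l. 0 \<le> l \<and> l < a \<longrightarrow> cs_le p (1 - spectral_family x l))"
proof -
  have "cs_le (spectral_family x l) (two_step a 0 p p l) \<longleftrightarrow>
      (0 \<le> l \<and> l < a \<longrightarrow> cs_le p (1 - spectral_family x l))" for l
    using spectral_family_neg[OF aw x, of l] cs_proj_le_1[OF spectral_family_proj[OF x]]
      cs_proj_le_compl_swap[OF p spectral_family_proj[OF x]]
    by (auto simp: two_step_def cs_le_refl cs_sa_zero)
  then show ?thesis unfolding spectral_le_def spectral_family_scaleR_proj[OF p a] by blast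
qed

lemma atom_not_le_0: "cs_atom (e::'a) \<Longrightarrow> \<not> cs_le e 0"
  using cs_proj_le_iff'[OF cs_atom_proj cs_proj_0, of e] cs_atom_nonzero by fastforce

lemma point_le_scaleR_proj_iff:
  assumes e: "cs_atom (e::'a)" and p: "cs_proj p" and a: "0 < a" and b: "0 \<le> b"
  shows "spectral_le (a *\<^sub>R e) (b *\<^sub>R p) \<longleftrightarrow> a \<le> b \<and> cs_le e p"
proof -
  have "spectral_le (a *\<^sub>R e) (b *\<^sub>R p) \<longleftrightarrow>
      (\<forall>l. 0 \<le> l \<and> l < a \<longrightarrow> cs_le e (if l < b then p else 0))"
    unfolding scaleR_proj_le_iff[OF cs_pos_scaleR_proj[OF p b] cs_atom_proj[OF e] less_imp_le[OF a]]
      spectral_family_scaleR_proj[OF p b] by (simp add: two_step_def cong: imp_cong)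
  also have "\<dots> \<longleftrightarrow> a \<le> b \<and> cs_le e p"
  proof
    assume *: "\<forall>l. 0 \<le> l \<and> l < a \<longrightarrow> cs_le e (if l < b then p else 0)"
    \<comment> \<open>If b < a, the level l = b would put e below 0.\<close>
    have "a \<le> b" using *[rule_format, of b] b atom_not_le_0[OF e] by fastforce
    moreover from this have "cs_le e p" using *[rule_format, of 0] a by simp
    ultimately show "a \<le> b \<and> cs_le e p" ..
  qed auto
  finally show ?thesis .
qed

lemma point_le_point_iff:
  assumes "cs_atom (e::'a)" "cs_atom f" "0 < a" "0 \<le> b"
  shows "spectral_le (a *\<^sub>R e) (b *\<^sub>R f) \<longleftrightarrow> a \<le> b \<and> e = f"
  using point_le_scaleR_proj_iff[OF assms(1) cs_atom_proj[OF assms(2)] assms(3,4)]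
    cs_atom_le_atom[OF assms(1,2)] cs_le_refl[OF cs_proj_sa[OF cs_atom_proj[OF assms(2)]]] by auto

text \<open>With E the family of x, an atom e below 1 - E m gives the point \<open>m e\<close> below
  x, so atomicity yields r below E m for every m > l, and right-continuity reaches l. Hence the
  strict \<open>l < a\<close>.\<close>

lemma le_spectral_family_iff:
  assumes x: "cs_pos (x::'a)" and r: "cs_proj r" and l: "0 \<le> l"
  shows "cs_le r (spectral_family x l) \<longleftrightarrow>
    (\<forall>a e. l < a \<and> cs_atom e \<and> spectral_le (a *\<^sub>R e) x \<longrightarrow> cs_le e (1 - r))"
proof (intro iffI allI impI)
  fix a e assume le: "cs_le r (spectral_family x l)" and a: "l < a \<and> cs_atom e \<and> spectral_le (a *\<^sub>R e) x"
  then have "cs_le e (1 - spectral_family x l)" using scaleR_proj_le_iff[OF x cs_atom_proj, of e a] l by auto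
  moreover have "cs_le (1 - spectral_family x l) (1 - r)" using le cs_proj_le_compl_iff[OF spectral_family_proj[OF x] r] by simp
  ultimately show "cs_le e (1 - r)" by (rule cs_le_trans)
next
  assume *: "\<forall>a e. l < a \<and> cs_atom e \<and> spectral_le (a *\<^sub>R e) x \<longrightarrow> cs_le e (1 - r)"
  have "cs_le r (spectral_family x m)" if m: "m > l" for m
  proof -
    have "cs_le (1 - spectral_family x m) (1 - r)"
    proof (rule atomistic[OF fac I cs_proj_compl[OF spectral_family_proj[OF x]] cs_proj_compl[OF r]])
      fix e assume e: "cs_atom e" "cs_le e (1 - spectral_family x m)"
      have "cs_le e (1 - spectral_family x k)" if "k < m" for k
        using e(2) spectral_family_mono[OF x, of k m] that cs_proj_le_compl_iff[OF spectral_family_proj[OF x] spectral_family_proj[OF x]] cs_le_trans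
        by (metis less_imp_le)
      then have "spectral_le (m *\<^sub>R e) x" using scaleR_proj_le_iff[OF x cs_atom_proj[OF e(1)], of m] m l by auto
      then show "cs_le e (1 - r)" using * m e(1) by blast
    qed
    then show ?thesis using cs_proj_le_compl_iff[OF spectral_family_proj[OF x] r] by simp
  qed
  then show "cs_le r (spectral_family x l)"
    using is_spectral_familyD(6)[OF is_spectral_family_spectral_family[OF aw cs_pos_sa[OF x]] cs_pos_sa[OF x] r] by blast
qed

lemma spectral_leI_points:
  assumes x: "cs_pos (x::'a)" and y: "cs_pos y"
    and le: "\<And>a e. 0 < a \<Longrightarrow> cs_atom e \<Longrightarrow> spectral_le (a *\<^sub>R e) x \<Longrightarrow> spectral_le (a *\<^sub>R e) y"
  shows "spectral_le x y"
  unfolding spectral_le_def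
proof
  fix l
  show "cs_le (spectral_family y l) (spectral_family x l)"
  proof (cases "l < 0")
    case True
    then show ?thesis using spectral_family_neg[OF aw] x y by (simp add: cs_le_refl cs_sa_zero)
  next
    case False
    then have l: "0 \<le> l" by simp
    show ?thesis unfolding le_spectral_family_iff[OF x spectral_family_proj[OF y] l]
    proof (intro allI impI)
      fix a e assume a: "l < a \<and> cs_atom e \<and> spectral_le (a *\<^sub>R e) x"
      then have "spectral_le (a *\<^sub>R e) y" using le l by auto
      then show "cs_le e (1 - spectral_family y l)"
        using scaleR_proj_le_iff[OF y cs_atom_proj, of e a] a l by auto
    qed
  qed
qed

text \<open>Serves to show that the supremum of the coefficients of e below x is attained. Only
  levels l < a matter, and the midpoint of l and a is already above l.\<close>

lemma point_le_closed:
  assumes x: "cs_pos (x::'a)" and e: "cs_atom e" and a: "0 < a"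
    and le: "\<And>c. 0 < c \<Longrightarrow> c < a \<Longrightarrow> spectral_le (c *\<^sub>R e) x"
  shows "spectral_le (a *\<^sub>R e) x"
  unfolding scaleR_proj_le_iff[OF x cs_atom_proj[OF e] less_imp_le[OF a]]
proof (intro allI impI)
  fix l assume l: "0 \<le> l \<and> l < a"
  then have "spectral_le (((l + a) / 2) *\<^sub>R e) x" using a by (intro le) auto
  then show "cs_le e (1 - spectral_family x l)"
    using scaleR_proj_le_iff[OF x cs_atom_proj[OF e], of "(l + a) / 2"] l a by auto
qed

lemma point_le_bounded:
  assumes x: "cs_pos (x::'a)" and e: "cs_atom e"
  shows "\<exists>b>0. \<forall>a. spectral_le (a *\<^sub>R e) x \<and> 0 < a \<longrightarrow> a \<le> b"
proof -
  obtain \<alpha> where \<alpha>: "\<alpha> > 0" "\<And>l. l > \<alpha> \<Longrightarrow> spectral_family x l = 1"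
    using is_spectral_family_spectral_family[OF aw cs_pos_sa[OF x]] unfolding is_spectral_family_def by blast
  have "a \<le> \<alpha> + 1" if "spectral_le (a *\<^sub>R e) x" "0 < a" for a
  proof (rule ccontr)
    assume "\<not> a \<le> \<alpha> + 1"
    then have "cs_le e (1 - spectral_family x (\<alpha> + 1))"
      using that scaleR_proj_le_iff[OF x cs_atom_proj[OF e], of a] \<alpha>(1) by auto
    then show False using \<alpha>(2)[of "\<alpha> + 1"] atom_not_le_0[OF e] by simp
  qed
  then show ?thesis using \<alpha>(1) by (intro exI[of _ "\<alpha> + 1"]) auto
qed

lemma zero_spectral_le: "cs_pos (x::'a) \<Longrightarrow> spectral_le 0 x"
proof (rule spectral_leI_points)
  fix a and e :: 'a assume "0 < a" "cs_atom e" "spectral_le (a *\<^sub>R e) 0"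
  then have False using point_le_scaleR_proj_iff[of e 0 a 0] by simp
  then show "spectral_le (a *\<^sub>R e) x" ..
qed simp_all

text \<open>Points below u and v are multiples of e; a point \<open>c e\<close> below v but not
  below u has a coefficient exceeding all those below u.\<close>

lemma down_chain_point:
  assumes e: "cs_atom (e::'a)" and a: "0 < a" shows "down_chain (a *\<^sub>R e)"
  unfolding down_chain_def
proof (intro allI impI)
  fix u v assume uv: "cs_pos u \<and> cs_pos v \<and> spectral_le u (a *\<^sub>R e) \<and> spectral_le v (a *\<^sub>R e)"
  have below: "f = e" if "cs_atom f" "0 < c" "spectral_le (c *\<^sub>R f) w" "spectral_le w (a *\<^sub>R e)" for c f w
    using that spectral_le_trans[OF that(3,4)] point_le_point_iff[OF that(1) e that(2), of a] a by simp
  show "spectral_le u v \<or> spectral_le v u"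
  proof (rule disjCI)
    assume nvu: "\<not> spectral_le v u"
    then obtain c f where c: "0 < c" "cs_atom f" "spectral_le (c *\<^sub>R f) v" "\<not> spectral_le (c *\<^sub>R f) u"
      using spectral_leI_points[of v u] uv by blast
    then have fe: "f = e" using below uv by blast
    show "spectral_le u v"
    proof (rule spectral_leI_points)
      fix d g assume d: "0 < d" "cs_atom g" "spectral_le (d *\<^sub>R g) u"
      then have ge: "g = e" using below uv by blast
      have "d \<le> c"
      proof (rule ccontr)
        assume "\<not> d \<le> c"
        then have "spectral_le (c *\<^sub>R e) (d *\<^sub>R e)" using point_le_point_iff[OF e e c(1), of d] d(1) by simp
        then show False using d(3) c(4) fe ge spectral_le_trans by blast
      qed
      then have "spectral_le (d *\<^sub>R e) (c *\<^sub>R e)" using point_le_point_iff[OF e e d(1), of c] c(1) by simp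
      then show "spectral_le (d *\<^sub>R g) v" using c(3) fe ge spectral_le_trans by blast
    qed (use uv in auto)
  qed
qed

text \<open>Two points below x are comparable and therefore share their atom. The supremum b of the
  coefficients is finite and attained, so x and \<open>b e\<close> have the same points below
  them.\<close>

lemma down_chain_imp_point:
  assumes x: "cs_pos (x::'a)" and ch: "down_chain x" and x0: "x \<noteq> 0"
  shows "\<exists>a e. 0 < a \<and> cs_atom e \<and> x = a *\<^sub>R e"
proof -
  have "\<not> spectral_le x 0" using spectral_le_antisym[OF aw x cs_pos_0 _ zero_spectral_le[OF x]] x0 by blast
  then obtain a e where a: "0 < a" "cs_atom e" "spectral_le (a *\<^sub>R e) x"
    using spectral_leI_points[OF x cs_pos_0] by blast
  have pos: "cs_pos (c *\<^sub>R f)" if "0 < c" "cs_atom f" for c and f :: 'a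
    using that by (intro cs_pos_scaleR_proj cs_atom_proj) auto
  have uniq: "f = e" if "0 < c" "cs_atom f" "spectral_le (c *\<^sub>R f) x" for c f
  proof -
    have "spectral_le (c *\<^sub>R f) (a *\<^sub>R e) \<or> spectral_le (a *\<^sub>R e) (c *\<^sub>R f)"
      using ch that a pos unfolding down_chain_def by blast
    then show ?thesis using point_le_point_iff[OF that(2) a(2) that(1), of a]
        point_le_point_iff[OF a(2) that(2) a(1), of c] a(1) that(1) by auto
  qed
  define S where "S = {c. 0 < c \<and> spectral_le (c *\<^sub>R e) x}"
  obtain B where "\<And>c. c \<in> S \<Longrightarrow> c \<le> B" using point_le_bounded[OF x a(2)] by (auto simp: S_def)
  then have bdd: "bdd_above S" by (auto simp: bdd_above_def)
  have aS: "a \<in> S" using a by (simp add: S_def)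
  define b where "b = Sup S"
  have b: "0 < b" using cSup_upper[OF aS bdd] a(1) by (simp add: b_def)
  have "spectral_le (b *\<^sub>R e) x"
  proof (rule point_le_closed[OF x a(2) b])
    fix c assume c: "0 < c" "c < b"
    then obtain d where d: "d \<in> S" "c < d" using less_cSup_iff[OF _ bdd, of c] aS by (auto simp: b_def)
    then have "spectral_le (c *\<^sub>R e) (d *\<^sub>R e)" using point_le_point_iff[OF a(2) a(2) c(1), of d] c by simp
    then show "spectral_le (c *\<^sub>R e) x" using d spectral_le_trans by (auto simp: S_def)
  qed
  moreover have "spectral_le x (b *\<^sub>R e)"
  proof (rule spectral_leI_points[OF x pos[OF b a(2)]])
    fix c f assume c: "0 < c" "cs_atom f" "spectral_le (c *\<^sub>R f) x"
    then have fe: "f = e" by (rule uniq)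
    then have "c \<le> b" using c cSup_upper[OF _ bdd, of c] by (simp add: b_def S_def)
    then show "spectral_le (c *\<^sub>R f) (b *\<^sub>R e)" using point_le_point_iff[OF c(2) a(2) c(1), of b] b fe by simp
  qed
  ultimately have "x = b *\<^sub>R e" using spectral_le_antisym[OF aw x pos[OF b a(2)]] by blast
  then show ?thesis using a(2) b by blast
qed

text \<open>The witness y takes the value t on f and s on its complement, so above level s it sees
  only f, and every other atom is capped at s.\<close>

lemma two_step_upper:
  assumes f: "cs_atom (f::'a)" and e: "cs_atom e" and s: "0 < s" "s \<le> t"
  shows "\<exists>y. cs_pos y \<and> spectral_le (s *\<^sub>R e) y \<and> spectral_le (t *\<^sub>R f) y \<and>
    (\<forall>a g. 0 < a \<and> cs_atom g \<and> g \<noteq> f \<and> spectral_le (a *\<^sub>R g) y \<longrightarrow> a \<le> s)"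
proof -
  note pe = cs_atom_proj[OF e] and pf = cs_atom_proj[OF f]
  define y where "y = s *\<^sub>R 1 + (t - s) *\<^sub>R f"
  have y: "cs_pos y" unfolding y_def using s pf by (intro cs_pos_add cs_pos_scaleR_proj) auto
  have "spectral_family y = two_step s (t - s) f 1"
    unfolding y_def using s pf by (intro spectral_family_two_step[OF aw]) (auto simp: cs_proj_le_1)
  then have sf: "1 - spectral_family y l = (if l < s then 1 else if l < t then f else 0)" if "0 \<le> l" for l
    using that by (simp add: two_step_def)
  have "spectral_le (s *\<^sub>R e) y" "spectral_le (t *\<^sub>R f) y"
    using s by (auto simp: scaleR_proj_le_iff[OF y pe] scaleR_proj_le_iff[OF y pf] sf cs_proj_le_1 pe pf cs_le_refl cs_proj_sa)
  moreover have "a \<le> s" if "0 < a" "cs_atom g" "g \<noteq> f" "spectral_le (a *\<^sub>R g) y" for a g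
  proof (rule ccontr)
    assume "\<not> a \<le> s"
    then have "cs_le g (1 - spectral_family y s)"
      using that s scaleR_proj_le_iff[OF y cs_atom_proj[OF that(2)], of a] by auto
    then have "cs_le g f \<or> cs_le g 0" using s by (auto simp: sf split: if_splits)
    then show False using cs_atom_le_atom[OF that(2) f] that(3) atom_not_le_0[OF that(2)] by blast
  qed
  ultimately show ?thesis using y by blast
qed

end

section \<open>Spectral order isomorphisms of the positive cones\<close>

lemma spectral_order_iso_inv:
  assumes "spectral_order_iso \<phi> A B" shows "spectral_order_iso (inv_into A \<phi>) B A"
proof -
  have b: "bij_betw \<phi> A B" and o: "\<And>x y. x \<in> A \<Longrightarrow> y \<in> A \<Longrightarrow> spectral_le x y \<longleftrightarrow> spectral_le (\<phi> x) (\<phi> y)"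
    using assms by (auto simp: spectral_order_iso_def)
  have "spectral_le u v \<longleftrightarrow> spectral_le (inv_into A \<phi> u) (inv_into A \<phi> v)" if "u \<in> B" "v \<in> B" for u v
    using o[of "inv_into A \<phi> u" "inv_into A \<phi> v"] that b bij_betw_inv_into_right[OF b]
      bij_betwE[OF bij_betw_inv_into[OF b]] by simp
  then show ?thesis using bij_betw_inv_into[OF b] by (simp add: spectral_order_iso_def)
qed

context
  fixes \<phi> :: "'a::cstar_algebra \<Rightarrow> 'b::cstar_algebra"
  assumes iso: "spectral_order_iso \<phi> {x. cs_pos x} {y. cs_pos y}"
begin

lemma iso_pos: "cs_pos x \<Longrightarrow> cs_pos (\<phi> x)"
  using iso bij_betwE unfolding spectral_order_iso_def by blast

lemma iso_le: "cs_pos x \<Longrightarrow> cs_pos y \<Longrightarrow> spectral_le (\<phi> x) (\<phi> y) \<longleftrightarrow> spectral_le x y"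
  using iso unfolding spectral_order_iso_def by blast

lemma iso_inj: "cs_pos x \<Longrightarrow> cs_pos y \<Longrightarrow> \<phi> x = \<phi> y \<Longrightarrow> x = y"
  using iso unfolding spectral_order_iso_def bij_betw_def inj_on_def by blast

lemma iso_surj: "cs_pos y \<Longrightarrow> \<exists>x. cs_pos x \<and> \<phi> x = y"
  using iso unfolding spectral_order_iso_def bij_betw_def by (metis (no_types, lifting) imageE mem_Collect_eq)

end

context
  fixes \<phi> :: "'a::cstar_algebra \<Rightarrow> 'b::cstar_algebra"
  assumes facA: "aw_factor TYPE('a)" and IA: "aw_typeI TYPE('a)"
    and facB: "aw_factor TYPE('b)" and IB: "aw_typeI TYPE('b)"
    and iso: "spectral_order_iso \<phi> {x. cs_pos x} {y. cs_pos y}"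
begin

lemma iso_0: "\<phi> 0 = 0"
proof -
  obtain x where x: "cs_pos x" "\<phi> x = 0" using iso_surj[OF iso] cs_pos_0 by blast
  have "spectral_le (\<phi> 0) (\<phi> x)" using iso_le[OF iso cs_pos_0 x(1)] zero_spectral_le[OF facA IA x(1)] by simp
  then show ?thesis
    using spectral_le_antisym[OF aw_factor_aw[OF facB] iso_pos[OF iso cs_pos_0] cs_pos_0]
      zero_spectral_le[OF facB IB iso_pos[OF iso cs_pos_0]] x(2) by simp
qed

lemma iso_point:
  assumes a: "0 < a" and e: "cs_atom e"
  shows "\<exists>b f. 0 < b \<and> cs_atom f \<and> \<phi> (a *\<^sub>R e) = b *\<^sub>R f"
proof (rule down_chain_imp_point[OF facB IB])
  have p: "cs_pos (a *\<^sub>R e)" using a e by (intro cs_pos_scaleR_proj cs_atom_proj) auto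
  show "cs_pos (\<phi> (a *\<^sub>R e))" by (rule iso_pos[OF iso p])
  show "\<phi> (a *\<^sub>R e) \<noteq> 0"
    using iso_inj[OF iso p cs_pos_0] iso_0 a cs_atom_nonzero[OF e] by auto
  show "down_chain (\<phi> (a *\<^sub>R e))" unfolding down_chain_def
  proof (intro allI impI)
    fix u v assume uv: "cs_pos u \<and> cs_pos v \<and> spectral_le u (\<phi> (a *\<^sub>R e)) \<and> spectral_le v (\<phi> (a *\<^sub>R e))"
    then obtain x y where "cs_pos x" "\<phi> x = u" "cs_pos y" "\<phi> y = v" using iso_surj[OF iso] by blast
    then show "spectral_le u v \<or> spectral_le v u"
      using uv iso_le[OF iso] p down_chain_point[OF facA IA e a] unfolding down_chain_def by blast
  qed
qed

end

section \<open>Scales and the action on atoms\<close>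

context
  fixes \<phi> :: "'a::cstar_algebra \<Rightarrow> 'b::cstar_algebra"
  assumes facA: "aw_factor TYPE('a)" and IA: "aw_typeI TYPE('a)"
    and facB: "aw_factor TYPE('b)" and IB: "aw_typeI TYPE('b)"
    and iso: "spectral_order_iso \<phi> {x. cs_pos x} {y. cs_pos y}"
begin

private lemmas pos = iso_pos[OF iso]
private lemmas le = iso_le[OF iso]

lemma iso_point_surj:
  assumes b: "0 < b" and f: "cs_atom f"
  shows "\<exists>a e. 0 < a \<and> cs_atom e \<and> \<phi> (a *\<^sub>R e) = b *\<^sub>R f"
proof -
  have "cs_pos (b *\<^sub>R f)" using b f by (intro cs_pos_scaleR_proj cs_atom_proj) auto
  then have "b *\<^sub>R f \<in> {y. cs_pos y}" by simp
  moreover have "bij_betw \<phi> {x. cs_pos x} {y. cs_pos y}" using iso by (simp add: spectral_order_iso_def)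
  ultimately have "\<phi> (inv_into {x. cs_pos x} \<phi> (b *\<^sub>R f)) = b *\<^sub>R f" by (rule bij_betw_inv_into_right[rotated])
  moreover obtain a e where "0 < a" "cs_atom e" "inv_into {x. cs_pos x} \<phi> (b *\<^sub>R f) = a *\<^sub>R e"
    using iso_point[OF facB IB facA IA spectral_order_iso_inv[OF iso] b f] by blast
  ultimately show ?thesis by metis
qed

text \<open>A priori the target atom \<open>t a e\<close> depends on a. All multiples of e are
  comparable, hence so are their images, and comparable points share their atom.\<close>

lemma iso_points:
  "\<exists>\<beta> \<tau>. (\<forall>e. cs_atom e \<longrightarrow> cs_atom (\<tau> e)) \<and> bij_betw \<tau> {e. cs_atom e} {f. cs_atom f} \<and>
     (\<forall>a e. 0 < a \<and> cs_atom e \<longrightarrow> 0 < \<beta> a e \<and> \<phi> (a *\<^sub>R e) = \<beta> a e *\<^sub>R \<tau> e) \<and>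
     (\<forall>a b e. 0 < a \<and> 0 < b \<and> cs_atom e \<longrightarrow> (\<beta> a e \<le> \<beta> b e \<longleftrightarrow> a \<le> b)) \<and>
     (\<forall>b e. 0 < b \<and> cs_atom e \<longrightarrow> (\<exists>a>0. \<beta> a e = b))"
proof -
  have "\<forall>a e. \<exists>b f. 0 < a \<and> cs_atom e \<longrightarrow> 0 < b \<and> cs_atom f \<and> \<phi> (a *\<^sub>R e) = b *\<^sub>R f"
    using iso_point[OF facA IA facB IB iso] by blast
  then obtain \<beta> t where bt: "\<And>a e. 0 < a \<Longrightarrow> cs_atom e \<Longrightarrow> 0 < \<beta> a e"
    "\<And>a e. 0 < a \<Longrightarrow> cs_atom e \<Longrightarrow> cs_atom (t a e)"
    "\<And>a e. 0 < a \<Longrightarrow> cs_atom e \<Longrightarrow> \<phi> (a *\<^sub>R e) = \<beta> a e *\<^sub>R t a e" by metis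
  have key: "a \<le> b \<and> e = f \<longleftrightarrow> \<beta> a e \<le> \<beta> b f \<and> t a e = t b f"
    if "0 < a" "0 < b" "cs_atom e" "cs_atom f" for a b e f
  proof -
    have "cs_pos (a *\<^sub>R e)" "cs_pos (b *\<^sub>R f)" using that by (auto intro!: cs_pos_scaleR_proj cs_atom_proj)
    then have "spectral_le (\<phi> (a *\<^sub>R e)) (\<phi> (b *\<^sub>R f)) \<longleftrightarrow> spectral_le (a *\<^sub>R e) (b *\<^sub>R f)" by (rule le)
    moreover have "spectral_le (a *\<^sub>R e) (b *\<^sub>R f) \<longleftrightarrow> a \<le> b \<and> e = f"
      using that by (intro point_le_point_iff[OF facA IA]) auto
    moreover have "spectral_le (\<beta> a e *\<^sub>R t a e) (\<beta> b f *\<^sub>R t b f) \<longleftrightarrow> \<beta> a e \<le> \<beta> b f \<and> t a e = t b f"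
      using that bt by (intro point_le_point_iff[OF facB IB]) (auto simp: less_imp_le)
    ultimately show ?thesis using bt(3) that by simp
  qed
  define \<tau> where "\<tau> = t 1"
  have t: "t a e = \<tau> e" if "0 < a" "cs_atom e" for a e
    using key[of a 1 e e] key[of 1 a e e] that unfolding \<tau>_def by (cases "a \<le> 1") auto
  have inj: "e = f" if "cs_atom e" "cs_atom f" "\<tau> e = \<tau> f" for e f
    using key[of 1 1 e f] key[of 1 1 f e] that unfolding \<tau>_def by (cases "\<beta> 1 e \<le> \<beta> 1 f") auto
  have onto: "\<exists>a e. 0 < a \<and> cs_atom e \<and> \<beta> a e = b \<and> \<tau> e = f" if f: "0 < b" "cs_atom f" for b f
  proof -
    obtain a e where a: "0 < a" "cs_atom e" "\<phi> (a *\<^sub>R e) = b *\<^sub>R f" using iso_point_surj[OF f] by blast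
    then have eq: "\<beta> a e *\<^sub>R \<tau> e = b *\<^sub>R f" using bt(3) t by simp
    have at: "cs_atom (\<tau> e)" using bt(2)[of 1 e] a(2) by (simp add: \<tau>_def)
    have "spectral_le (b *\<^sub>R f) (\<beta> a e *\<^sub>R \<tau> e)" "spectral_le (\<beta> a e *\<^sub>R \<tau> e) (b *\<^sub>R f)"
      using point_le_point_iff[OF facB IB f(2) f(2) f(1), of b] f(1) unfolding eq by simp_all
    then have "b \<le> \<beta> a e" "\<beta> a e \<le> b" "\<tau> e = f"
      using point_le_point_iff[OF facB IB f(2) at f(1), of "\<beta> a e"]
        point_le_point_iff[OF facB IB at f(2) bt(1)[OF a(1,2)], of b] bt(1)[OF a(1,2)] f(1) by auto
    then show ?thesis using a by (intro exI[of _ a] exI[of _ e]) auto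
  qed
  show ?thesis
  proof (intro exI[of _ \<beta>] exI[of _ \<tau>] conjI allI impI)
    show at: "cs_atom (\<tau> e)" if "cs_atom e" for e using bt(2)[of 1 e] that by (simp add: \<tau>_def)
    show "bij_betw \<tau> {e. cs_atom e} {f. cs_atom f}"
    proof (rule bij_betw_imageI)
      show "inj_on \<tau> {e. cs_atom e}" using inj by (blast intro: inj_onI)
      show "\<tau> ` {e. cs_atom e} = {f. cs_atom f}" using at onto[OF zero_less_one] by blast
    qed
    show "0 < \<beta> a e" "\<phi> (a *\<^sub>R e) = \<beta> a e *\<^sub>R \<tau> e" if "0 < a \<and> cs_atom e" for a e
      using that bt t by auto
    show "\<beta> a e \<le> \<beta> b e \<longleftrightarrow> a \<le> b" if "0 < a \<and> 0 < b \<and> cs_atom e" for a b e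
      using that key[of a b e e] t by auto
    show "\<exists>a>0. \<beta> a e = b" if be: "0 < b \<and> cs_atom e" for b e
    proof -
      obtain a f where "0 < a" "cs_atom f" "\<beta> a f = b" "\<tau> f = \<tau> e" using onto at be by meson
      then show ?thesis using inj[of f e] be by auto
    qed
  qed
qed

text \<open>The scale \<open>\<beta> a e\<close> is independent of the atom: a third atom \<open>g\<close> below the join of \<open>e\<close> and \<open>f\<close>
  satisfies \<open>a g \<preceq> y\<close> whenever \<open>a e, a f \<preceq> y\<close>, and the two-step upper bounds \<open>y\<close> of the images
  force \<open>\<beta> a g \<le> min (\<beta> a e) (\<beta> a f)\<close>; the exchange property makes this symmetric.\<close>
lemma scale_independent:
  assumes at: "\<And>e. cs_atom e \<Longrightarrow> cs_atom (\<tau> e)" and inj: "inj_on \<tau> {e. cs_atom e}"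
    and b: "\<And>a e. 0 < a \<Longrightarrow> cs_atom e \<Longrightarrow> 0 < \<beta> a e"
      "\<And>a e. 0 < a \<Longrightarrow> cs_atom e \<Longrightarrow> \<phi> (a *\<^sub>R e) = \<beta> a e *\<^sub>R \<tau> e"
    and a: "0 < a" and e: "cs_atom e" and f: "cs_atom f"
  shows "\<beta> a e = \<beta> a f"
proof (cases "e = f")
  case ne: False
  have pp: "cs_pos (a *\<^sub>R e)" if "cs_atom e" for e :: 'a
    using that a by (intro cs_pos_scaleR_proj cs_atom_proj) auto
  have step: "\<beta> a g \<le> \<beta> a e"
    if at3: "cs_atom e" "cs_atom f" "cs_atom g" "g \<noteq> f" and le': "\<beta> a e \<le> \<beta> a f"
      and lub: "\<And>r. cs_proj r \<Longrightarrow> cs_le e r \<Longrightarrow> cs_le f r \<Longrightarrow> cs_le g r" for e f g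
  proof -
    obtain y where y: "cs_pos y" "spectral_le (\<beta> a e *\<^sub>R \<tau> e) y" "spectral_le (\<beta> a f *\<^sub>R \<tau> f) y"
      "\<And>c h. 0 < c \<Longrightarrow> cs_atom h \<Longrightarrow> h \<noteq> \<tau> f \<Longrightarrow> spectral_le (c *\<^sub>R h) y \<Longrightarrow> c \<le> \<beta> a e"
      using two_step_upper[OF facB IB at[OF at3(2)] at[OF at3(1)] b(1)[OF a at3(1)] le'] by blast
    obtain z where z: "cs_pos z" "\<phi> z = y" using iso_surj[OF iso y(1)] by blast
    have "spectral_le (a *\<^sub>R e) z" "spectral_le (a *\<^sub>R f) z"
      using y(2,3) b(2)[OF a] at3 z le[OF pp z(1)] by metis+
    then have "spectral_le (a *\<^sub>R g) z"
      using lub cs_proj_compl[OF spectral_family_proj[OF facA IA z(1)]]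
        scaleR_proj_le_iff[OF facA IA z(1) cs_atom_proj less_imp_le[OF a]] at3 by blast
    then have "spectral_le (\<beta> a g *\<^sub>R \<tau> g) y" using b(2)[OF a at3(3)] z le[OF pp z(1)] at3(3) by metis
    moreover have "\<tau> g \<noteq> \<tau> f" using inj at3 by (auto simp: inj_on_def)
    ultimately show ?thesis using y(4) b(1)[OF a at3(3)] at[OF at3(3)] by blast
  qed
  have both: "\<beta> a g \<le> \<beta> a e \<and> \<beta> a g \<le> \<beta> a f"
    if "cs_atom e" "cs_atom f" "cs_atom g" "g \<noteq> f" "g \<noteq> e"
      "\<And>r. cs_proj r \<Longrightarrow> cs_le e r \<Longrightarrow> cs_le f r \<Longrightarrow> cs_le g r" for e f g
    using step[of e f g] step[of f e g] that by (cases "\<beta> a e \<le> \<beta> a f") auto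
  obtain g where g: "cs_atom g" "g \<noteq> e" "g \<noteq> f" and
    lub: "\<And>r. cs_proj r \<Longrightarrow> cs_le e r \<Longrightarrow> cs_le f r \<Longrightarrow> cs_le g r"
    using third_atom[OF facA e f ne] by blast
  have "\<beta> a e \<le> \<beta> a f"
    using both[OF f g(1) e] atom_exchange[OF e f g(1) ne g(3) lub] g ne by blast
  moreover have "\<beta> a f \<le> \<beta> a e"
    using both[OF e g(1) f] atom_exchange[OF f e g(1) ne[symmetric] g(2) lub] g ne by blast
  ultimately show ?thesis by simp
qed simp

lemma iso_points_uniform:
  "\<exists>f \<tau>. strict_mono f \<and> surj f \<and> f 0 = (0::real) \<and> bij_betw \<tau> {e. cs_atom e} {f. cs_atom f} \<and>
     (\<forall>a e. 0 < a \<and> cs_atom e \<longrightarrow> \<phi> (a *\<^sub>R e) = f a *\<^sub>R \<tau> e)"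
proof -
  obtain \<beta> \<tau> where b: "\<And>e. cs_atom e \<Longrightarrow> cs_atom (\<tau> e)" "bij_betw \<tau> {e. cs_atom e} {f. cs_atom f}"
     "\<And>a e. 0 < a \<Longrightarrow> cs_atom e \<Longrightarrow> 0 < \<beta> a e" "\<And>a e. 0 < a \<Longrightarrow> cs_atom e \<Longrightarrow> \<phi> (a *\<^sub>R e) = \<beta> a e *\<^sub>R \<tau> e"
     "\<And>a b e. 0 < a \<Longrightarrow> 0 < b \<Longrightarrow> cs_atom e \<Longrightarrow> \<beta> a e \<le> \<beta> b e \<longleftrightarrow> a \<le> b"
     "\<And>b e. 0 < b \<Longrightarrow> cs_atom e \<Longrightarrow> \<exists>a>0. \<beta> a e = b"
    using iso_points by blast
  obtain e0 :: 'a where e0: "cs_atom e0" using typeI_atom_exists[OF facA IA] by blast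
  \<comment> \<open>The identity on the negative half-line makes \<open>f\<close> a homeomorphism of the whole line.\<close>
  define f where "f t = (if t \<le> 0 then t else \<beta> t e0)" for t
  have "strict_mono f"
  proof (rule strict_monoI)
    fix s t :: real assume st: "s < t"
    show "f s < f t"
      using st b(3)[of t e0] b(5)[of t s e0] e0 by (auto simp: f_def not_le)
  qed
  moreover have "surj f"
  proof (rule surjI)
    fix y show "f (if y \<le> 0 then y else (SOME a. 0 < a \<and> \<beta> a e0 = y)) = y"
    proof (cases "y \<le> 0")
      case False
      then have "\<exists>a. 0 < a \<and> \<beta> a e0 = y" using b(6)[of y e0] e0 by auto
      from someI_ex[OF this] False show ?thesis by (simp add: f_def)
    qed (simp add: f_def)
  qed
  moreover have "\<phi> (a *\<^sub>R e) = f a *\<^sub>R \<tau> e" if "0 < a" "cs_atom e" for a e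
    using that b(4)[OF that] scale_independent[OF b(1) bij_betw_imp_inj_on[OF b(2)] b(3,4) that e0] by (simp add: f_def)
  moreover have "f 0 = 0" by (simp add: f_def)
  ultimately show ?thesis using b(2) by blast
qed

text \<open>q is the supremum of the images of the atoms below p. The risk is an extra atom, \<tau>
  e below q with e not below p. The element \<open>\<phi> p\<close> excludes it: with E its family
  and l in [0, c), all those images and hence q lie below 1 - E l, so \<open>c \<tau> e\<close> is
  below \<open>\<phi> p\<close>.\<close>

lemma iso_atoms_extend:
  assumes c: "0 < c" and at: "\<And>e. cs_atom e \<Longrightarrow> cs_atom (\<tau> e)"
    and \<tau>: "\<And>e. cs_atom e \<Longrightarrow> \<phi> e = c *\<^sub>R \<tau> e" and p: "cs_proj p"
  shows "\<exists>q. cs_proj q \<and> (\<forall>e. cs_atom e \<longrightarrow> (cs_le e p \<longleftrightarrow> cs_le (\<tau> e) q))"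
proof -
  obtain q where q: "cs_proj q"
    "\<And>r. cs_proj r \<Longrightarrow> cs_le q r \<longleftrightarrow> (\<forall>f\<in>\<tau> ` {e. cs_atom e \<and> cs_le e p}. cs_le f r)"
    using proj_lub_exists[OF aw_factor_aw[OF facB], of "\<tau> ` {e. cs_atom e \<and> cs_le e p}"] at cs_atom_proj by blast
  have z: "cs_pos (\<phi> p)" by (rule pos[OF cs_proj_pos[OF p]])
  have iff: "cs_le e p \<longleftrightarrow> (\<forall>l. 0 \<le> l \<and> l < c \<longrightarrow> cs_le (\<tau> e) (1 - spectral_family (\<phi> p) l))"
    if e: "cs_atom e" for e
  proof -
    have "cs_le e p \<longleftrightarrow> spectral_le e p"
      using point_le_scaleR_proj_iff[OF facA IA e p, of 1 1] by simp
    also have "\<dots> \<longleftrightarrow> spectral_le (c *\<^sub>R \<tau> e) (\<phi> p)"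
      using le[OF cs_proj_pos[OF cs_atom_proj[OF e]] cs_proj_pos[OF p]] \<tau>[OF e] by simp
    also have "\<dots> \<longleftrightarrow> (\<forall>l. 0 \<le> l \<and> l < c \<longrightarrow> cs_le (\<tau> e) (1 - spectral_family (\<phi> p) l))"
      by (rule scaleR_proj_le_iff[OF facB IB z cs_atom_proj[OF at[OF e]] less_imp_le[OF c]])
    finally show ?thesis .
  qed
  show ?thesis
  proof (intro exI[of _ q] conjI allI impI q(1) iffI)
    fix e assume "cs_atom e" "cs_le e p"
    then show "cs_le (\<tau> e) q" using q(2)[OF q(1)] cs_le_refl[OF cs_proj_sa[OF q(1)]] by blast
  next
    fix e assume e: "cs_atom e" "cs_le (\<tau> e) q"
    have "cs_le (\<tau> e) (1 - spectral_family (\<phi> p) l)" if l: "0 \<le> l \<and> l < c" for l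
    proof -
      have "cs_le q (1 - spectral_family (\<phi> p) l)"
        using q(2)[OF cs_proj_compl[OF spectral_family_proj[OF facB IB z]]] iff l by blast
      then show ?thesis using e(2) cs_le_trans by blast
    qed
    then show "cs_le e p" using iff[OF e(1)] by blast
  qed
qed

end

section \<open>The canonical form\<close>

lemma proj_eqI_atoms:
  fixes p q :: "'a::cstar_algebra"
  assumes "aw_factor TYPE('a)" "aw_typeI TYPE('a)" "cs_proj p" "cs_proj q"
    and "\<And>e. cs_atom e \<Longrightarrow> cs_le e p \<longleftrightarrow> cs_le e q"
  shows "p = q"
  using atomistic[OF assms(1,2,3,4)] atomistic[OF assms(1,2,4,3)] assms(5) cs_le_antisym by blast

lemma strict_mono_surj_continuous:
  fixes f :: "real \<Rightarrow> real"
  assumes "strict_mono f" "surj f" shows "continuous_on UNIV f"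
  by (rule continuous_onI_mono) (use assms in \<open>auto simp: strict_mono_less_eq\<close>)

theorem theorem4p5:
  fixes \<phi> :: "'a::cstar_algebra \<Rightarrow> 'b::cstar_algebra"
  assumes "aw_factor TYPE('a)" and "aw_typeI TYPE('a)"
    and "aw_factor TYPE('b)" and "aw_typeI TYPE('b)"
    and "spectral_order_iso \<phi> {x. cs_pos x} {y. cs_pos y}"
  shows "\<exists>(f::real \<Rightarrow> real) (\<tau>::'a \<Rightarrow> 'b).
           bij_betw f {0..} {0..} \<and> strict_mono_on {0..} f \<and> proj_iso \<tau> \<and>
           (\<forall>x. cs_pos x \<longrightarrow> \<phi> x = Theta \<tau> (cfc f x))"
proof -
  note A = assms(1,2) and B = assms(3,4) and iso = assms(5)
  note aw = aw_factor_aw[OF assms(1)] aw_factor_aw[OF assms(3)]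
  define \<psi> where "\<psi> = inv_into {x. cs_pos x} \<phi>"
  have inv: "spectral_order_iso \<psi> {y. cs_pos y} {x. cs_pos x}" unfolding \<psi>_def by (rule spectral_order_iso_inv[OF iso])
  have \<psi>\<phi>: "\<psi> (\<phi> x) = x" if "cs_pos x" for x
    using that iso unfolding \<psi>_def spectral_order_iso_def bij_betw_def by (simp add: inv_into_f_f)
  obtain f \<tau> where f: "strict_mono f" "surj f" "f 0 = 0"
    and \<tau>: "bij_betw \<tau> {e. cs_atom e} {f. cs_atom f}"
    and \<phi>: "\<And>a e. 0 < a \<Longrightarrow> cs_atom e \<Longrightarrow> \<phi> (a *\<^sub>R e) = f a *\<^sub>R \<tau> e"
    using iso_points_uniform[OF A B iso] by blast
  define g where "g = inv f"
  have fg: "f (g l) = l" for l unfolding g_def by (rule surj_f_inv_f[OF f(2)])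
  have f0: "0 < f t \<longleftrightarrow> 0 < t" "0 \<le> f t \<longleftrightarrow> 0 \<le> t" for t
    using strict_mono_less[OF f(1), of 0 t] strict_mono_less_eq[OF f(1), of 0 t] f(3) by simp_all
  define \<sigma> where "\<sigma> = inv_into {e. cs_atom e} \<tau>"
  have at: "cs_atom (\<tau> e)" if "cs_atom e" for e using bij_betwE[OF \<tau>] that by blast
  have \<sigma>: "cs_atom (\<sigma> e)" "\<tau> (\<sigma> e) = e" if "cs_atom e" for e
    using that bij_betwE[OF bij_betw_inv_into[OF \<tau>]] bij_betw_inv_into_right[OF \<tau>] by (auto simp: \<sigma>_def)
  have \<sigma>\<tau>: "\<sigma> (\<tau> e) = e" if "cs_atom e" for e
    using that bij_betw_inv_into_left[OF \<tau>] by (auto simp: \<sigma>_def)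
  have g1: "0 < g 1" using f0(1)[of "g 1"] by (simp add: fg)
  have "\<phi> e = f 1 *\<^sub>R \<tau> e" if "cs_atom e" for e using \<phi>[of 1 e] that by simp
  then have "\<exists>q. cs_proj q \<and> (\<forall>e. cs_atom e \<longrightarrow> (cs_le e p \<longleftrightarrow> cs_le (\<tau> e) q))" if "cs_proj p" for p
    using iso_atoms_extend[OF A B iso _ at _ that] f0(1)[of 1] by simp
  then obtain T where T: "\<And>p. cs_proj p \<Longrightarrow> cs_proj (T p)"
    "\<And>p e. cs_proj p \<Longrightarrow> cs_atom e \<Longrightarrow> cs_le (\<tau> e) (T p) \<longleftrightarrow> cs_le e p" by metis
  \<comment> \<open>The extension lemma is applied to the inverse too, whose scale at coefficient 1
    is \<open>g 1\<close>; the resulting S inverts T.\<close>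
  have "\<psi> e = g 1 *\<^sub>R \<sigma> e" if e: "cs_atom e" for e
  proof -
    have "cs_pos (g 1 *\<^sub>R \<sigma> e)" using g1 \<sigma>[OF e] by (intro cs_pos_scaleR_proj cs_atom_proj) auto
    moreover have "\<phi> (g 1 *\<^sub>R \<sigma> e) = e" using \<phi>[OF g1 \<sigma>(1)[OF e]] \<sigma>(2)[OF e] by (simp add: fg)
    ultimately show ?thesis using \<psi>\<phi> by metis
  qed
  then have "\<exists>q. cs_proj q \<and> (\<forall>e. cs_atom e \<longrightarrow> (cs_le e p \<longleftrightarrow> cs_le (\<sigma> e) q))" if "cs_proj p" for p
    using iso_atoms_extend[where \<tau> = \<sigma>, OF B A inv g1 _ _ that] \<sigma>(1) by blast
  then obtain S where S: "\<And>p. cs_proj p \<Longrightarrow> cs_proj (S p)"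
    "\<And>p e. cs_proj p \<Longrightarrow> cs_atom e \<Longrightarrow> cs_le (\<sigma> e) (S p) \<longleftrightarrow> cs_le e p" by metis
  have S': "cs_le e (S p) \<longleftrightarrow> cs_le (\<tau> e) p" if "cs_proj p" "cs_atom e" for p e
    using S(2)[OF that(1) at[OF that(2)]] \<sigma>\<tau>[OF that(2)] by simp
  have TS: "T (S q) = q" if q: "cs_proj q" for q
  proof (rule proj_eqI_atoms[OF B T(1)[OF S(1)[OF q]] q])
    fix e :: 'b assume e: "cs_atom e"
    show "cs_le e (T (S q)) \<longleftrightarrow> cs_le e q"
      using T(2)[OF S(1)[OF q] \<sigma>(1)[OF e]] S(2)[OF q e] \<sigma>(2)[OF e] by simp
  qed
  have ST: "S (T p) = p" if p: "cs_proj p" for p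
  proof (rule proj_eqI_atoms[OF A S(1)[OF T(1)[OF p]] p])
    fix e :: 'a assume e: "cs_atom e"
    show "cs_le e (S (T p)) \<longleftrightarrow> cs_le e p" using S'[OF T(1)[OF p] e] T(2)[OF p e] by simp
  qed
  have Tle: "cs_le (T p) (T q) \<longleftrightarrow> cs_le p q" if p: "cs_proj p" and q: "cs_proj q" for p q
  proof
    assume "cs_le (T p) (T q)"
    then show "cs_le p q" using T(2)[OF p] T(2)[OF q] cs_le_trans by (intro atomistic[OF A p q]) blast
  next
    assume le: "cs_le p q"
    show "cs_le (T p) (T q)"
    proof (rule atomistic[OF B T(1)[OF p] T(1)[OF q]])
      fix e assume e: "cs_atom e" "cs_le e (T p)"
      then have "cs_le (\<sigma> e) p" using T(2)[OF p \<sigma>(1)[OF e(1)]] \<sigma>(2)[OF e(1)] by simp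
      then have "cs_le (\<sigma> e) q" using le cs_le_trans by blast
      then show "cs_le e (T q)" using T(2)[OF q \<sigma>(1)[OF e(1)]] \<sigma>(2)[OF e(1)] by simp
    qed
  qed
  define \<tau>' where "\<tau>' p = 1 - T (1 - p)" for p
  have \<tau>'p: "cs_proj (\<tau>' p)" if "cs_proj p" for p using that unfolding \<tau>'_def by (intro cs_proj_compl T(1))
  have iso': "proj_iso \<tau>'" unfolding proj_iso_def
  proof (intro conjI allI impI)
    show "bij_betw \<tau>' {p. cs_proj p} {q. cs_proj q}"
      by (rule bij_betw_byWitness[where f' = "\<lambda>q. 1 - S (1 - q)"])
         (auto simp: \<tau>'_def ST TS cs_proj_compl T(1) S(1))
    show "cs_le p q \<longleftrightarrow> cs_le (\<tau>' p) (\<tau>' q)" if "cs_proj p \<and> cs_proj q" for p q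
      using that unfolding \<tau>'_def by (simp add: cs_proj_le_compl_iff T(1) cs_proj_compl Tle)
  qed
  have "cs_le (T (S 1)) (T 1)" by (simp add: Tle S(1) cs_proj_le_1)
  then have "T 1 = 1" using TS[of 1] cs_proj_le_1[OF T(1)[OF cs_proj_1]] cs_le_antisym by simp
  then have \<tau>'0: "\<tau>' 0 = 0" by (simp add: \<tau>'_def)
  have cf: "continuous_on UNIV f" by (rule strict_mono_surj_continuous[OF f(1,2)])
  have "\<phi> x = Theta \<tau>' (cfc f x)" if x: "cs_pos x" for x
  proof -
    have \<phi>x: "cs_pos (\<phi> x)" by (rule iso_pos[OF iso x])
    have main: "spectral_family (\<phi> x) (f m) = \<tau>' (spectral_family x m)" if m: "0 \<le> m" for m
    proof -
      \<comment> \<open>The two projections are compared through the projections r below them, since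
        such statements can be read off from points.\<close>
      have iff: "cs_le r (spectral_family (\<phi> x) (f m)) \<longleftrightarrow> cs_le r (\<tau>' (spectral_family x m))"
        if r: "cs_proj r" for r
      proof -
        note pr = cs_proj_compl[OF r]
        have "cs_le r (spectral_family (\<phi> x) (f m)) \<longleftrightarrow>
          (\<forall>b e. f m < b \<and> cs_atom e \<and> spectral_le (b *\<^sub>R e) (\<phi> x) \<longrightarrow> cs_le e (1 - r))"
          using le_spectral_family_iff[OF B \<phi>x r] m by (simp add: f0)
        \<comment> \<open>Substitute b = f a and replace e by \<tau> e. The double complement is
          kept so that \<open>le_spectral_family_iff\<close> applies with
          \<open>1 - S (1 - r)\<close> in the role of r.\<close>
        also have "\<dots> \<longleftrightarrow> (\<forall>a e. m < a \<and> cs_atom e \<and> spectral_le (a *\<^sub>R e) x \<longrightarrow> cs_le e (1 - (1 - S (1 - r))))"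
        proof -
          have pt: "spectral_le (f a *\<^sub>R \<tau> e) (\<phi> x) \<longleftrightarrow> spectral_le (a *\<^sub>R e) x" if "m < a" "cs_atom e" for a e
            using iso_le[OF iso _ x, of "a *\<^sub>R e"] \<phi>[of a e] that m cs_pos_scaleR_proj[OF cs_atom_proj, of e a] by simp
          show ?thesis
          proof (intro iffI allI impI)
            fix a e assume *: "\<forall>b e. f m < b \<and> cs_atom e \<and> spectral_le (b *\<^sub>R e) (\<phi> x) \<longrightarrow> cs_le e (1 - r)"
              and a: "m < a \<and> cs_atom e \<and> spectral_le (a *\<^sub>R e) x"
            have "cs_le (\<tau> e) (1 - r)"
              using *[rule_format, of "f a" "\<tau> e"] a pt at strict_mono_less[OF f(1), of m a] by simp
            then show "cs_le e (1 - (1 - S (1 - r)))" using S'[OF pr] a by simp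
          next
            fix b e assume *: "\<forall>a e. m < a \<and> cs_atom e \<and> spectral_le (a *\<^sub>R e) x \<longrightarrow> cs_le e (1 - (1 - S (1 - r)))"
              and b: "f m < b \<and> cs_atom e \<and> spectral_le (b *\<^sub>R e) (\<phi> x)"
            have "m < g b" using strict_mono_less[OF f(1), of m "g b"] b by (simp add: fg)
            then have "spectral_le (g b *\<^sub>R \<sigma> e) x" using pt[of "g b" "\<sigma> e"] b \<sigma>[of e] by (simp add: fg)
            then have "cs_le (\<sigma> e) (S (1 - r))" using * \<open>m < g b\<close> \<sigma>(1) b by fastforce
            then show "cs_le e (1 - r)" using S(2)[OF pr] b by simp
          qed
        qed
        also have "\<dots> \<longleftrightarrow> cs_le (1 - S (1 - r)) (spectral_family x m)"
          using le_spectral_family_iff[OF A x cs_proj_compl[OF S(1)[OF pr]] m] by simp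
        also have "\<dots> \<longleftrightarrow> cs_le (1 - spectral_family x m) (S (1 - r))"
          using cs_proj_le_compl_iff[OF spectral_family_proj[OF A x] cs_proj_compl[OF S(1)[OF pr]], of m] by simp
        also have "\<dots> \<longleftrightarrow> cs_le (T (1 - spectral_family x m)) (1 - r)"
          using Tle[OF cs_proj_compl[OF spectral_family_proj[OF A x]] S(1)[OF pr]] TS[OF pr] by simp
        also have "\<dots> \<longleftrightarrow> cs_le r (\<tau>' (spectral_family x m))" unfolding \<tau>'_def
          by (rule cs_proj_le_compl_swap[OF T(1)[OF cs_proj_compl[OF spectral_family_proj[OF A x]]] r])
        finally show ?thesis .
      qed
      have p1: "cs_proj (spectral_family (\<phi> x) (f m))" by (rule spectral_family_proj[OF B \<phi>x])
      have p2: "cs_proj (\<tau>' (spectral_family x m))" by (rule \<tau>'p[OF spectral_family_proj[OF A x]])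
      show ?thesis
        using iff[OF p1] iff[OF p2] cs_le_refl[OF cs_proj_sa[OF p1]] cs_le_refl[OF cs_proj_sa[OF p2]] cs_le_antisym by blast
    qed
    have sf: "spectral_family (\<phi> x) l = \<tau>' (spectral_family (cfc f x) l)" for l
    proof (cases "l < 0")
      case True
      \<comment> \<open>f fixes 0, so g keeps negative levels negative; there both families vanish,
        and \<open>\<tau>' 0 = 0\<close> matches them.\<close>
      then have "g l < 0" using f0(2)[of "g l"] by (simp add: fg)
      then show ?thesis
        using True spectral_family_neg[OF aw(2) \<phi>x] spectral_family_neg[OF aw(1) x]
          spectral_family_cfc[OF aw(1) cs_pos_sa[OF x] cf f(1) fg] \<tau>'0 by simp
    next
      case False
      then have "0 \<le> g l" using f0(2)[of "g l"] by (simp add: fg)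
      then show ?thesis
        using main[of "g l"] spectral_family_cfc[OF aw(1) cs_pos_sa[OF x] cf f(1) fg] by (simp add: fg)
    qed
    show ?thesis unfolding Theta_def
    proof (rule the_equality[symmetric])
      show "cs_sa (\<phi> x) \<and> (\<forall>l. spectral_family (\<phi> x) l = \<tau>' (spectral_family (cfc f x) l))"
        using sf cs_pos_sa[OF \<phi>x] by blast
      fix y assume y: "cs_sa y \<and> (\<forall>l. spectral_family y l = \<tau>' (spectral_family (cfc f x) l))"
      then have "spectral_family y = spectral_family (\<phi> x)" by (intro ext) (simp only: sf)
      then show "y = \<phi> x" using spectral_family_inj[OF aw(2) _ cs_pos_sa[OF \<phi>x]] y by blast
    qed
  qed
  moreover have "bij_betw f {0..} {0..}"
  proof (rule bij_betw_byWitness[where f' = g])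
    have "g (f t) = t" for t using strict_mono_eq[OF f(1), of "g (f t)" t] by (simp add: fg)
    then show "\<forall>t\<in>{0..}. g (f t) = t" by blast
    show "\<forall>l\<in>{0..}. f (g l) = l" by (simp add: fg)
    show "f ` {0..} \<subseteq> {0..}" by (auto simp: f0)
    show "g ` {0..} \<subseteq> {0..}" using f0(2)[of "g _"] by (auto simp: fg)
  qed
  moreover have "strict_mono_on {0..} f" using f(1) by (simp add: strict_mono_on_def strict_mono_def)
  ultimately show ?thesis using iso' by blast
qed

end
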